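(* If $C^{(n)}$ is distributed as the cycle counts of a uniformly random permutation of $[n]$ (ESF$(1)$), then \[\sup_{x\in\mathbb{R}}\left|\mathbb{P}\!\left(\frac{\log\mathsf{invol}_n(C^{(n)})-\frac12\log^2 n}{\sqrt{\frac13\log^3 n}}\le x\right)-\Phi(x)-\frac{3^{3/2}}{24\sqrt{2\pi}}\frac{(1-x^2)e^{-x^2/2}}{\sqrt{\log n}}\right|\ll\left(\frac{\log\log n}{\log n}\right)^{\frac23},\] where $\Phi$ is the standard normal distribution function.
   Context: Cycle counts: $c_k$ = number of cycles of length $k$. For a nonnegative integer vector $a$: $\mathsf{invol}_n(a)=\prod_{k=1}^n k^{a_k}\sum_{j=0}^{\lfloor a_k/2\rfloor}\frac{(a_k)_{2j}}{(2k)^j j!}$ with $(x)_r=x(x-1)\cdots(x-r+1)$; for the cycle counts of $\sigma\in\mathfrak{S}_n$ this equals the number of ordered pairs of involutions $(\tau_1,\tau_2)$ in $\mathfrak{S}_n$ with $\sigma=\tau_2\circ\tau_1$. The symbol $\ll$ means bounded by a constant multiple, for all sufficiently large $n$. *)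

theory Defs
  imports "HOL-Analysis.Analysis" "HOL-Combinatorics.Permutations" "HOL-Combinatorics.Orbits"
begin

definition cycle_count :: "nat \<Rightarrow> (nat \<Rightarrow> nat) \<Rightarrow> nat \<Rightarrow> nat" where
  "cycle_count n \<sigma> k = card {orbit \<sigma> x | x. x \<in> {1..n} \<and> card (orbit \<sigma> x) = k}"

definition falling :: "nat \<Rightarrow> nat \<Rightarrow> nat" where
  "falling x r = (\<Prod>i<r. x - i)"

definition invol :: "nat \<Rightarrow> (nat \<Rightarrow> nat) \<Rightarrow> real" where
  "invol n a = (\<Prod>k\<in>{1..n}. real k ^ a k *
      (\<Sum>j\<in>{0..a k div 2}. real (falling (a k) (2*j)) / ((2 * real k) ^ j * fact j)))"

definition Phi :: "real \<Rightarrow> real" where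
  "Phi x = integral {..x} (\<lambda>t. exp (- t\<^sup>2 / 2) / sqrt (2 * pi))"

definition invol_cdf :: "nat \<Rightarrow> real \<Rightarrow> real" where
  "invol_cdf n x = real (card {\<sigma>. \<sigma> permutes {1..n} \<and>
      (ln (invol n (cycle_count n \<sigma>)) - (ln (real n))\<^sup>2 / 2) / sqrt ((ln (real n)) ^ 3 / 3) \<le> x})
     / fact n"

end

theory Submission
  imports Defs "HOL-Probability.Probability" "HOL-Real_Asymp.Real_Asymp"
begin

text \<open>
  Write \<open>L = ln n\<close>. Since \<open>ln invol = \<Sum>k. C\<^sub>k ln k + O(1)\<close> in mean, Markov's inequality reduces the claim to an
  Edgeworth expansion for \<open>X = \<Sum>k. C\<^sub>k ln k\<close>. The expectation \<open>E (exp (i \<theta> X))\<close> is the coefficient \<open>M\<^sub>n\<close> of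
  \<open>z^n\<close> in \<open>exp (\<Sum>k. f k z^k / k)\<close> with \<open>f k = k^(i \<theta>)\<close>. Splitting the exponent at \<open>b\<close>, about \<open>n / L^4\<close>, gives
  \<open>M\<^sub>n = q\<^sub>n exp (\<Sum>k\<le>b. f k / k) + O(b / n)\<close>, where \<open>q\<close> comes from the long cycles and varies slowly because
  of the recurrence \<open>n q\<^sub>n = \<Sum>k. f k q\<^sub>n\<^sub>-\<^sub>k\<close>. As \<open>q\<^sub>n\<close> is at most \<open>1 / b\<close>, this bounds \<open>M\<^sub>n\<close> for large \<open>\<theta>\<close>; comparing
  with the weight that is 1 on short cycles gives \<open>M\<^sub>n = exp (\<Sum>k\<le>n. (f k - 1) / k)\<close> up to terms of second order
  in \<open>\<theta> L\<close>, and the exponent is an integral of \<open>exp (i \<theta> u) - 1\<close> over \<open>[0, L]\<close> up to \<open>O(\<theta>)\<close>. Esseen's smoothing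
  argument at frequency \<open>L^(2/3)\<close> turns this into the bound on the distribution function.
\<close>

section \<open>Coefficients of the exponential generating function of cycle weights\<close>

text \<open>The obstacle is that the cycle counts are tied together by
  \<open>\<Sum>k. k C_k = n\<close>. Were they independent Poisson variables with means
  \<open>1 / k\<close>, then \<open>E (exp (i \<theta> X))\<close> would be exactly
  \<open>exp (\<Sum>k\<le>n. (f k - 1) / k)\<close>. The dependence sits in \<open>q_n\<close>,
  which is never computed: it is either bounded, or eliminated between two weights with the same
  long part. The splitting error is at most of order \<open>L b / n\<close>, so \<open>b\<close>
  near \<open>n / L^4\<close> makes it \<open>L^(-3)\<close> while \<open>ln (n / b)\<close> stays
  \<open>O(ln L)\<close>. This error does not vanish with \<theta>, whereas inversion divides by the
  frequency; hence a first-moment bound is used next to 0. The limiting exponent belongs to a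
  compound Poisson law with intensity \<open>du\<close> on \<open>[0, L]\<close>, whose r-th
  cumulant is \<open>L^(r+1) / (r+1)\<close>. This gives the centring \<open>L^2 / 2\<close>, the
  variance \<open>L^3 / 3\<close>, and from the third cumulant \<open>L^4 / 4\<close> the constant
  \<open>3^(3/2) / 24\<close>. The cutoff \<open>L^(2/3)\<close> refers to the standardized
  frequency, and its reciprocal is the dominant error.\<close>

fun cyc :: "(nat \<Rightarrow> 'a::real_normed_field) \<Rightarrow> nat \<Rightarrow> 'a" where
  "cyc f n = (if n = 0 then 1 else (\<Sum>k<n. f (Suc k) * cyc f (n - Suc k)) / of_nat n)"

declare cyc.simps [simp del]

lemma cyc_0 [simp]: "cyc f 0 = 1"
  by (simp add: cyc.simps)

lemma cyc_Suc: "of_nat (Suc n) * cyc f (Suc n) = (\<Sum>k\<le>n. f (Suc k) * cyc f (n - k))"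
  by (subst cyc.simps) (simp add: lessThan_Suc_atMost del: of_nat_Suc)

lemma cyc_unique:
  assumes "a 0 = 1" "\<And>n. of_nat (Suc n) * a (Suc n) = (\<Sum>k\<le>n. f (Suc k) * a (n - k))"
  shows "a n = cyc f n"
proof (induction n rule: less_induct)
  case (less n)
  show ?case
  proof (cases n)
    case 0
    then show ?thesis using assms by simp
  next
    case (Suc m)
    have "of_nat (Suc m) * a (Suc m) = (of_nat (Suc m) * cyc f (Suc m) :: 'a)"
      unfolding assms(2) cyc_Suc using less Suc by (intro sum.cong) auto
    then show ?thesis using Suc by (simp del: of_nat_Suc)
  qed
qed

lemma cyc_cong:
  assumes "\<And>k. 1 \<le> k \<Longrightarrow> k \<le> n \<Longrightarrow> f k = g k"
  shows "cyc f n = cyc g n"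
  using assms
proof (induction n rule: less_induct)
  case (less n)
  show ?case
    by (subst (1 2) cyc.simps)
       (auto intro!: sum.cong arg_cong2[where f = "(*)"] less.prems less.IH)
qed

lemma cyc_one [simp]: "cyc (\<lambda>_. 1) n = 1"
  by (rule cyc_unique[symmetric, where a = "\<lambda>_. 1"]) auto

text \<open>The recurrence is the linear differential equation \<open>A' = F A\<close>,
  \<open>A(0) = 1\<close>, solved by the exponential of a power series; this identifies
  \<open>cyc f\<close> with the coefficients of \<open>exp (\<Sum>k. f k z^k / k)\<close>. The value
  \<open>f 0\<close> never enters.\<close>

lemma fps_deriv_cyc:
  "fps_deriv (Abs_fps (cyc f)) = Abs_fps (\<lambda>k. f (Suc k)) * Abs_fps (cyc f)"
  by (rule fps_ext) (simp add: fps_mult_nth cyc_Suc atLeast0AtMost del: of_nat_Suc)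

text \<open>Exponentials turn sums into products: the Cauchy product solves the differential
  equation belonging to \<open>f + g\<close>, and the recurrence has only one solution.\<close>

lemma cyc_add: "cyc (\<lambda>k. f k + g k) n = (\<Sum>i\<le>n. cyc f i * cyc g (n - i))"
proof -
  define P where "P = Abs_fps (cyc f) * Abs_fps (cyc g)"
  have D: "fps_deriv P = Abs_fps (\<lambda>k. f (Suc k) + g (Suc k)) * P"
  proof -
    have "Abs_fps (\<lambda>k. f (Suc k) + g (Suc k)) = Abs_fps (\<lambda>k. f (Suc k)) + Abs_fps (\<lambda>k. g (Suc k))"
      by (rule fps_ext) simp
    then show ?thesis
      unfolding P_def fps_deriv_mult fps_deriv_cyc by (simp add: algebra_simps)
  qed
  have "fps_nth P n = cyc (\<lambda>k. f k + g k) n"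
  proof (rule cyc_unique)
    show "fps_nth P 0 = 1" by (simp add: P_def)
    fix n
    have "fps_nth (fps_deriv P) n = (\<Sum>k\<le>n. (f (Suc k) + g (Suc k)) * fps_nth P (n - k))"
      unfolding D by (simp add: fps_mult_nth atLeast0AtMost)
    then show "of_nat (Suc n) * fps_nth P (Suc n) = (\<Sum>k\<le>n. (f (Suc k) + g (Suc k)) * fps_nth P (n - k))"
      by simp
  qed
  then show ?thesis by (simp add: P_def fps_mult_nth atLeast0AtMost)
qed

text \<open>The recurrence only adds and multiplies, so a majorant of the weights yields a majorant
  of the solution. This is the passage from complex weights to real estimates.\<close>

lemma norm_cyc_le:
  fixes g :: "nat \<Rightarrow> real"
  assumes "\<And>k. 1 \<le> k \<Longrightarrow> k \<le> n \<Longrightarrow> norm (f k) \<le> g k"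
  shows "norm (cyc f n) \<le> cyc g n"
  using assms
proof (induction n rule: less_induct)
  case (less n)
  show ?case
  proof (cases "n = 0")
    case False
    have "norm (\<Sum>k<n. f (Suc k) * cyc f (n - Suc k)) \<le> (\<Sum>k<n. g (Suc k) * cyc g (n - Suc k))"
    proof (rule sum_norm_le)
      fix k assume "k \<in> {..<n}"
      then have *: "norm (f (Suc k)) \<le> g (Suc k)" "norm (cyc f (n - Suc k)) \<le> cyc g (n - Suc k)"
        using less by auto
      then show "norm (f (Suc k) * cyc f (n - Suc k)) \<le> g (Suc k) * cyc g (n - Suc k)"
        unfolding norm_mult by (intro mult_mono) (auto intro: order_trans[OF norm_ge_zero])
    qed
    then show ?thesis
      using False by (subst (1 2) cyc.simps) (simp add: norm_divide divide_right_mono)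
  qed simp
qed

lemma cyc_nonneg: "(\<And>k. f k \<ge> 0) \<Longrightarrow> cyc f n \<ge> (0::real)"
  using norm_cyc_le[of n "\<lambda>k. 0::real" f] by (auto intro: order_trans[OF norm_ge_zero])

section \<open>Coefficients of truncated exponentials and their total sums\<close>

lemma cyc_single:
  assumes "m \<ge> 1"
  shows "cyc (\<lambda>k. if k = m then a else 0) n
    = (if m dvd n then (a / of_nat m) ^ (n div m) / fact (n div m) else 0)"
proof (rule cyc_unique[symmetric])
  fix n
  let ?a = "\<lambda>n. if m dvd n then (a / of_nat m) ^ (n div m) / fact (n div m) else 0"
  \<comment> \<open>The weight sits at \<open>m\<close> and the recurrence reads
    \<open>f (Suc k)\<close>, so only \<open>k = m - 1\<close> survives.\<close>
  have "(\<Sum>k\<le>n. (if Suc k = m then a else 0) * ?a (n - k))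
      = (\<Sum>k\<le>n. if k = m - 1 then a * ?a (n - (m - 1)) else 0)"
    using assms by (intro sum.cong) auto
  also have "\<dots> = (if m - 1 \<le> n then a * ?a (n - (m - 1)) else 0)"
    by (subst sum.delta) auto
  also have "\<dots> = of_nat (Suc n) * ?a (Suc n)"
  proof (cases "m dvd Suc n")
    case True
    then obtain j where j: "Suc n = m * j" by auto
    then have "j \<noteq> 0" by (metis mult_0_right nat.distinct(1))
    then obtain i where i: "j = Suc i" by (cases j) auto
    have n: "n - (m - 1) = m * i" "m - 1 \<le> n"
      using j i assms by (simp_all add: algebra_simps)
    have "of_nat (Suc n) = (of_nat m * of_nat (Suc i) :: 'a)"
      unfolding j i by (rule of_nat_mult)
    moreover have "of_nat m \<noteq> (0::'a)" using assms by simp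
    ultimately show ?thesis
      using n assms
      by (simp add: j i fact_Suc divide_simps del: of_nat_Suc mult_Suc_right)
  next
    case False
    have "\<not> m dvd n - (m - 1)" if "m - 1 \<le> n"
    proof
      assume "m dvd n - (m - 1)"
      then have "m dvd n - (m - 1) + m" by simp
      also have "n - (m - 1) + m = Suc n" using that assms by simp
      finally show False using False by simp
    qed
    then show ?thesis using False by simp
  qed
  finally show "of_nat (Suc n) * ?a (Suc n) = (\<Sum>k\<le>n. (if Suc k = m then a else 0) * ?a (n - k))" ..
qed simp

lemma sums_cyc_single:
  fixes a :: "'a :: {real_normed_field, banach}"
  assumes "m \<ge> 1"
  shows "cyc (\<lambda>k. if k = m then a else 0) sums exp (a / of_nat m)"
proof -
  have "(\<lambda>j. (a / of_nat m) ^ j /\<^sub>R fact j) sums exp (a / of_nat m)"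
    by (rule exp_converges)
  moreover have "(\<lambda>j. (a / of_nat m) ^ j /\<^sub>R fact j) = (\<lambda>j. cyc (\<lambda>k. if k = m then a else 0) (m * j))"
    using assms by (auto simp: cyc_single scaleR_conv_of_real field_simps)
  ultimately have "(\<lambda>j. cyc (\<lambda>k. if k = m then a else 0) (m * j)) sums exp (a / of_nat m)" by simp
  then show ?thesis
    by (subst (asm) sums_mono_reindex)
       (use assms in \<open>auto simp: strict_mono_def cyc_single elim!: dvdE\<close>)
qed

lemma cyc_truncate_0: "cyc (\<lambda>k. if k \<le> 0 then f k else 0) = (\<lambda>n. if n = 0 then 1 else 0)"
  by (rule ext) (subst cyc.simps, auto)

lemma cyc_truncate_Suc:
  "cyc (\<lambda>k. if k \<le> Suc b then f k else 0) = (\<lambda>n. \<Sum>i\<le>n.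
     cyc (\<lambda>k. if k \<le> b then f k else 0) i * cyc (\<lambda>k. if k = Suc b then f (Suc b) else 0) (n - i))"
  unfolding cyc_add[symmetric] by (intro ext cyc_cong) auto

text \<open>Evaluation at \<open>z = 1\<close>: admitting one more index multiplies the sums, and
  nonnegativity supplies the absolute convergence that the Cauchy product demands. General weights
  then borrow their absolute convergence from this case by majorisation.\<close>

lemma sums_cyc_nonneg:
  fixes g :: "nat \<Rightarrow> real"
  assumes "\<And>k. g k \<ge> 0"
  shows "cyc (\<lambda>k. if k \<le> b then g k else 0) sums exp (\<Sum>k=1..b. g k / k)"
proof (induction b)
  case 0
  show ?case using sums_single[of 0 "\<lambda>_. 1::real"] unfolding cyc_truncate_0 by simp
next
  case (Suc b)
  let ?A = "cyc (\<lambda>k. if k \<le> b then g k else 0)" and ?B = "cyc (\<lambda>k. if k = Suc b then g (Suc b) else 0)"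
  have B: "?B sums exp (g (Suc b) / Suc b)" by (rule sums_cyc_single) simp
  have nn: "?A n \<ge> 0" "?B n \<ge> 0" for n using assms by (auto intro!: cyc_nonneg)
  have "(\<lambda>n. \<Sum>i\<le>n. ?A i * ?B (n - i)) sums (suminf ?A * suminf ?B)"
    by (rule Cauchy_product_sums) (use Suc B nn in \<open>auto simp: sums_iff\<close>)
  also have "suminf ?A * suminf ?B = exp (\<Sum>k=1..Suc b. g k / k)"
    using Suc B by (simp add: sums_iff exp_add)
  finally show ?case unfolding cyc_truncate_Suc .
qed

lemma summable_norm_cyc:
  fixes f :: "nat \<Rightarrow> 'a::real_normed_field"
  shows "summable (\<lambda>n. norm (cyc (\<lambda>k. if k \<le> b then f k else 0) n))"
  by (rule summable_comparison_test'[where N = 0, OF sums_summable[OF sums_cyc_nonneg[of "\<lambda>k. norm (f k)" b]]])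
     (auto intro!: norm_cyc_le)

lemma sums_cyc:
  fixes f :: "nat \<Rightarrow> 'a :: {real_normed_field, banach}"
  shows "cyc (\<lambda>k. if k \<le> b then f k else 0) sums exp (\<Sum>k=1..b. f k / of_nat k)"
proof (induction b)
  case 0
  show ?case using sums_single[of 0 "\<lambda>_. 1::'a"] unfolding cyc_truncate_0 by simp
next
  case (Suc b)
  let ?A = "cyc (\<lambda>k. if k \<le> b then f k else 0)" and ?B = "cyc (\<lambda>k. if k = Suc b then f (Suc b) else 0)"
  have B: "?B sums exp (f (Suc b) / of_nat (Suc b))" by (rule sums_cyc_single) simp
  \<comment> \<open>A single weight at \<open>Suc b\<close> is already truncated at
    \<open>Suc b\<close>, the shape in which absolute summability is known.\<close>
  have "summable (\<lambda>n. norm (cyc (\<lambda>k. if k \<le> Suc b then if k = Suc b then f (Suc b) else 0 else 0) n))"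
    by (rule summable_norm_cyc)
  also have "(\<lambda>k. if k \<le> Suc b then if k = Suc b then f (Suc b) else 0 else 0)
     = (\<lambda>k. if k = Suc b then f (Suc b) else 0)" by auto
  finally have sB: "summable (\<lambda>n. norm (?B n))" .
  have "(\<lambda>n. \<Sum>i\<le>n. ?A i * ?B (n - i)) sums (suminf ?A * suminf ?B)"
    by (rule Cauchy_product_sums) (use summable_norm_cyc sB in auto)
  also have "suminf ?A * suminf ?B = exp (\<Sum>k=1..Suc b. f k / of_nat k)"
    using Suc B by (simp add: sums_iff exp_add)
  finally show ?case unfolding cyc_truncate_Suc .
qed

section \<open>Separating short and long cycles\<close>

lemma inverse_Suc_le_ln: "1 \<le> k \<Longrightarrow> 1 / real (Suc k) \<le> ln (real (Suc k)) - ln (real k)"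
  using ln_diff_le[of "real k" "real (Suc k)"] by (simp add: field_simps)

lemma harm_interval_le:
  assumes "1 \<le> b" "b \<le> n"
  shows "(\<Sum>k\<in>{b<..n}. 1 / real k) \<le> ln (real n) - ln (real b)"
  using assms(2)
proof (induction n rule: dec_induct)
  case (step n)
  have "{b<..Suc n} = insert (Suc n) {b<..n}" using step by auto
  then show ?case using step inverse_Suc_le_ln[of n] assms by simp
qed simp

lemma harm_upper: "1 \<le> b \<Longrightarrow> (\<Sum>k=1..b. 1 / real k) \<le> 1 + ln (real b)"
proof -
  assume b: "1 \<le> b"
  then have "{1..b} = insert 1 {1<..b}" by auto
  then show ?thesis using harm_interval_le[of 1 b] b by simp
qed

text \<open>With weight 1 on all \<open>k > b\<close> the recurrence says that \<open>j q_j\<close>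
  is the sum of the \<open>q_i\<close> with \<open>i < j - b\<close>. A partial sum up to
  \<open>x\<close> does not see weights beyond \<open>x\<close>, so it is at most the total sum of
  the truncated exponential, \<open>exp (ln x - ln b)\<close>.\<close>

lemma cyc_large_le:
  fixes g :: "nat \<Rightarrow> 'a::real_normed_field"
  assumes b: "b \<ge> 1" and g1: "\<And>k. norm (g k) \<le> 1" and g0: "\<And>k. k \<le> b \<Longrightarrow> g k = 0"
    and j: "j \<ge> 1"
  shows "norm (cyc g j) \<le> 1 / real b"
proof -
  define u :: "nat \<Rightarrow> real" where "u k = (if k \<le> b then 0 else 1)" for k
  have unn: "u k \<ge> 0" for k by (simp add: u_def)
  have cnn: "cyc u i \<ge> 0" for i by (intro cyc_nonneg unn)
  \<comment> \<open>Adding \<open>b\<close> to the numerator covers \<open>x < b\<close>, where the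
    sum is 1, and still gives at most \<open>j / b\<close> at \<open>x = j - b - 1\<close>.\<close>
  have partial: "(\<Sum>i\<le>x. cyc u i) \<le> (real x + real b) / real b" for x
  proof -
    let ?v = "\<lambda>k. if k \<le> x then u k else 0"
    have "(\<Sum>i\<le>x. cyc u i) = (\<Sum>i\<le>x. cyc ?v i)"
      by (intro sum.cong refl cyc_cong) auto
    also have "\<dots> \<le> suminf (cyc ?v)"
      using sums_cyc_nonneg[OF unn, of x] by (intro sum_le_suminf cyc_nonneg) (auto simp: sums_iff unn)
    also have "\<dots> = exp (\<Sum>k=1..x. u k / k)"
      using sums_cyc_nonneg[OF unn, of x] by (simp add: sums_iff)
    also have "\<dots> \<le> (real x + real b) / real b"
    proof (cases "b \<le> x")
      case True
      have "(\<Sum>k=1..x. u k / k) = (\<Sum>k\<in>{b<..x}. 1 / real k)"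
        using b by (intro sum.mono_neutral_cong_right) (auto simp: u_def)
      also have "exp \<dots> \<le> exp (ln (real x) - ln (real b))"
        using harm_interval_le[OF b True] by simp
      also have "\<dots> = real x / real b"
        using b True by (simp add: exp_diff)
      finally show ?thesis using b by (simp add: add_divide_distrib)
    next
      case False
      then have "(\<Sum>k=1..x. u k / k) = 0" by (intro sum.neutral) (auto simp: u_def)
      then show ?thesis using b by (simp add: field_simps)
    qed
    finally show ?thesis .
  qed
  have "norm (cyc g j) \<le> cyc u j"
    using g1 g0 by (intro norm_cyc_le) (auto simp: u_def)
  also have "\<dots> \<le> 1 / real b"
  proof -
    have "real j * cyc u j = (\<Sum>k<j. u (Suc k) * cyc u (j - Suc k))"
      using j by (subst cyc.simps) simp
    also have "\<dots> = (\<Sum>i<j. u (j - i) * cyc u i)"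
      by (subst sum.nat_diff_reindex[symmetric]) (auto intro!: sum.cong)
    also have "\<dots> \<le> real j / real b"
    proof (cases "j \<le> b")
      case True
      then have "(\<Sum>i<j. u (j - i) * cyc u i) = 0"
        by (intro sum.neutral) (auto simp: u_def)
      then show ?thesis by simp
    next
      case False
      have "(\<Sum>i<j. u (j - i) * cyc u i) = (\<Sum>i\<le>j - b - 1. cyc u i)"
        using False by (intro sum.mono_neutral_cong_right) (auto simp: u_def)
      also have "\<dots> \<le> (real (j - b - 1) + real b) / real b" by (rule partial)
      also have "\<dots> \<le> real j / real b"
        using False b by (intro divide_right_mono) auto
      finally show ?thesis .
    qed
    finally show ?thesis using j b by (simp add: field_simps)
  qed
  finally show ?thesis .
qed

text \<open>Subtracting the recurrences at \<open>m\<close> and \<open>m + 1\<close> leaves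
  differences of consecutive weights. They are of size \<open>\<kappa> / k\<close>, except for the
  jump away from 0 at \<open>k = b\<close>.\<close>

lemma cyc_large_diff:
  fixes g :: "nat \<Rightarrow> 'a::real_normed_field"
  assumes b: "b \<ge> 1" and g1: "\<And>k. norm (g k) \<le> 1" and g0: "\<And>k. k \<le> b \<Longrightarrow> g k = 0"
    and gd: "\<And>k. k > b \<Longrightarrow> norm (g (Suc k) - g k) \<le> \<kappa> / real k" and k0: "\<kappa> \<ge> 0"
    and m: "b < m" "m \<le> n"
  shows "norm (cyc g (Suc m) - cyc g m) \<le> (2 + \<kappa> * (1 + ln (real n))) / (real b * real m)"
proof -
  have q: "norm (cyc g j) \<le> 1 / real b" if "j \<ge> 1" for j
    by (rule cyc_large_le) (use assms that in auto)
  have "of_nat (Suc m) * cyc g (Suc m) = (\<Sum>k\<le>m. g (Suc k) * cyc g (m - k))"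
    by (rule cyc_Suc)
  \<comment> \<open>The term \<open>k = 0\<close> drops out because \<open>g 1 = 0\<close>; both
    recurrences then run over the same coefficients \<open>cyc g (m - k)\<close>.\<close>
  also have "{..m} = insert 0 {1..m}" by auto
  finally have 1: "of_nat (Suc m) * cyc g (Suc m) = (\<Sum>k=1..m. g (Suc k) * cyc g (m - k))"
    using g0[of 1] b by simp
  have "of_nat m * cyc g m = (\<Sum>k<m. g (Suc k) * cyc g (m - Suc k))"
    using m by (subst cyc.simps) simp
  also have "\<dots> = (\<Sum>k=1..m. g k * cyc g (m - k))"
    by (rule sum.reindex_bij_witness[of _ "\<lambda>k. k - 1" Suc]) auto
  finally have 2: "of_nat m * cyc g m = (\<Sum>k=1..m. g k * cyc g (m - k))" .
  have 3: "of_nat m * (cyc g (Suc m) - cyc g m) =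
      (\<Sum>k=1..m. (g (Suc k) - g k) * cyc g (m - k)) - cyc g (Suc m)"
    using 1 2 by (simp add: algebra_simps sum_subtractf)
  have "real m * norm (cyc g (Suc m) - cyc g m)
      = norm (of_nat m * (cyc g (Suc m) - cyc g m))" by (simp add: norm_mult)
  also have "\<dots> \<le> (\<Sum>k=1..m. norm ((g (Suc k) - g k) * cyc g (m - k))) + 1 / real b"
    unfolding 3 by (intro order_trans[OF norm_triangle_ineq4] add_mono norm_sum q) auto
  \<comment> \<open>Two terms are exceptional: the jump at \<open>k = b\<close>, and
    \<open>k = m\<close>, where the other factor is \<open>cyc g 0 = 1\<close> instead of at most
    \<open>1 / b\<close>.\<close>
  also have "(\<Sum>k=1..m. norm ((g (Suc k) - g k) * cyc g (m - k))) \<le>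
     (\<Sum>k=1..m. (if k = b then 1 / real b else 0) + (if k = m then \<kappa> / real m else 0)
        + (if k > b then \<kappa> / real b * (1 / real k) else 0))"
  proof (rule sum_mono)
    fix k assume k: "k \<in> {1..m}"
    consider "k < b" | "k = b" | "k > b" "k = m" | "k > b" "k < m" using k by fastforce
    then show "norm ((g (Suc k) - g k) * cyc g (m - k)) \<le> (if k = b then 1 / real b else 0)
      + (if k = m then \<kappa> / real m else 0) + (if k > b then \<kappa> / real b * (1 / real k) else 0)"
    proof cases
      case 1
      then show ?thesis using g0[of k] g0[of "Suc k"] k0 by simp
    next
      case 2
      then have "norm ((g (Suc k) - g k) * cyc g (m - k)) \<le> 1 * (1 / real b)"
        unfolding norm_mult using g0[of k] g1[of "Suc k"] q[of "m - k"] m by (intro mult_mono) auto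
      then show ?thesis using 2 k0 m(1) by auto
    next
      case 3
      then show ?thesis using gd[of k] k0 by (simp add: norm_mult add_increasing2)
    next
      case 4
      then have "norm ((g (Suc k) - g k) * cyc g (m - k)) \<le> (\<kappa> / real k) * (1 / real b)"
        unfolding norm_mult using gd[of k] q[of "m - k"] m k0 by (intro mult_mono) auto
      then show ?thesis using 4 k0 by (simp add: mult_ac)
    qed
  qed
  also have "\<dots> = 1 / real b + \<kappa> / real m + \<kappa> / real b * (\<Sum>k\<in>{b<..m}. 1 / real k)"
  proof -
    have "(\<Sum>k=1..m. if k > b then \<kappa> / real b * (1 / real k) else 0)
        = (\<Sum>k\<in>{b<..m}. \<kappa> / real b * (1 / real k))"
      by (intro sum.mono_neutral_cong_right) auto
    then show ?thesis using b m by (simp add: sum.distrib sum_distrib_left)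
  qed
  also have "\<dots> \<le> 1 / real b + \<kappa> / real b + \<kappa> / real b * ln (real n)"
  proof (intro add_mono mult_left_mono order_refl)
    show "\<kappa> / real m \<le> \<kappa> / real b" using m b k0 by (intro divide_left_mono) auto
    have "(\<Sum>k\<in>{b<..m}. 1 / real k) \<le> ln (real m) - ln (real b)"
      using b m by (intro harm_interval_le) auto
    also have "\<dots> \<le> ln (real n)" using b m by (auto intro: order_trans[of _ "ln (real m)"])
    finally show "(\<Sum>k\<in>{b<..m}. 1 / real k) \<le> ln (real n)" .
  qed (use k0 in auto)
  finally have "real m * norm (cyc g (Suc m) - cyc g m) \<le> (2 + \<kappa> * (1 + ln (real n))) / real b"
    by (simp add: algebra_simps add_divide_distrib)
  then show ?thesis using m b by (simp add: field_simps)
qed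

lemma sums_shift_right:
  fixes a :: "nat \<Rightarrow> 'a::real_normed_vector"
  assumes "a sums s"
  shows "(\<lambda>i. if k < i then a (i - Suc k) else 0) sums s"
  using assms by (subst sums_iff_shift'[symmetric, where n = "Suc k"]) auto

text \<open>\<open>exp 1 * b\<close> bounds the total mass of the short part. The bracket is the
  slope constant \<open>4 + 2 * \<kappa> * (1 + ln n)\<close> of \<open>q\<close>, plus 4 for the
  one index \<open>i = n\<close> that meets \<open>q 0 = 1\<close>.\<close>

abbreviation split_error :: "real \<Rightarrow> nat \<Rightarrow> nat \<Rightarrow> real" where
  "split_error \<kappa> n b \<equiv> exp 1 * (8 + 2 * \<kappa> * (1 + ln (real n))) * (real b / real n)"

text \<open>The coefficients of the short part have total mass at most \<open>e b\<close> and mean index \<open>b\<close>, so that replacing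
  \<open>q\<^sub>n\<^sub>-\<^sub>i\<close> by \<open>q\<^sub>n\<close> costs \<open>e b * b\<close> times the slope \<open>O(1 / (b n))\<close> of \<open>q\<close>.\<close>

lemma cyc_decomposition:
  fixes f :: "nat \<Rightarrow> 'a::{real_normed_field,banach}"
  assumes b: "b \<ge> 1" "2 * b < n" and f1: "\<And>k. norm (f k) \<le> 1"
    and fd: "\<And>k. k > b \<Longrightarrow> norm (f (Suc k) - f k) \<le> \<kappa> / real k" and k0: "\<kappa> \<ge> 0"
  shows "norm (cyc f n - cyc (\<lambda>k. if k \<le> b then 0 else f k) n * exp (\<Sum>k=1..b. f k / of_nat k))
     \<le> split_error \<kappa> n b"
proof -
  define g where "g k = (if k \<le> b then 0 else f k)" for k
  define s where "s = cyc (\<lambda>k. if k \<le> b then f k else 0)"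
  define s' where "s' = cyc (\<lambda>k. if k \<le> b then 1 else (0::real))"
  define S where "S = exp (\<Sum>k=1..b. f k / of_nat k)"
  define H where "H = exp (\<Sum>k=1..b. 1 / real k)"
  \<comment> \<open>Twice the numerator in \<open>cyc_large_diff\<close>: the slope is used at
    points \<open>m \<ge> n / 2\<close> but expressed through \<open>n\<close>.\<close>
  define K where "K = 4 + 2 * \<kappa> * (1 + ln (real n))"
  define q where "q = cyc g"
  have n1: "n \<ge> 1" using b by simp
  have K4: "K \<ge> 4" unfolding K_def using k0 n1 by simp
  have gb: "norm (g k) \<le> 1" "k \<le> b \<Longrightarrow> g k = 0" for k using f1 by (auto simp: g_def)
  have q1: "norm (q j) \<le> 1 / real b" if "j \<ge> 1" for j
    unfolding q_def by (rule cyc_large_le) (use b gb that in auto)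
  have q0: "q 0 = 1" by (simp add: q_def)
  have sS: "s sums S" unfolding s_def S_def by (rule sums_cyc)
  have s'H: "s' sums H" unfolding s'_def H_def by (rule sums_cyc_nonneg) simp
  have s'nn: "s' i \<ge> 0" for i unfolding s'_def by (intro cyc_nonneg) auto
  have ss': "norm (s i) \<le> s' i" for i unfolding s_def s'_def using f1 by (intro norm_cyc_le) auto
  have s'rec: "real i * s' i = (\<Sum>k<b. if k < i then s' (i - Suc k) else 0)" for i
  proof (cases "i = 0")
    case False
    have "real i * s' i = (\<Sum>k<i. (if Suc k \<le> b then 1 else 0) * s' (i - Suc k))"
      using False unfolding s'_def by (subst cyc.simps) simp
    also have "\<dots> = (\<Sum>k\<in>{..<i} \<inter> {..<b}. s' (i - Suc k))"
      by (intro sum.mono_neutral_cong_right) auto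
    also have "\<dots> = (\<Sum>k<b. if k < i then s' (i - Suc k) else 0)"
      by (intro sum.mono_neutral_cong_left) auto
    finally show ?thesis .
  qed simp
  \<comment> \<open>Summing the recurrence over all \<open>i\<close>, each of the \<open>b\<close>
    shifts contributes the full mass \<open>H\<close>.\<close>
  have mean: "(\<lambda>i. real i * s' i) sums (real b * H)"
  proof -
    have "(\<lambda>i. \<Sum>k<b. if k < i then s' (i - Suc k) else 0) sums (\<Sum>k<b. H)"
      by (intro sums_sum sums_shift_right s'H)
    then show ?thesis by (simp add: s'rec)
  qed
  \<comment> \<open>Markov's inequality from the mean would give only \<open>b * H / n\<close>.
    Applying the recurrence once first gains another factor of order \<open>1 / n\<close>; the
    indices \<open>n - Suc k\<close> are at least \<open>n / 2\<close> because
    \<open>2 b < n\<close>.\<close>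
  have s'n: "s' n \<le> 2 * real b * H / (real n)\<^sup>2"
  proof -
    have "real n * s' n = (\<Sum>k<b. s' (n - Suc k))"
      unfolding s'rec using b by (intro sum.cong) auto
    also have "\<dots> \<le> (\<Sum>k<b. (2 / real n) * (real (n - Suc k) * s' (n - Suc k)))"
    proof (rule sum_mono)
      fix k assume k: "k \<in> {..<b}"
      then have "real n \<le> 2 * real (n - Suc k)" using b by (simp add: of_nat_diff)
      then have "1 * s' (n - Suc k) \<le> (2 / real n * real (n - Suc k)) * s' (n - Suc k)"
        using n1 by (intro mult_right_mono s'nn) (auto simp: field_simps)
      then show "s' (n - Suc k) \<le> (2 / real n) * (real (n - Suc k) * s' (n - Suc k))"
        by (simp add: mult_ac)
    qed
    also have "\<dots> = (2 / real n) * (\<Sum>i\<in>(\<lambda>k. n - Suc k) ` {..<b}. real i * s' i)"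
      using b by (subst sum.reindex) (auto simp: sum_distrib_left inj_on_def)
    also have "\<dots> \<le> (2 / real n) * (real b * H)"
      unfolding sums_unique[OF mean]
      using s'nn by (intro mult_left_mono sum_le_suminf sums_summable[OF mean]) auto
    finally show ?thesis using n1 by (simp add: field_simps power2_eq_square)
  qed
  have tele: "norm (q (n - i) - q n) \<le> real i * (K / (real b * real n))" if "2 * i \<le> n" for i
    using that
  proof (induction i)
    case (Suc i)
    let ?m = "n - Suc i"
    have m: "Suc ?m = n - i" "real n \<le> 2 * real ?m" "b < ?m"
      using Suc b by (auto simp: of_nat_diff)
    have "norm (q (Suc ?m) - q ?m) \<le> (2 + \<kappa> * (1 + ln (real n))) / (real b * real ?m)"
      unfolding q_def
      by (rule cyc_large_diff) (use b gb m fd k0 in \<open>auto simp: g_def\<close>)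
    also have "\<dots> \<le> (2 + \<kappa> * (1 + ln (real n))) / (real b * (real n / 2))"
      using m b k0 n1 by (intro divide_left_mono mult_left_mono mult_pos_pos add_nonneg_nonneg mult_nonneg_nonneg) auto
    also have "\<dots> = K / (real b * real n)" by (simp add: K_def field_simps)
    finally have "norm (q (n - i) - q ?m) \<le> K / (real b * real n)" unfolding m .
    moreover have "norm (q (n - i) - q n) \<le> real i * (K / (real b * real n))"
      using Suc by simp
    moreover have "norm (q ?m - q n) \<le> norm (q (n - i) - q n) + norm (q (n - i) - q ?m)"
      using norm_triangle_ineq4[of "q (n - i) - q n" "q (n - i) - q ?m"] by simp
    ultimately show ?case by (simp add: algebra_simps add_divide_distrib)
  qed simp
  define Q where "Q i = (if i \<le> n then q (n - i) else 0)" for i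
  \<comment> \<open>\<open>i = n\<close> is excluded because \<open>q 0 = 1\<close>. For
    \<open>2 i > n\<close>, including the \<open>i > n\<close> where \<open>Q\<close> vanishes, the
    crude bound \<open>2 / b\<close> lies below the linear one since
    \<open>K \<ge> 4\<close>.\<close>
  have dQ: "norm (Q i - q n) \<le> real i * (K / (real b * real n))" if "i \<noteq> n" for i
  proof (cases "2 * i \<le> n")
    case True
    then show ?thesis using tele[of i] by (simp add: Q_def)
  next
    case False
    have "norm (Q i - q n) \<le> 1 / real b + 1 / real b"
      using that q1[of n] q1[of "n - i"] n1
      by (intro order_trans[OF norm_triangle_ineq4] add_mono) (auto simp: Q_def)
    also have "\<dots> = (real n / 2) * (4 / (real b * real n))" using n1 b by (simp add: field_simps)
    also have "\<dots> \<le> real i * (K / (real b * real n))"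
      using False K4 by (intro mult_mono divide_right_mono) auto
    finally show ?thesis .
  qed
  have "cyc f n = cyc (\<lambda>k. (if k \<le> b then f k else 0) + g k) n"
    by (intro cyc_cong) (auto simp: g_def)
  also have "\<dots> = (\<Sum>i\<le>n. s i * Q i)"
    unfolding cyc_add s_def q_def Q_def by (intro sum.cong) auto
  finally have cf: "cyc f n = (\<Sum>i\<le>n. s i * Q i)" .
  \<comment> \<open>As \<open>Q\<close> is 0 beyond \<open>n\<close>, the finite convolution becomes
    a series from which \<open>S * q n\<close> can be subtracted termwise.\<close>
  have "(\<lambda>i. s i * Q i) sums cyc f n"
    unfolding cf by (rule sums_finite) (auto simp: Q_def)
  then have "(\<lambda>i. s i * Q i - s i * q n) sums (cyc f n - S * q n)"
    by (intro sums_diff sums_mult2 sS)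
  moreover have "(\<lambda>i. K / (real b * real n) * (real i * s' i) + (if i = n then 2 * s' n else 0))
       sums (K / (real b * real n) * (real b * H) + 2 * s' n)"
    by (intro sums_add sums_mult mean) (rule sums_single)
  moreover have "norm (s i * Q i - s i * q n)
     \<le> K / (real b * real n) * (real i * s' i) + (if i = n then 2 * s' n else 0)" for i
  proof (cases "i = n")
    case True
    have "norm (s i * (Q i - q n)) \<le> s' i * 2"
      unfolding norm_mult
    proof (intro mult_mono ss')
      have "norm (Q i - q n) \<le> 1 + 1 / real b"
        using True q0 q1[of n] n1 by (intro order_trans[OF norm_triangle_ineq4] add_mono) (auto simp: Q_def)
      also have "\<dots> \<le> 2" using b by simp
      finally show "norm (Q i - q n) \<le> 2" .
    qed (use s'nn in auto)
    moreover have "0 \<le> K / (real b * real n) * (real i * s' i)"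
      using K4 s'nn by (intro mult_nonneg_nonneg divide_nonneg_nonneg) auto
    ultimately show ?thesis using True unfolding right_diff_distrib by simp
  next
    case False
    have "norm (s i * (Q i - q n)) \<le> s' i * (real i * (K / (real b * real n)))"
      unfolding norm_mult by (intro mult_mono ss' dQ False s'nn norm_ge_zero)
    then show ?thesis using False by (simp add: algebra_simps)
  qed
  ultimately have "norm (cyc f n - S * q n) \<le> K / (real b * real n) * (real b * H) + 2 * s' n"
    by (rule norm_sums_le)
  also have "\<dots> \<le> K * H / real n + 4 * H / real n"
  proof (rule add_mono)
    have "2 * s' n \<le> 2 * (2 * real b * H / (real n)\<^sup>2)" using s'n by (intro mult_left_mono) auto
    also have "\<dots> = 4 * H * real b / (real n)\<^sup>2" by simp
    also have "\<dots> \<le> 4 * H * real n / (real n)\<^sup>2"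
      using b by (intro divide_right_mono mult_left_mono) (auto simp: H_def)
    also have "\<dots> = 4 * H / real n" using n1 by (simp add: power2_eq_square)
    finally show "2 * s' n \<le> 4 * H / real n" .
  qed (use b in simp)
  also have "\<dots> = H * ((K + 4) / real n)" by (simp add: distrib_left add_divide_distrib mult.commute)
  also have "H \<le> exp (1 + ln (real b))"
    unfolding H_def using harm_upper[OF b(1)] by simp
  also have "exp (1 + ln (real b)) = exp 1 * real b" using b by (simp add: exp_add)
  finally show ?thesis
    unfolding S_def q_def g_def using K4 by (simp add: K_def mult_ac add_ac divide_right_mono mult_right_mono)
qed

text \<open>Normalising the short exponential by the harmonic sum costs a factor
  \<open>exp 1 * b\<close>, which the bound \<open>1 / b\<close> on \<open>q_n\<close> compensates.
  What is left is the decay of the independent model, up to the factor \<open>exp 1\<close>.\<close>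

lemma norm_cyc_le_exp:
  fixes f :: "nat \<Rightarrow> complex"
  assumes b: "b \<ge> 1" "2 * b < n" and f1: "\<And>k. norm (f k) \<le> 1"
    and fd: "\<And>k. k > b \<Longrightarrow> norm (f (Suc k) - f k) \<le> \<kappa> / real k" and k0: "\<kappa> \<ge> 0"
  shows "norm (cyc f n) \<le> exp 1 * exp (\<Sum>k=1..b. (Re (f k) - 1) / real k)
    + split_error \<kappa> n b"
proof -
  define q where "q = cyc (\<lambda>k. if k \<le> b then 0 else f k) n"
  define S where "S = exp (\<Sum>k=1..b. f k / of_nat k)"
  have q1: "norm q \<le> 1 / real b"
    unfolding q_def by (rule cyc_large_le) (use b f1 in auto)
  have "norm S = exp (\<Sum>k=1..b. Re (f k) / real k)"
    by (simp add: S_def norm_exp_eq_Re Re_divide_of_nat)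
  also have "\<dots> = exp (\<Sum>k=1..b. (Re (f k) - 1) / real k) * exp (\<Sum>k=1..b. 1 / real k)"
    by (simp add: exp_add[symmetric] sum.distrib[symmetric] diff_divide_distrib)
  also have "\<dots> \<le> exp (\<Sum>k=1..b. (Re (f k) - 1) / real k) * (exp 1 * real b)"
  proof (rule mult_left_mono)
    have "exp (\<Sum>k=1..b. 1 / real k) \<le> exp (1 + ln (real b))"
      using harm_upper[OF b(1)] by simp
    also have "exp (1 + ln (real b)) = exp 1 * real b" using b by (simp add: exp_add)
    finally show "exp (\<Sum>k=1..b. 1 / real k) \<le> exp 1 * real b" .
  qed simp
  finally have "norm (q * S) \<le> (1 / real b) * (exp (\<Sum>k=1..b. (Re (f k) - 1) / real k) * (exp 1 * real b))"
    unfolding norm_mult using q1 by (intro mult_mono) auto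
  also have "\<dots> = exp 1 * exp (\<Sum>k=1..b. (Re (f k) - 1) / real k)" using b by simp
  finally have 1: "norm (q * S) \<le> exp 1 * exp (\<Sum>k=1..b. (Re (f k) - 1) / real k)" .
  have "norm (cyc f n) \<le> norm (q * S) + norm (cyc f n - q * S)"
    using norm_triangle_sub by blast
  also have "norm (cyc f n - q * S) \<le> split_error \<kappa> n b"
    unfolding q_def S_def by (rule cyc_decomposition) (use assms in auto)
  finally show ?thesis using 1 by linarith
qed

section \<open>Second-order comparison of a coefficient with an exponential\<close>

lemma exp_sub_linear_le:
  fixes x :: real assumes "0 \<le> x" "x \<le> 1" shows "exp x - 1 - x \<le> x\<^sup>2"
  using exp_bound[of x] assms by simp

lemma norm_exp_sub_linear_le:
  fixes z :: complex assumes "norm z \<le> x" "x \<le> 1" shows "norm (exp z - 1 - z) \<le> x\<^sup>2"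
proof -
  have s: "(\<lambda>n. z ^ (n + 2) /\<^sub>R fact (n + 2)) sums (exp z - (\<Sum>i<2. z ^ i /\<^sub>R fact i))"
    using exp_converges[of z] by (subst sums_iff_shift) simp
  have t: "(\<lambda>n. x ^ (n + 2) /\<^sub>R fact (n + 2)) sums (exp x - (\<Sum>i<2. x ^ i /\<^sub>R fact i))"
    using exp_converges[of x] by (subst sums_iff_shift) simp
  have "norm (exp z - (\<Sum>i<2. z ^ i /\<^sub>R fact i)) \<le> exp x - (\<Sum>i<2. x ^ i /\<^sub>R fact i)"
  proof (rule norm_sums_le[OF s t])
    fix n
    show "norm (z ^ (n + 2) /\<^sub>R fact (n + 2)) \<le> x ^ (n + 2) /\<^sub>R fact (n + 2)"
      unfolding norm_scaleR norm_power real_scaleR_def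
      using power_mono[OF assms(1) norm_ge_zero, of "n + 2"]
      by (intro mult_mono) auto
  qed
  also have "\<dots> \<le> x\<^sup>2"
    using exp_sub_linear_le[of x] assms norm_ge_zero[of z] by (simp add: numeral_2_eq_2)
  finally show ?thesis by (simp add: numeral_2_eq_2 algebra_simps)
qed

text \<open>Weight 1 contributes the factor \<open>1 / (1 - z)\<close>, which turns coefficients
  into partial sums.\<close>

lemma cyc_add_one: "cyc (\<lambda>k. 1 + h k) n = (\<Sum>j\<le>n. cyc h j)"
proof -
  have "cyc (\<lambda>k. h k + 1) n = (\<Sum>j\<le>n. cyc h j)"
    by (subst cyc_add) simp
  then show ?thesis by (simp add: add.commute)
qed

text \<open>Both quantities equal \<open>1 + l\<close> to first order. The remainder of the
  coefficients is majorised by the one for the weights \<open>norm (h k)\<close>, whose total is at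
  most \<open>exp \<Lambda>' - 1 - \<Lambda>'\<close>.\<close>

lemma cyc_perturbation:
  fixes h :: "nat \<Rightarrow> complex"
  assumes L: "(\<Sum>k=1..n. norm (h k) / real k) \<le> \<Lambda>" "\<Lambda> \<le> 1"
  shows "norm (cyc (\<lambda>k. 1 + h k) n - exp (\<Sum>k=1..n. h k / of_nat k)) \<le> 2 * \<Lambda>\<^sup>2"
proof -
  define \<Lambda>' where "\<Lambda>' = (\<Sum>k=1..n. norm (h k) / real k)"
  define l where "l = (\<Sum>k=1..n. h k / of_nat k)"
  define a where "a = (\<lambda>k. if k \<le> n then norm (h k) else 0)"
  have ann: "a k \<ge> 0" for k by (simp add: a_def)
  have Lnn: "0 \<le> \<Lambda>'" unfolding \<Lambda>'_def by (intro sum_nonneg) auto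
  have split: "{..n} = insert 0 {1..n}" by auto
  \<comment> \<open>The last term of the recurrence, \<open>k = j - 1\<close>, is the linear part
    \<open>g j / j\<close>. What remains is again a sum of products and can be majorised factor by
    factor.\<close>
  have cyc1: "cyc g j - g j / of_nat j = (\<Sum>k<j-1. g (Suc k) * cyc g (j - Suc k)) / of_nat j"
    if j: "j \<ge> 1" for j and g :: "nat \<Rightarrow> 'b::real_normed_field"
  proof -
    obtain i where i: "j = Suc i" using j by (cases j) auto
    show ?thesis unfolding i by (subst cyc.simps) (simp add: add_divide_distrib)
  qed
  have remainder: "norm (cyc h j - h j / of_nat j) \<le> cyc a j - a j / real j" if j: "j \<in> {1..n}" for j
  proof -
    have "norm (\<Sum>k<j-1. h (Suc k) * cyc h (j - Suc k)) \<le> (\<Sum>k<j-1. a (Suc k) * cyc a (j - Suc k))"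
    proof (rule sum_norm_le)
      fix k assume "k \<in> {..<j-1}"
      then show "norm (h (Suc k) * cyc h (j - Suc k)) \<le> a (Suc k) * cyc a (j - Suc k)"
        unfolding norm_mult using j by (intro mult_mono norm_cyc_le) (auto simp: a_def)
    qed
    then show ?thesis using j by (subst (1 2) cyc1) (auto simp: norm_divide divide_right_mono)
  qed
  have "cyc (\<lambda>k. 1 + h k) n - (1 + l) = (\<Sum>j=1..n. cyc h j - h j / of_nat j)"
    unfolding cyc_add_one split l_def by (simp add: sum_subtractf)
  also have "norm \<dots> \<le> (\<Sum>j=1..n. cyc a j - a j / real j)"
    by (intro sum_norm_le remainder)
  also have "\<dots> = (\<Sum>j\<le>n. cyc a j) - 1 - \<Lambda>'"
    unfolding split \<Lambda>'_def by (simp add: sum_subtractf a_def)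
  also have "(\<Sum>j\<le>n. cyc a j) \<le> exp \<Lambda>'"
  proof -
    have s: "cyc a sums exp \<Lambda>'"
      using sums_cyc_nonneg[of "\<lambda>k. norm (h k)" n] by (simp add: a_def \<Lambda>'_def)
    show ?thesis unfolding sums_unique[OF s]
      by (intro sum_le_suminf sums_summable[OF s]) (auto intro!: cyc_nonneg ann)
  qed
  also have "exp \<Lambda>' - 1 - \<Lambda>' \<le> \<Lambda>'\<^sup>2"
    using Lnn L by (intro exp_sub_linear_le) (auto simp: \<Lambda>'_def)
  finally have 1: "norm (cyc (\<lambda>k. 1 + h k) n - (1 + l)) \<le> \<Lambda>'\<^sup>2" by simp
  have "norm l \<le> \<Lambda>'"
    unfolding l_def \<Lambda>'_def by (intro sum_norm_le) (simp add: norm_divide)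
  then have 2: "norm (exp l - 1 - l) \<le> \<Lambda>'\<^sup>2"
    using L by (intro norm_exp_sub_linear_le) (auto simp: \<Lambda>'_def)
  have "norm (cyc (\<lambda>k. 1 + h k) n - exp l) \<le> \<Lambda>'\<^sup>2 + \<Lambda>'\<^sup>2"
    using norm_triangle_ineq4[of "cyc (\<lambda>k. 1 + h k) n - (1 + l)" "exp l - 1 - l"] 1 2
    by (simp add: algebra_simps)
  also have "\<dots> \<le> 2 * \<Lambda>\<^sup>2"
    using Lnn L power_mono[of \<Lambda>' \<Lambda> 2] by (simp add: \<Lambda>'_def)
  finally show ?thesis by (simp add: l_def)
qed

text \<open>\<open>f\<close> and \<open>f'\<close> share the long part, so \<open>cyc f n\<close> is
  close to \<open>q * E * S'\<close> and \<open>cyc f' n\<close> to \<open>q * S'\<close>.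
  Eliminating \<open>q\<close> reduces the claim to \<open>f'\<close>, to which
  \<open>cyc_perturbation\<close> applies. For \<open>f\<close> itself that lemma would require the
  sum of \<open>norm (f k - 1) / k\<close> over all \<open>k \<le> n\<close>, not just over
  \<open>k > b\<close>, to be at most 1.\<close>

lemma norm_cyc_sub_exp_le:
  fixes f :: "nat \<Rightarrow> complex"
  assumes b: "b \<ge> 1" "2 * b < n" and f1: "\<And>k. norm (f k) \<le> 1"
    and fd: "\<And>k. k > b \<Longrightarrow> norm (f (Suc k) - f k) \<le> \<kappa> / real k" and k0: "\<kappa> \<ge> 0"
    and L: "(\<Sum>k\<in>{b<..n}. norm (f k - 1) / real k) \<le> \<Lambda>" "\<Lambda> \<le> 1"
  shows "norm (cyc f n - exp (\<Sum>k=1..n. (f k - 1) / of_nat k))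
    \<le> exp (\<Sum>k=1..b. (Re (f k) - 1) / real k) * (2 * \<Lambda>\<^sup>2)
      + 2 * split_error \<kappa> n b"
proof -
  define q where "q = cyc (\<lambda>k. if k \<le> b then 0 else f k) n"
  define f' where "f' k = (if k \<le> b then 1 else f k)" for k
  define \<epsilon> where "\<epsilon> = split_error \<kappa> n b"
  define S where "S = exp (\<Sum>k=1..b. f k / of_nat k)"
  define S' where "S' = exp (\<Sum>k=1..b. 1 / of_nat k :: complex)"
  define E where "E = exp (\<Sum>k=1..b. (f k - 1) / of_nat k)"
  have nE: "norm E = exp (\<Sum>k=1..b. (Re (f k) - 1) / real k)"
    by (simp add: E_def norm_exp_eq_Re Re_divide_of_nat)
  have "Re (f k) \<le> 1" for k using f1[of k] complex_Re_le_cmod[of "f k"] by linarith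
  \<comment> \<open>\<open>E\<close> multiplies the error of the second decomposition, so it must
    not enlarge it.\<close>
  then have nE1: "norm E \<le> 1"
    unfolding nE exp_le_one_iff by (intro sum_nonpos) (auto simp: divide_nonpos_nonneg)
  have SE: "S = E * S'"
    by (simp add: S_def S'_def E_def exp_add[symmetric] sum.distrib[symmetric] diff_divide_distrib)
  have 1: "norm (cyc f n - q * S) \<le> \<epsilon>"
    unfolding q_def S_def \<epsilon>_def by (rule cyc_decomposition) (use assms in auto)
  have "norm (cyc f' n - cyc (\<lambda>k. if k \<le> b then 0 else f' k) n * exp (\<Sum>k=1..b. f' k / of_nat k)) \<le> \<epsilon>"
    unfolding \<epsilon>_def by (rule cyc_decomposition) (use assms in \<open>auto simp: f'_def\<close>)
  also have "(\<lambda>k. if k \<le> b then 0 else f' k) = (\<lambda>k. if k \<le> b then 0 else f k)"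
    by (auto simp: f'_def)
  also have "(\<Sum>k=1..b. f' k / of_nat k) = (\<Sum>k=1..b. 1 / of_nat k)"
    by (intro sum.cong) (auto simp: f'_def)
  finally have 2: "norm (cyc f' n - q * S') \<le> \<epsilon>" by (simp add: q_def S'_def)
  have l: "(\<Sum>k=1..n. (f' k - 1) / of_nat k) = (\<Sum>k\<in>{b<..n}. (f k - 1) / of_nat k)"
    by (intro sum.mono_neutral_cong_right) (auto simp: f'_def)
  have "(\<Sum>k=1..n. norm (f' k - 1) / real k) = (\<Sum>k\<in>{b<..n}. norm (f k - 1) / real k)"
    by (intro sum.mono_neutral_cong_right) (auto simp: f'_def)
  then have 3: "norm (cyc f' n - exp (\<Sum>k\<in>{b<..n}. (f k - 1) / of_nat k)) \<le> 2 * \<Lambda>\<^sup>2"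
    using cyc_perturbation[of "\<lambda>k. f' k - 1" n \<Lambda>] L l by simp
  have "{1..n} = {1..b} \<union> {b<..n}" "{1..b} \<inter> {b<..n} = {}" using b by auto
  then have E: "exp (\<Sum>k=1..n. (f k - 1) / of_nat k) = E * exp (\<Sum>k\<in>{b<..n}. (f k - 1) / of_nat k)"
    by (simp add: E_def sum.union_disjoint exp_add)
  have "cyc f n - exp (\<Sum>k=1..n. (f k - 1) / of_nat k) = (cyc f n - q * S)
     + (E * (cyc f' n - exp (\<Sum>k\<in>{b<..n}. (f k - 1) / of_nat k)) - E * (cyc f' n - q * S'))"
    unfolding E SE by (simp add: algebra_simps)
  also have "norm \<dots> \<le> \<epsilon> + (norm E * (2 * \<Lambda>\<^sup>2) + 1 * \<epsilon>)"
  proof (rule order_trans[OF norm_triangle_ineq add_mono[OF 1 order_trans[OF norm_triangle_ineq4 add_mono]]])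
    show "norm (E * (cyc f' n - exp (\<Sum>k\<in>{b<..n}. (f k - 1) / of_nat k))) \<le> norm E * (2 * \<Lambda>\<^sup>2)"
      unfolding norm_mult by (intro mult_left_mono 3 norm_ge_zero)
    show "norm (E * (cyc f' n - q * S')) \<le> 1 * \<epsilon>"
      unfolding norm_mult by (intro mult_mono 2 nE1) auto
  qed
  finally show ?thesis unfolding \<epsilon>_def[symmetric] nE by simp
qed

section \<open>Cycle weights of permutations\<close>

text \<open>Weight of a permutation in which the cycle of the marked point \<open>x\<close> counts as having \<open>j\<close> additional points;
  deleting a marked point from its cycle and marking its successor instead raises \<open>j\<close> by one.\<close>

definition marked_weight :: "(nat \<Rightarrow> 'b::comm_monoid_mult) \<Rightarrow> nat \<Rightarrow> ('a \<Rightarrow> 'a) \<Rightarrow> 'a set \<Rightarrow> 'a \<Rightarrow> 'b" where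
  "marked_weight f j p S x =
     f (card (orbit p x) + j) * (\<Prod>Z\<in>orbit p ` S - {orbit p x}. f (card Z))"

lemma orbit_fixpoint:
  assumes "p permutes S" "a \<notin> S" shows "orbit p a = {a}"
  using assms by (simp add: orbit_eq_singleton_iff permutes_not_in)

lemma orbit_subset_permutes: "p permutes S \<Longrightarrow> x \<in> S \<Longrightarrow> orbit p x \<subseteq> S"
  by (rule permutes_orbit_subset)

lemma marked_weight_fixpoint:
  assumes "p permutes S" "a \<notin> S"
  shows "marked_weight f j p (insert a S) a = f (Suc j) * (\<Prod>Z\<in>orbit p ` S. f (card Z))"
proof -
  have "orbit p ` insert a S - {orbit p a} = orbit p ` S"
    using assms orbit_subset_permutes[OF assms(1)] by (auto simp: orbit_fixpoint[OF assms])
  then show ?thesis by (simp add: marked_weight_def orbit_fixpoint[OF assms])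
qed

text \<open>Composing with the transposition puts \<open>a\<close> into the cycle of
  \<open>b\<close>, immediately before \<open>b\<close>: the point that \<open>p\<close> sends to
  \<open>b\<close> now goes to \<open>a\<close>, and \<open>a\<close> goes to \<open>b\<close>. The
  other cycles are untouched.\<close>

lemma orbit_transpose_insert:
  assumes p: "p permutes S" and fin: "finite S" and a: "a \<notin> S" and b: "b \<in> S"
  defines "p' \<equiv> Transposition.transpose a b \<circ> p"
  shows "orbit p' a = insert a (orbit p b)"
    and "y \<in> S \<Longrightarrow> orbit p' y = (if y \<in> orbit p b then insert a (orbit p b) else orbit p y)"
proof -
  have pa: "p a = a" using p a by (simp add: permutes_not_in)
  have pS: "p z \<in> S" if "z \<in> S" for z using p that by (simp add: permutes_in_image)
  have perm: "permutation p" using p fin by (rule permutation_permutes[THEN iffD2, OF exI, OF conjI, rotated])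
  have perm': "permutation p'"
    unfolding p'_def by (intro permutation_compose perm permutation_swap_id)
  have p'a: "p' a = b" by (simp add: p'_def pa)
  have p'z: "p' z = (if p z = b then a else p z)" if "z \<in> S" for z
    using pS[OF that] a by (auto simp: p'_def Transposition.transpose_def)
  have sub: "orbit p b \<subseteq> S" by (rule orbit_subset_permutes[OF p b])
  show *: "orbit p' a = insert a (orbit p b)"
  proof (intro equalityI subsetI)
    fix z assume "z \<in> orbit p' a"
    then show "z \<in> insert a (orbit p b)"
    proof induction
      case base
      then show ?case by (simp add: p'a permutation_self_in_orbit[OF perm])
    next
      case (step y)
      then show ?case
        using p'a p'z[of y] sub orbit.step[of y p b]
        by (auto simp: permutation_self_in_orbit[OF perm] split: if_splits)
    qed
  next
    have b': "b \<in> orbit p' a" using orbit.base[of p' a] by (simp add: p'a)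
    fix z assume "z \<in> insert a (orbit p b)"
    then consider "z = a" | "z \<in> orbit p b" by auto
    then show "z \<in> orbit p' a"
    proof cases
      case 1
      then show ?thesis by (simp add: permutation_self_in_orbit[OF perm'])
    next
      case 2
      then show ?thesis
      proof induction
        case base
        then show ?case using b' p'z[OF b] orbit.step[OF b'] by (auto split: if_splits)
      next
        case (step y)
        then have "y \<in> S" using sub by auto
        then show ?case using step b' p'z[of y] orbit.step[of y p' a] by (auto split: if_splits)
      qed
    qed
  qed
  assume y: "y \<in> S"
  show "orbit p' y = (if y \<in> orbit p b then insert a (orbit p b) else orbit p y)"
  proof (cases "y \<in> orbit p b")
    case True
    then have "y \<in> orbit p' a" by (simp add: *)
    then have "orbit p' y = orbit p' a"
      by (meson orbit_cyclic_eq3 cyclic_on_orbit' perm')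
    then show ?thesis using True * by simp
  next
    case False
    have nb: "b \<notin> orbit p y"
      using False orbit_swap[of y p b] permutation_self_in_orbit[OF perm] by blast
    have "orbit p' y = orbit p y"
    proof (rule orbit_cong)
      show "p' s = p s" if "s \<in> orbit p y" for s
      proof -
        have "s \<in> S" using that orbit_subset_permutes[OF p y] by auto
        moreover have "p s \<noteq> b" using nb orbit.step[OF that] by auto
        ultimately show ?thesis by (simp add: p'z)
      qed
    qed (rule permutation_self_in_orbit[OF perm])
    then show ?thesis using False by simp
  qed
qed

text \<open>The enlarged cycle has one point more than the cycle of \<open>b\<close>; the offset
  records that point, so the weight can be read off the smaller permutation.\<close>

lemma marked_weight_transpose:
  assumes p: "p permutes S" and fin: "finite S" and a: "a \<notin> S" and b: "b \<in> S"
  shows "marked_weight f j (Transposition.transpose a b \<circ> p) (insert a S) a = marked_weight f (Suc j) p S b"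
proof -
  let ?p' = "Transposition.transpose a b \<circ> p"
  note orb = orbit_transpose_insert[OF p fin a b]
  have perm: "permutation p" using p fin by (rule permutation_permutes[THEN iffD2, OF exI, OF conjI, rotated])
  have sub: "orbit p y \<subseteq> S" if "y \<in> S" for y by (rule orbit_subset_permutes[OF p that])
  have a': "a \<notin> orbit p y" if "y \<in> S" for y using sub[OF that] a by auto
  have same: "orbit p y = orbit p b" if "y \<in> orbit p b" for y
    using that by (meson orbit_cyclic_eq3 cyclic_on_orbit' perm)
  have "orbit ?p' ` insert a S - {orbit ?p' a} = orbit p ` S - {orbit p b}"
  proof (intro equalityI subsetI)
    fix Z assume "Z \<in> orbit ?p' ` insert a S - {orbit ?p' a}"
    then obtain y where y: "y \<in> S" "y \<notin> orbit p b" "Z = orbit p y"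
      using orb by (auto split: if_splits)
    then show "Z \<in> orbit p ` S - {orbit p b}"
      using permutation_self_in_orbit[OF perm, of y] by auto
  next
    fix Z assume "Z \<in> orbit p ` S - {orbit p b}"
    then obtain y where y: "y \<in> S" "Z = orbit p y" "Z \<noteq> orbit p b" by auto
    then have "y \<notin> orbit p b" using same by auto
    then have "orbit ?p' y = Z" using orb(2)[OF y(1)] y by simp
    moreover have "Z \<noteq> orbit ?p' a" using orb(1) a'[OF y(1)] y by auto
    ultimately show "Z \<in> orbit ?p' ` insert a S - {orbit ?p' a}" using y by auto
  qed
  moreover have "card (orbit ?p' a) = Suc (card (orbit p b))"
    using a'[OF b] finite_subset[OF sub[OF b] fin] by (simp add: orb(1))
  ultimately show ?thesis by (simp add: marked_weight_def)
qed

text \<open>One induction on the size proves both claims. Removing the marked point leaves a smaller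
  permutation whose marked cycle lacks a point, which is why a general offset \<open>j\<close> is
  carried along; the first claim comes from \<open>j = 0\<close>. In the second,
  \<open>Suc k\<close> is the length of the cycle of \<open>x\<close>.\<close>

lemma sum_permutes_weight:
  fixes f :: "nat \<Rightarrow> 'b::real_normed_field"
  assumes "finite S"
  shows "(\<Sum>p | p permutes S. \<Prod>Z\<in>orbit p ` S. f (card Z)) = fact (card S) * cyc f (card S)"
    and "x \<in> S \<Longrightarrow> (\<Sum>p | p permutes S. marked_weight f j p S x)
      = fact (card S - 1) * (\<Sum>k<card S. f (Suc k + j) * cyc f (card S - Suc k))"
  using assms
proof (induction "card S" arbitrary: S x j)
  case 0
  {
    case 1 then show ?case using 0 by (auto simp: Collect_conv_if)
  next
    case 2 then show ?case using 0 by auto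
  }
next
  case (Suc n)
  have marked: "(\<Sum>p | p permutes S. marked_weight f j p S x)
      = fact n * (\<Sum>k<Suc n. f (Suc k + j) * cyc f (Suc n - Suc k))" if x: "x \<in> S" and fin: "finite S" for x j
  proof -
    define S' where "S' = S - {x}"
    have S': "S = insert x S'" "x \<notin> S'" "finite S'" "card S' = n"
      using x fin Suc(3) by (auto simp: S'_def)
    \<comment> \<open>Each permutation of \<open>insert x S'\<close> is uniquely a permutation of
      \<open>S'\<close> followed by the transposition of \<open>x\<close> and some \<open>b\<close>;
      \<open>b = x\<close> makes \<open>x\<close> a fixed point.\<close>
    have "(\<Sum>p | p permutes S. marked_weight f j p S x) =
       (\<Sum>b\<in>insert x S'. \<Sum>p | p permutes S'. marked_weight f j (Transposition.transpose x b \<circ> p) S x)"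
      unfolding S'(1) by (rule sum_over_permutations_insert) (use S' in auto)
    also have "\<dots> = (\<Sum>p | p permutes S'. marked_weight f j p (insert x S') x)
        + (\<Sum>b\<in>S'. \<Sum>p | p permutes S'. marked_weight f j (Transposition.transpose x b \<circ> p) (insert x S') x)"
      using S'(2,3) by (subst sum.insert) (simp_all flip: S'(1))
    also have "(\<Sum>p | p permutes S'. marked_weight f j p (insert x S') x)
        = f (Suc j) * (\<Sum>p | p permutes S'. \<Prod>Z\<in>orbit p ` S'. f (card Z))"
      unfolding sum_distrib_left using S' by (intro sum.cong refl marked_weight_fixpoint) auto
    also have "(\<Sum>p | p permutes S'. \<Prod>Z\<in>orbit p ` S'. f (card Z)) = fact n * cyc f n"
      using Suc(1)[of S'] S' by simp
    also have "(\<Sum>b\<in>S'. \<Sum>p | p permutes S'. marked_weight f j (Transposition.transpose x b \<circ> p) (insert x S') x)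
        = (\<Sum>b\<in>S'. \<Sum>p | p permutes S'. marked_weight f (Suc j) p S' b)"
      using S' by (intro sum.cong refl marked_weight_transpose) auto
    also have "\<dots> = (\<Sum>b\<in>S'. fact (n - 1) * (\<Sum>k<n. f (Suc k + Suc j) * cyc f (n - Suc k)))"
      using Suc(2)[of S'] S' by (intro sum.cong) auto
    also have "\<dots> = fact n * (\<Sum>k<n. f (Suc k + Suc j) * cyc f (n - Suc k))"
      using S'(4) by (cases n) (auto simp: algebra_simps)
    \<comment> \<open>The fixed-point case is the term \<open>k = 0\<close>; the induction
      hypothesis with offset \<open>Suc j\<close> supplies the others, shifted by one.\<close>
    also have "f (Suc j) * (fact n * cyc f n) + fact n * (\<Sum>k<n. f (Suc k + Suc j) * cyc f (n - Suc k))
        = fact n * (\<Sum>k<Suc n. f (Suc k + j) * cyc f (Suc n - Suc k))"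
      unfolding sum.lessThan_Suc_shift by (simp add: algebra_simps)
    finally show ?thesis .
  qed
  {
    case 1
    obtain x where x: "x \<in> S" using Suc(3) by fastforce
    have "(\<Sum>p | p permutes S. \<Prod>Z\<in>orbit p ` S. f (card Z)) = (\<Sum>p | p permutes S. marked_weight f 0 p S x)"
      unfolding marked_weight_def using x 1 by (intro sum.cong refl) (auto intro!: prod.remove)
    also have "\<dots> = fact n * (\<Sum>k\<le>n. f (Suc k) * cyc f (n - k))"
      using marked[OF x 1, of 0] by (simp add: lessThan_Suc_atMost)
    also have "\<dots> = fact (card S) * cyc f (card S)"
      unfolding Suc(3)[symmetric] cyc_Suc[symmetric] by (simp add: algebra_simps)
    finally show ?case .
  next
    case 2
    then show ?case using marked[OF 2] Suc(3)[symmetric] by simp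
  }
qed

lemma prod_cycle_count:
  fixes f :: "nat \<Rightarrow> 'b::comm_monoid_mult"
  assumes "\<sigma> permutes {1..n}"
  shows "(\<Prod>k=1..n. f k ^ cycle_count n \<sigma> k) = (\<Prod>Z\<in>orbit \<sigma> ` {1..n}. f (card Z))"
proof -
  have card: "card (orbit \<sigma> x) \<in> {1..n}" if "x \<in> {1..n}" for x
  proof -
    have "orbit \<sigma> x \<subseteq> {1..n}" by (rule orbit_subset_permutes[OF assms that])
    then show ?thesis
      using card_mono[of "{1..n}" "orbit \<sigma> x"] orbit_nonempty[of \<sigma> x]
        finite_subset[of "orbit \<sigma> x" "{1..n}"] by (auto simp: Suc_le_eq card_gt_0_iff)
  qed
  have "(\<Prod>k=1..n. f k ^ cycle_count n \<sigma> k)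
     = (\<Prod>k=1..n. \<Prod>Z\<in>{Z \<in> orbit \<sigma> ` {1..n}. card Z = k}. f (card Z))"
  proof (rule prod.cong)
    fix k
    have "{orbit \<sigma> x | x. x \<in> {1..n} \<and> card (orbit \<sigma> x) = k} = {Z \<in> orbit \<sigma> ` {1..n}. card Z = k}"
      by auto
    then show "f k ^ cycle_count n \<sigma> k = (\<Prod>Z\<in>{Z \<in> orbit \<sigma> ` {1..n}. card Z = k}. f (card Z))"
      by (simp add: cycle_count_def)
  qed simp
  also have "\<dots> = (\<Prod>Z\<in>orbit \<sigma> ` {1..n}. f (card Z))"
    using card by (intro prod.group) auto
  finally show ?thesis .
qed

lemma sum_permutes_cycle_count:
  fixes f :: "nat \<Rightarrow> 'b::real_normed_field"
  shows "(\<Sum>\<sigma> | \<sigma> permutes {1..n}. \<Prod>k=1..n. f k ^ cycle_count n \<sigma> k) = fact n * cyc f n"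
proof -
  have "(\<Sum>\<sigma> | \<sigma> permutes {1..n}. \<Prod>k=1..n. f k ^ cycle_count n \<sigma> k)
      = (\<Sum>\<sigma> | \<sigma> permutes {1..n}. \<Prod>Z\<in>orbit \<sigma> ` {1..n}. f (card Z))"
    by (intro sum.cong refl prod_cycle_count) auto
  then show ?thesis using sum_permutes_weight(1)[of "{1..n}" f] by simp
qed

section \<open>Averages over permutations\<close>

definition perm_avg :: "nat \<Rightarrow> ((nat \<Rightarrow> nat) \<Rightarrow> 'a::real_normed_field) \<Rightarrow> 'a" where
  "perm_avg n g = (\<Sum>\<sigma> | \<sigma> permutes {1..n}. g \<sigma>) / fact n"

lemma perm_avg_prod:
  "perm_avg n (\<lambda>\<sigma>. \<Prod>k=1..n. f k ^ cycle_count n \<sigma> k) = cyc f n"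
  unfolding perm_avg_def sum_permutes_cycle_count by simp

lemma perm_avg_const: "perm_avg n (\<lambda>_. c) = c"
  using perm_avg_prod[of n "\<lambda>_. 1 :: 'a"]
  by (simp add: perm_avg_def card_permutations[of _ n])

lemma perm_avg_mono:
  fixes g h :: "(nat \<Rightarrow> nat) \<Rightarrow> real"
  shows "(\<And>\<sigma>. \<sigma> permutes {1..n} \<Longrightarrow> g \<sigma> \<le> h \<sigma>) \<Longrightarrow> perm_avg n g \<le> perm_avg n h"
  unfolding perm_avg_def by (intro divide_right_mono sum_mono) auto

lemma perm_avg_sum: "perm_avg n (\<lambda>\<sigma>. \<Sum>k\<in>A. g k \<sigma>) = (\<Sum>k\<in>A. perm_avg n (g k))"
  unfolding perm_avg_def by (subst sum.swap) (simp add: sum_divide_distrib)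

lemma perm_avg_mult_left: "perm_avg n (\<lambda>\<sigma>. c * g \<sigma>) = c * perm_avg n g"
  by (simp add: perm_avg_def sum_distrib_left)

lemma perm_avg_diff: "perm_avg n (\<lambda>\<sigma>. g \<sigma> - h \<sigma>) = perm_avg n g - perm_avg n h"
  by (simp add: perm_avg_def sum_subtractf diff_divide_distrib)

text \<open>Doubling the weight at \<open>k\<close> expresses the mean of \<open>2 ^ C_k\<close> as
  a partial sum of the coefficients of \<open>exp (z^k / k)\<close>, hence at most
  \<open>exp (1 / k)\<close>. An exponential moment is convenient because \<open>2 ^ c - 1\<close>
  dominates both \<open>c\<close> and \<open>c (c - 1) / 2\<close>.\<close>

lemma perm_avg_two_power_le:
  assumes k: "k \<in> {1..n}"
  shows "perm_avg n (\<lambda>\<sigma>. 2 ^ cycle_count n \<sigma> k - 1) \<le> 2 / real k"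
proof -
  define h :: "nat \<Rightarrow> real" where "h i = (if i = k then 1 else 0)" for i
  have "(\<Prod>i=1..n. (1 + h i) ^ c i) = 2 ^ c k" for c :: "nat \<Rightarrow> nat"
  proof -
    have "(\<Prod>i=1..n. (1 + h i) ^ c i) = (1 + h k) ^ c k * (\<Prod>i\<in>{1..n} - {k}. (1 + h i) ^ c i)"
      using k by (intro prod.remove) auto
    also have "(\<Prod>i\<in>{1..n} - {k}. (1 + h i) ^ c i) = 1"
      by (intro prod.neutral) (auto simp: h_def)
    finally show ?thesis by (simp add: h_def)
  qed
  then have "perm_avg n (\<lambda>\<sigma>. 2 ^ cycle_count n \<sigma> k) = cyc (\<lambda>i. 1 + h i) n"
    using perm_avg_prod[of n "\<lambda>i. 1 + h i"] by simp
  also have "\<dots> = (\<Sum>j\<le>n. cyc h j)" by (rule cyc_add_one)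
  also have "\<dots> \<le> exp (1 / real k)"
  proof -
    have s: "cyc h sums exp (1 / real k)"
      unfolding h_def using sums_cyc_single[of k "1::real"] k by simp
    show ?thesis unfolding sums_unique[OF s]
      by (intro sum_le_suminf sums_summable[OF s]) (auto intro!: cyc_nonneg simp: h_def)
  qed
  finally have "perm_avg n (\<lambda>\<sigma>. 2 ^ cycle_count n \<sigma> k) \<le> exp (1 / real k)" .
  moreover have "exp (1 / real k) - 1 \<le> 2 / real k"
  proof -
    have "exp (1 / real k) - 1 - 1 / real k \<le> (1 / real k)\<^sup>2"
      using k by (intro exp_sub_linear_le) auto
    also have "\<dots> \<le> 1 / real k" using k by (auto simp: power2_eq_square field_simps)
    finally show ?thesis by simp
  qed
  ultimately show ?thesis by (simp add: perm_avg_diff perm_avg_const)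
qed

section \<open>The involution count as a linear statistic plus a nonnegative correction\<close>

definition log_weight :: "nat \<Rightarrow> (nat \<Rightarrow> nat) \<Rightarrow> real" where
  "log_weight n a = (\<Sum>k=1..n. real (a k) * ln (real k))"

definition invol_factor :: "nat \<Rightarrow> nat \<Rightarrow> real" where
  "invol_factor k a = (\<Sum>j\<in>{0..a div 2}. real (falling a (2*j)) / ((2 * real k) ^ j * fact j))"

lemma falling_le: "falling a (2 * j) \<le> (a * (a - 1)) ^ j"
proof (induction j)
  case (Suc j)
  have "falling a (2 * Suc j) = falling a (2 * j) * ((a - 2 * j) * (a - Suc (2 * j)))"
    by (simp add: falling_def mult_ac)
  also have "\<dots> \<le> (a * (a - 1)) ^ j * (a * (a - 1))"
    by (intro mult_le_mono Suc.IH) auto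
  finally show ?case by (simp add: mult_ac)
qed (simp add: falling_def)

lemma invol_factor_ge_1: "invol_factor k a \<ge> 1"
proof -
  have "(\<Sum>j\<in>{0..0}. real (falling a (2*j)) / ((2 * real k) ^ j * fact j)) \<le> invol_factor k a"
    unfolding invol_factor_def by (rule sum_mono2) (auto intro!: divide_nonneg_nonneg)
  then show ?thesis by (simp add: falling_def)
qed

text \<open>Pairing consecutive factors of the falling factorial bounds the sum termwise by the
  exponential series at \<open>a (a - 1) / (2 k)\<close>, and
  \<open>a (a - 1) / 2 \<le> 2 ^ a - 1\<close>.\<close>

lemma ln_invol_factor_le:
  assumes "k \<ge> 1"
  shows "ln (invol_factor k a) \<le> (2 ^ a - 1) / real k"
proof -
  define x where "x = real (a * (a - 1)) / (2 * real k)"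
  have x0: "x \<ge> 0" by (simp add: x_def)
  have "invol_factor k a \<le> (\<Sum>j\<in>{0..a div 2}. x ^ j /\<^sub>R fact j)"
    unfolding invol_factor_def
  proof (rule sum_mono)
    fix j
    have "real (falling a (2 * j)) / ((2 * real k) ^ j * fact j) \<le> real ((a * (a - 1)) ^ j) / ((2 * real k) ^ j * fact j)"
      by (rule divide_right_mono[OF of_nat_mono[OF falling_le]]) simp
    also have "\<dots> = x ^ j / fact j"
      unfolding x_def power_divide of_nat_power divide_divide_eq_left ..
    also have "\<dots> = x ^ j /\<^sub>R fact j"
      by (simp only: real_scaleR_def divide_inverse mult.commute)
    finally show "real (falling a (2 * j)) / ((2 * real k) ^ j * fact j) \<le> x ^ j /\<^sub>R fact j" .
  qed
  also have "\<dots> \<le> exp x"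
    unfolding exp_def using x0 by (intro sum_le_suminf summable_exp_generic) auto
  finally have "ln (invol_factor k a) \<le> ln (exp x)"
    using invol_factor_ge_1[of k a] by (subst ln_le_cancel_iff) auto
  also have "ln (exp x) = x" by simp
  also have "x \<le> (2 * (2 ^ a - 1)) / (2 * real k)"
    unfolding x_def
  proof (rule divide_right_mono)
    have "real a * (real a - 1) + 2 \<le> 2 * 2 ^ a"
    proof (induction a)
      case (Suc a)
      have "real a \<le> 2 ^ a" using of_nat_less_two_power[of a, where 'a = real] by simp
      moreover have "real (Suc a) * (real (Suc a) - 1) + 2 = (real a * (real a - 1) + 2) + 2 * real a"
        by (simp add: algebra_simps)
      moreover have "\<dots> \<le> 2 * 2 ^ a + 2 * 2 ^ a"
        using Suc \<open>real a \<le> 2 ^ a\<close> by (intro add_mono mult_left_mono) auto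
      ultimately show ?case by simp
    qed simp
    then show "real (a * (a - 1)) \<le> 2 * (2 ^ a - 1)" by (cases a) (auto simp: algebra_simps)
  qed simp
  also have "\<dots> = (2 ^ a - 1) / real k" by (rule mult_divide_mult_cancel_left) simp
  finally show ?thesis .
qed

lemma ln_invol:
  "ln (invol n a) = log_weight n a + (\<Sum>k=1..n. ln (invol_factor k (a k)))"
proof -
  have pos: "real k ^ a k * invol_factor k (a k) > 0" if "k \<in> {1..n}" for k
    using that invol_factor_ge_1[of k "a k"] by simp
  have "ln (invol n a) = (\<Sum>k=1..n. ln (real k ^ a k * invol_factor k (a k)))"
    unfolding invol_def invol_factor_def[symmetric] using pos by (intro ln_prod) force+
  also have "\<dots> = (\<Sum>k=1..n. real (a k) * ln (real k) + ln (invol_factor k (a k)))"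
  proof (intro sum.cong refl)
    fix k assume "k \<in> {1..n}"
    then show "ln (real k ^ a k * invol_factor k (a k)) = real (a k) * ln (real k) + ln (invol_factor k (a k))"
      using invol_factor_ge_1[of k "a k"] by (simp add: ln_mult_pos ln_realpow)
  qed
  finally show ?thesis by (simp add: sum.distrib log_weight_def)
qed

text \<open>One factor \<open>1 / k\<close> comes from the logarithm and another from the mean of
  \<open>2 ^ C_k - 1\<close>, so the sum over \<open>k\<close> converges. A correction of bounded
  mean is negligible on the scale \<open>L^(3/2)\<close> of the fluctuations.\<close>

lemma perm_avg_invol_factor:
  "\<exists>C\<ge>0. \<forall>n. perm_avg n (\<lambda>\<sigma>. \<Sum>k=1..n. ln (invol_factor k (cycle_count n \<sigma> k))) \<le> C"
proof -
  have s: "summable (\<lambda>k. 2 * (1 / real k ^ 2))"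
    using inverse_power_summable[of 2, where 'a = real] by (intro summable_mult) (simp add: divide_inverse)
  have "perm_avg n (\<lambda>\<sigma>. \<Sum>k=1..n. ln (invol_factor k (cycle_count n \<sigma> k))) \<le> (\<Sum>k. 2 * (1 / real k ^ 2))" for n
  proof -
    have "perm_avg n (\<lambda>\<sigma>. \<Sum>k=1..n. ln (invol_factor k (cycle_count n \<sigma> k)))
       \<le> perm_avg n (\<lambda>\<sigma>. \<Sum>k=1..n. (1 / real k) * (2 ^ cycle_count n \<sigma> k - 1))"
      using ln_invol_factor_le by (intro perm_avg_mono sum_mono) auto
    also have "\<dots> = (\<Sum>k=1..n. (1 / real k) * perm_avg n (\<lambda>\<sigma>. 2 ^ cycle_count n \<sigma> k - 1))"
      unfolding perm_avg_sum perm_avg_mult_left ..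
    also have "\<dots> \<le> (\<Sum>k=1..n. (1 / real k) * (2 / real k))"
      by (intro sum_mono mult_left_mono perm_avg_two_power_le) auto
    also have "\<dots> = (\<Sum>k=1..n. 2 * (1 / real k ^ 2))"
      by (simp add: power2_eq_square)
    also have "\<dots> \<le> (\<Sum>k. 2 * (1 / real k ^ 2))"
      by (intro sum_le_suminf s) auto
    finally show ?thesis .
  qed
  moreover have "(\<Sum>k. 2 * (1 / real k ^ 2)) \<ge> 0" by (intro suminf_nonneg s) auto
  ultimately show ?thesis by blast
qed

lemma log_weight_nonneg: "log_weight n a \<ge> 0"
  unfolding log_weight_def by (intro sum_nonneg) auto

lemma perm_avg_log_weight_le:
  assumes "n \<ge> 1"
  shows "perm_avg n (\<lambda>\<sigma>. log_weight n (cycle_count n \<sigma>)) \<le> 2 * ln (real n) * (1 + ln (real n))"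
proof -
  have "perm_avg n (\<lambda>\<sigma>. log_weight n (cycle_count n \<sigma>))
     \<le> perm_avg n (\<lambda>\<sigma>. \<Sum>k=1..n. ln (real n) * (2 ^ cycle_count n \<sigma> k - 1))"
  proof (rule perm_avg_mono, unfold log_weight_def, rule sum_mono)
    fix \<sigma> k assume k: "k \<in> {1..n}"
    have "real c \<le> 2 ^ c - 1" for c :: nat
      by (induction c) auto
    then show "real (cycle_count n \<sigma> k) * ln (real k) \<le> ln (real n) * (2 ^ cycle_count n \<sigma> k - 1)"
      using k by (subst mult.commute) (intro mult_mono, auto)
  qed
  also have "\<dots> = (\<Sum>k=1..n. ln (real n) * perm_avg n (\<lambda>\<sigma>. 2 ^ cycle_count n \<sigma> k - 1))"
    unfolding perm_avg_sum perm_avg_mult_left ..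
  also have "\<dots> \<le> (\<Sum>k=1..n. ln (real n) * (2 / real k))"
    using assms by (intro sum_mono mult_left_mono perm_avg_two_power_le) auto
  also have "\<dots> = 2 * ln (real n) * (\<Sum>k=1..n. 1 / real k)"
    by (simp add: sum_distrib_left mult_ac)
  also have "\<dots> \<le> 2 * ln (real n) * (1 + ln (real n))"
    using harm_upper[OF assms] assms by (intro mult_left_mono) auto
  finally show ?thesis .
qed

section \<open>Power sums with imaginary exponents\<close>

abbreviation cis_sum :: "real \<Rightarrow> nat \<Rightarrow> complex" where
  "cis_sum \<theta> n \<equiv> (\<Sum>k=1..n. (cis (\<theta> * ln (real k)) - 1) / of_nat k)"

abbreviation cos_sum :: "real \<Rightarrow> nat \<Rightarrow> real" where
  "cos_sum \<theta> b \<equiv> (\<Sum>k=1..b. (cos (\<theta> * ln (real k)) - 1) / real k)"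

abbreviation cis_coeff :: "real \<Rightarrow> nat \<Rightarrow> complex" where
  "cis_coeff \<theta> n \<equiv> cyc (\<lambda>k. cis (\<theta> * ln (real k))) n"

abbreviation uniform_perm :: "nat \<Rightarrow> (nat \<Rightarrow> nat) measure" where
  "uniform_perm n \<equiv> measure_pmf (pmf_of_set {\<sigma>. \<sigma> permutes {1..n}})"

lemma norm_cis_diff_le: "norm (cis a - cis b) \<le> \<bar>a - b\<bar>"
proof -
  have "cis a - cis b = cis b * (cis (a - b) - 1)"
    by (simp add: right_diff_distrib cis_mult)
  moreover have "norm (cis (a - b) - 1) \<le> \<bar>a - b\<bar>"
    using iexp_approx1[of "a - b" 0] by (simp add: cis_conv_exp)
  ultimately show ?thesis by (simp add: norm_mult)
qed

lemma norm_cis_sub_linear_le: "norm (cis x - 1 - \<i> * x) \<le> x\<^sup>2 / 2"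
  using iexp_approx1[of x 1] by (simp add: cis_conv_exp algebra_simps power2_eq_square abs_mult_self_eq flip: power2_abs)

lemma ln_Suc_diff:
  assumes "1 \<le> k"
  shows "1 / real (Suc k) \<le> ln (real (Suc k)) - ln (real k)"
    and "ln (real (Suc k)) - ln (real k) \<le> 1 / real k"
  using inverse_Suc_le_ln[OF assms] ln_diff_le[of "real (Suc k)" "real k"] assms
  by (auto simp: field_simps)

text \<open>The sum is a Riemann sum at the points \<open>u = ln k\<close> for the integral of
  \<open>exp (i \<theta> u) - 1\<close> over \<open>[0, ln n]\<close>. The integrand vanishes to
  first order in \<theta>, so the error is of order \<theta> uniformly in \<open>n\<close>.\<close>

lemma sum_cis_ln:
  "\<exists>C\<ge>0. \<forall>\<theta> n. \<theta> \<noteq> 0 \<longrightarrow> n \<ge> 1 \<longrightarrow>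
     norm (cis_sum \<theta> n
       - ((cis (\<theta> * ln (real n)) - 1) / (\<i> * \<theta>) - ln (real n))) \<le> C * \<bar>\<theta>\<bar>"
proof -
  define e where "e k = (1 + ln (real k)) / (real k)\<^sup>2" for k
  have "summable (\<lambda>k. real k powr (-3/2))" by (simp add: summable_real_powr_iff)
  moreover have "e \<in> O(\<lambda>k. real k powr (-3/2))" unfolding e_def by real_asymp
  ultimately have se: "summable e"
    using summable_comparison_test_bigo[of "\<lambda>k. real k powr (-3/2)" e] by simp
  have enn: "e k \<ge> 0" for k by (cases "k = 0") (auto simp: e_def)
  have main: "norm (cis_sum \<theta> n
       - ((cis (\<theta> * ln (real n)) - 1) / (\<i> * \<theta>) - ln (real n))) \<le> (suminf e + 1) * \<bar>\<theta>\<bar>"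
    if th: "\<theta> \<noteq> 0" and n: "n \<ge> 1" for \<theta> n
  proof -
    \<comment> \<open>The integral up to \<open>ln k\<close>; it is 0 at
      \<open>k = 1\<close>.\<close>
    define A where "A k = (cis (\<theta> * ln (real k)) - 1) / (\<i> * \<theta>) - ln (real k)" for k
    define g where "g k = (cis (\<theta> * ln (real k)) - 1) / of_nat k" for k :: nat
    have step': "norm (g k - (A (Suc k) - A k)) \<le> \<bar>\<theta>\<bar> * e k" if k: "k \<ge> 1" for k
    proof -
      define D where "D = ln (real (Suc k)) - ln (real k)"
      define w where "w = cis (\<theta> * ln (real k))"
      have D: "1 / real (Suc k) \<le> D" "D \<le> 1 / real k"
        unfolding D_def using ln_Suc_diff[OF k] by auto
      have D0: "D \<ge> 0" using D(1) by (rule order_trans[rotated]) simp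
      have w': "cis (\<theta> * ln (real (Suc k))) = w * cis (\<theta> * D)"
        by (simp add: w_def D_def cis_mult algebra_simps)
      \<comment> \<open>The error of one step has two sources: \<open>1 / k\<close> stands in for
        the step length \<open>D\<close>, and the integrand is frozen at the left endpoint.\<close>
      have eq: "g k - (A (Suc k) - A k) = (w - 1) * of_real (1 / real k - D)
           - w * ((cis (\<theta> * D) - 1 - \<i> * of_real (\<theta> * D)) / (\<i> * \<theta>))"
      proof -
        define z where "z = (cis (\<theta> * D) - 1) / (\<i> * \<theta>)"
        have "A (Suc k) - A k = w * z - of_real D"
          unfolding A_def w' z_def by (simp add: w_def[symmetric] D_def diff_divide_distrib algebra_simps)
        moreover have "(cis (\<theta> * D) - 1 - \<i> * of_real (\<theta> * D)) / (\<i> * \<theta>) = z - of_real D"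
          using th by (simp add: z_def diff_divide_distrib)
        moreover have "g k = (w - 1) * of_real (1 / real k)"
          by (simp add: g_def w_def)
        ultimately show ?thesis by (simp only: of_real_diff) (simp add: algebra_simps)
      qed
      have "norm ((w - 1) * of_real (1 / real k - D)) \<le> (\<bar>\<theta>\<bar> * ln (real k)) * (1 / (real k)\<^sup>2)"
        unfolding norm_mult
      proof (rule mult_mono)
        show "norm (w - 1) \<le> \<bar>\<theta>\<bar> * ln (real k)"
          using norm_cis_diff_le[of "\<theta> * ln (real k)" 0] k by (simp add: w_def abs_mult)
        have "1 / real k - 1 / real (Suc k) = 1 / (real k * real (Suc k))"
          using k by (simp add: field_simps)
        also have "\<dots> \<le> 1 / (real k * real k)"
          using k by (intro divide_left_mono mult_left_mono) auto
        finally have "1 / real k - 1 / real (Suc k) \<le> 1 / (real k)\<^sup>2"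
          by (simp add: power2_eq_square)
        then show "norm (complex_of_real (1 / real k - D)) \<le> 1 / (real k)\<^sup>2"
          unfolding norm_of_real using D by linarith
      qed (use k in auto)
      moreover have "norm (w * ((cis (\<theta> * D) - 1 - \<i> * of_real (\<theta> * D)) / (\<i> * \<theta>)))
          \<le> \<bar>\<theta>\<bar> * (1 / (real k)\<^sup>2)"
      proof -
        have "norm (w * ((cis (\<theta> * D) - 1 - \<i> * of_real (\<theta> * D)) / (\<i> * \<theta>)))
            \<le> ((\<theta> * D)\<^sup>2 / 2) / \<bar>\<theta>\<bar>"
          using divide_right_mono[OF norm_cis_sub_linear_le[of "\<theta> * D"], of "\<bar>\<theta>\<bar>"]
          by (simp add: w_def norm_mult norm_divide)
        also have "\<dots> = \<bar>\<theta>\<bar> * (D\<^sup>2 / 2)" using th by (simp add: power2_eq_square field_simps)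
        also have "D\<^sup>2 \<le> (1 / real k)\<^sup>2" using D D0 by (intro power_mono) auto
        finally have "norm (w * ((cis (\<theta> * D) - 1 - \<i> * of_real (\<theta> * D)) / (\<i> * \<theta>)))
            \<le> \<bar>\<theta>\<bar> * ((1 / real k)\<^sup>2 / 2)" by (simp add: mult_left_mono)
        also have "\<dots> \<le> \<bar>\<theta>\<bar> * (1 / (real k)\<^sup>2)"
          by (intro mult_left_mono) (auto simp: power_divide divide_simps)
        finally show ?thesis .
      qed
      ultimately have "norm (g k - (A (Suc k) - A k))
          \<le> (\<bar>\<theta>\<bar> * ln (real k)) * (1 / (real k)\<^sup>2) + \<bar>\<theta>\<bar> * (1 / (real k)\<^sup>2)"
        unfolding eq by (intro order_trans[OF norm_triangle_ineq4] add_mono)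
      then show ?thesis by (simp add: e_def algebra_simps add_divide_distrib)
    qed
    have tele: "norm ((\<Sum>k=1..<m. g k) - A m) \<le> \<bar>\<theta>\<bar> * (\<Sum>k=1..<m. e k)" if "m \<ge> 1" for m
      using that
    proof (induction m rule: dec_induct)
      case base
      then show ?case by (simp add: A_def)
    next
      case (step m)
      have "(\<Sum>k=1..<Suc m. g k) - A (Suc m) = ((\<Sum>k=1..<m. g k) - A m) + (g m - (A (Suc m) - A m))"
        using step by simp
      also have "norm \<dots> \<le> \<bar>\<theta>\<bar> * (\<Sum>k=1..<m. e k) + \<bar>\<theta>\<bar> * e m"
        using step step'[of m] by (intro order_trans[OF norm_triangle_ineq] add_mono) auto
      finally show ?case using step by (simp add: algebra_simps)
    qed
    have "norm (g n) \<le> \<bar>\<theta>\<bar>"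
    proof -
      have "norm (g n) \<le> \<bar>\<theta> * ln (real n)\<bar> / real n"
        using norm_cis_diff_le[of "\<theta> * ln (real n)" 0]
        by (simp add: g_def norm_divide divide_right_mono)
      also have "\<dots> \<le> \<bar>\<theta>\<bar> * real n / real n"
        using n ln_le_minus_one[of "real n"] by (intro divide_right_mono) (auto simp: abs_mult intro!: mult_left_mono)
      finally show ?thesis using n by simp
    qed
    moreover have "norm ((\<Sum>k=1..<n. g k) - A n) \<le> \<bar>\<theta>\<bar> * suminf e"
      by (rule order_trans[OF tele[OF n]]) (intro mult_left_mono sum_le_suminf se enn, auto)
    moreover have "(\<Sum>k=1..n. g k) - A n = ((\<Sum>k=1..<n. g k) - A n) + g n"
      using n by (simp add: atLeastLessThanSuc_atLeastAtMost[symmetric])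
    ultimately have "norm ((\<Sum>k=1..n. g k) - A n) \<le> \<bar>\<theta>\<bar> * suminf e + \<bar>\<theta>\<bar>"
      using norm_triangle_ineq[of "(\<Sum>k=1..<n. g k) - A n" "g n"] by (simp only:)
    then show ?thesis unfolding g_def A_def by (simp add: algebra_simps)
  qed
  have "suminf e + 1 \<ge> 0" using suminf_nonneg[OF se enn] by simp
  then show ?thesis using main by blast
qed

text \<open>The Taylor polynomial of degree 5 together with \<open>s^4 \<le> 4 s^2\<close> on
  \<open>\<bar>s\<bar> \<le> 2\<close> gives \<open>1/6 - 4/120 = 2/15\<close>; beyond 2 the bound
  \<open>1 / \<bar>s\<bar>\<close> gives \<open>1/2\<close>.\<close>

lemma sin_over_le:
  fixes s :: real assumes "s \<noteq> 0"
  shows "sin s / s \<le> 1 - min (2 * s\<^sup>2 / 15) (1/2)"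
proof -
  have pos: "sin s / s \<le> 1 - min (2 * s\<^sup>2 / 15) (1/2)" if s: "s > 0" for s :: real
  proof (cases "s \<le> 2")
    case True
    have "(\<Sum>m<5. u m) = u 0 + u 1 + u 2 + u 3 + u 4" for u :: "nat \<Rightarrow> real"
      by (simp add: eval_nat_numeral)
    then have "(\<Sum>m<5. sin_coeff m * s ^ m) = s - s ^ 3 / 6"
      by (simp add: sin_coeff_def fact_numeral)
    then have "sin s \<le> s - s ^ 3 / 6 + s ^ 5 / 120"
      using abs_le_D1[OF Maclaurin_sin_bound[of s 5]] s by (simp add: fact_numeral)
    then have "sin s / s \<le> (s - s ^ 3 / 6 + s ^ 5 / 120) / s" using s by (intro divide_right_mono) auto
    also have "\<dots> = 1 - s\<^sup>2 / 6 + s\<^sup>2 * s\<^sup>2 / 120" using s by (simp add: field_simps eval_nat_numeral)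
    also have "s\<^sup>2 * s\<^sup>2 \<le> s\<^sup>2 * 4"
      using True s power_mono[of s 2 2] by (intro mult_left_mono) auto
    finally show ?thesis by simp
  next
    case False
    then have "sin s / s \<le> 1 / s" by (intro divide_right_mono) auto
    also have "\<dots> \<le> 1 / 2" using False by (intro divide_left_mono) auto
    finally show ?thesis using min.cobounded2[of "2 * s\<^sup>2 / 15" "1/2"] by linarith
  qed
  show ?thesis
    using pos[of s] pos[of "-s"] assms by (cases "s > 0") auto
qed

text \<open>Real part of the Riemann sum estimate, where the integral is
  \<open>sin (\<theta> L) / \<theta> - L\<close> with \<open>L = ln b\<close>. This is the source of
  all decay of the characteristic function.\<close>

lemma sum_cos_ln_le:
  "\<exists>C\<ge>0. \<forall>\<theta> b. \<theta> \<noteq> 0 \<longrightarrow> b \<ge> 2 \<longrightarrow>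
     cos_sum \<theta> b
       \<le> C * \<bar>\<theta>\<bar> - ln (real b) * min (2 * (\<theta> * ln (real b))\<^sup>2 / 15) (1/2)"
proof -
  obtain C where C: "C \<ge> 0" "\<And>\<theta> n. \<theta> \<noteq> 0 \<Longrightarrow> n \<ge> 1 \<Longrightarrow>
     norm (cis_sum \<theta> n
       - ((cis (\<theta> * ln (real n)) - 1) / (\<i> * \<theta>) - ln (real n))) \<le> C * \<bar>\<theta>\<bar>"
    using sum_cis_ln by blast
  have "cos_sum \<theta> b
       \<le> C * \<bar>\<theta>\<bar> - ln (real b) * min (2 * (\<theta> * ln (real b))\<^sup>2 / 15) (1/2)"
    if th: "\<theta> \<noteq> 0" and b: "b \<ge> 2" for \<theta> b
  proof -
    let ?L = "ln (real b)"
    have L: "?L > 0" using b by simp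
    have "cos_sum \<theta> b - (sin (\<theta> * ?L) / \<theta> - ?L)
       = Re ((\<Sum>k=1..b. (cis (\<theta> * ln (real k)) - 1) / of_nat k)
       - ((cis (\<theta> * ?L) - 1) / (\<i> * \<theta>) - ?L))"
      using th by (simp add: Re_divide_of_nat Re_divide power2_eq_square)
    also have "\<dots> \<le> C * \<bar>\<theta>\<bar>"
      using C(2)[of \<theta> b] th b by (intro order_trans[OF complex_Re_le_cmod]) auto
    finally have 1: "cos_sum \<theta> b
        \<le> C * \<bar>\<theta>\<bar> + (sin (\<theta> * ?L) / \<theta> - ?L)" by simp
    have "sin (\<theta> * ?L) / \<theta> = ?L * (sin (\<theta> * ?L) / (\<theta> * ?L))" using L by simp
    also have "\<dots> \<le> ?L * (1 - min (2 * (\<theta> * ?L)\<^sup>2 / 15) (1/2))"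
      using L th by (intro mult_left_mono sin_over_le) auto
    finally show ?thesis using 1 by (simp add: algebra_simps)
  qed
  then show ?thesis using C(1) by blast
qed

text \<open>The three retained terms carry the first three cumulants \<open>L^2 / 2\<close>,
  \<open>L^3 / 3\<close>, \<open>L^4 / 4\<close>, each over its factorial. Dividing the fifth-order
  remainder by \<theta> leaves \<open>\<theta>^4 L^5\<close>.\<close>

lemma norm_cis_taylor:
  assumes "\<theta> \<noteq> 0" "L > 0"
  shows "norm ((cis (\<theta> * L) - 1) / (\<i> * \<theta>) - L
      - (\<i> * (\<theta> * L\<^sup>2 / 2) - of_real (\<theta>\<^sup>2 * L ^ 3 / 6) - \<i> * (\<theta> ^ 3 * L ^ 4 / 24))) \<le> \<theta> ^ 4 * L ^ 5 / 120"
proof -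
  let ?s = "\<theta> * L"
  define R where "R = cis ?s - (\<Sum>k\<le>4. (\<i> * ?s) ^ k / fact k)"
  have R: "norm R \<le> \<bar>?s\<bar> ^ 5 / 120"
    using iexp_approx1[of ?s 4] by (simp add: R_def cis_conv_exp fact_numeral)
  have S: "(\<Sum>k\<le>4. (\<i> * ?s) ^ k / fact k) = 1 + \<i> * ?s - ?s\<^sup>2 / 2 - \<i> * ?s ^ 3 / 6 + ?s ^ 4 / 24"
    by (simp add: eval_nat_numeral fact_numeral algebra_simps)
  have "(cis ?s - 1) / (\<i> * \<theta>) - L
      - (\<i> * (\<theta> * L\<^sup>2 / 2) - of_real (\<theta>\<^sup>2 * L ^ 3 / 6) - \<i> * (\<theta> ^ 3 * L ^ 4 / 24)) = R / (\<i> * \<theta>)"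
    unfolding R_def S using assms by (simp add: field_simps eval_nat_numeral)
  also have "norm \<dots> \<le> (\<bar>?s\<bar> ^ 5 / 120) / \<bar>\<theta>\<bar>"
    using divide_right_mono[OF R, of "\<bar>\<theta>\<bar>"] by (simp add: norm_divide norm_mult)
  also have "\<dots> = \<theta> ^ 4 * L ^ 5 / 120"
  proof -
    have "\<bar>?s\<bar> ^ 5 = \<bar>\<theta>\<bar> * (\<bar>\<theta>\<bar> ^ 4 * L ^ 5)" using assms by (simp add: abs_mult power_mult_distrib eval_nat_numeral)
    then show ?thesis using assms by simp
  qed
  finally show ?thesis .
qed

section \<open>Smoothing with the Fejer kernel\<close>

text \<open>The kernel is left unnormalised: only the positivity of its integral matters.\<close>

definition fejer :: "real \<Rightarrow> real" where
  "fejer u = (1 - cos u) / u\<^sup>2"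

lemma fejer_nonneg: "fejer u \<ge> 0"
  by (simp add: fejer_def)

lemma fejer_minus [simp]: "fejer (- u) = fejer u"
  by (simp add: fejer_def)

lemma borel_measurable_fejer [measurable]: "fejer \<in> borel_measurable borel"
  unfolding fejer_def by measurable

lemma fejer_le: "fejer u \<le> 3 * inverse (1 + u\<^sup>2)"
proof (cases "u = 0")
  case False
  have "1 - cos u \<le> u\<^sup>2 / 2"
  proof -
    have "(sin (u / 2))\<^sup>2 \<le> (u / 2)\<^sup>2"
      using abs_sin_x_le_abs_x[of "u / 2"] by (simp only: abs_le_square_iff)
    then show ?thesis using cos_double_sin[of "u / 2"] by (simp add: power_divide)
  qed
  moreover have "u\<^sup>2 * (1 - cos u) \<le> u\<^sup>2 * 2"
    using cos_ge_minus_one[of u] by (intro mult_left_mono) auto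
  moreover have "(1 - c) * (1 + U) \<le> 3 * U" if "1 - c \<le> U / 2" "U * (1 - c) \<le> U * 2" "0 \<le> U" for c U :: real
    using that by (simp add: algebra_simps)
  ultimately have "(1 - cos u) * (1 + u\<^sup>2) \<le> 3 * u\<^sup>2" by simp
  moreover have "1 + u\<^sup>2 > 0" by (simp add: add_pos_nonneg)
  ultimately show ?thesis using False by (simp add: fejer_def field_simps)
qed (simp add: fejer_def)

lemma integrable_fejer: "integrable lborel fejer"
proof (rule Bochner_Integration.integrable_bound)
  show "integrable lborel (\<lambda>u. 3 * inverse (1 + u\<^sup>2) :: real)"
    using integrable_inverse_1_plus_square by (simp add: set_integrable_def einterval_def)
qed (use fejer_le fejer_nonneg in auto)

lemma integral_fejer_pos: "(\<integral>u. fejer u \<partial>lborel) > 0"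
proof -
  have c: "cos (1::real) < 1" using cos_monotone_0_pi[of 0 1] pi_gt3 by simp
  have "0 < (1 - cos 1) / 4 * measure lborel {1..2::real}" using c by simp
  also have "\<dots> = (\<integral>u. (1 - cos 1) / 4 * indicator {1..2::real} u \<partial>lborel)" by simp
  also have "\<dots> \<le> (\<integral>u. fejer u \<partial>lborel)"
  proof (rule integral_mono[OF _ integrable_fejer])
    fix u :: real
    show "(1 - cos 1) / 4 * indicator {1..2} u \<le> fejer u"
    proof (cases "u \<in> {1..2}")
      case True
      have "cos u \<le> cos 1" using True pi_gt3 by (intro cos_monotone_0_pi_le) auto
      moreover have "u\<^sup>2 \<le> 4" using True power_mono[of u 2 2] by auto
      ultimately have "(1 - cos 1) / 4 \<le> (1 - cos u) / u\<^sup>2"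
        using True c by (intro frac_le) auto
      then show ?thesis using True by (simp add: fejer_def)
    qed (simp add: fejer_nonneg)
  qed simp
  finally show ?thesis .
qed

abbreviation fejer_tail_mass :: "real \<Rightarrow> real" where
  "fejer_tail_mass R \<equiv> (\<integral>u. fejer u * indicator {u. \<bar>u\<bar> > R} u \<partial>lborel)"

lemma fejer_tail:
  assumes "\<epsilon> > 0"
  shows "\<exists>R>0. fejer_tail_mass R < \<epsilon>"
proof -
  have "(\<lambda>n::nat. fejer_tail_mass (real n)) \<longlonglongrightarrow> (\<integral>u. 0 \<partial>(lborel :: real measure))"
  proof (rule integral_dominated_convergence[where w = fejer])
    show "AE u in lborel. (\<lambda>n::nat. fejer u * indicator {u. \<bar>u\<bar> > real n} u) \<longlonglongrightarrow> 0"
    proof (rule AE_I2, rule tendsto_eventually)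
      fix u :: real
      obtain N where "\<bar>u\<bar> \<le> real N" using real_arch_simple by blast
      then show "eventually (\<lambda>n::nat. fejer u * indicator {u. \<bar>u\<bar> > real n} u = 0) sequentially"
        by (intro eventually_sequentiallyI[of N]) (auto simp: indicator_def)
    qed
  qed (auto simp: integrable_fejer fejer_nonneg indicator_def)
  then have "eventually (\<lambda>n::nat. fejer_tail_mass (real n) < \<epsilon>) sequentially"
    using assms by (intro order_tendstoD(2)[where a = \<epsilon>]) auto
  then have "eventually (\<lambda>n::nat. n > 0 \<and> fejer_tail_mass (real n) < \<epsilon>) sequentially"
    by (intro eventually_conj eventually_gt_at_top)
  then obtain n :: nat where "n > 0" "fejer_tail_mass (real n) < \<epsilon>"
    by (auto simp: eventually_sequentially)
  then show ?thesis by (intro exI[of _ "real n"]) auto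
qed

text \<open>Where \<Delta> comes near its bound \<eta>, the one-sided slope condition keeps it above
  \<open>c\<close> on all of \<open>[z, z + 2 R / T]\<close>. The kernel centred in that interval
  sees mostly these values, and its tails cost at most \<eta> times
  \<open>\<kappa> / 8\<close>.\<close>

lemma desmoothing_one_sided:
  fixes \<Delta> :: "real \<Rightarrow> real"
  assumes R: "fejer_tail_mass R \<le> \<kappa> / 8" "R > 0"
    and \<kappa>: "\<kappa> = (\<integral>u. fejer u \<partial>lborel)"
    and meas [measurable]: "\<Delta> \<in> borel_measurable borel" and B: "\<And>x. \<bar>\<Delta> x\<bar> \<le> \<eta>"
    and m: "m \<ge> 0" and up: "\<And>x s. s \<ge> 0 \<Longrightarrow> \<Delta> (x + s) \<ge> \<Delta> x - m * s" and T: "T > 0"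
    and D: "\<And>x. \<bar>\<integral>u. \<Delta> (x - u / T) * fejer u \<partial>lborel\<bar> \<le> \<epsilon>"
    and z: "\<Delta> z \<ge> 3/4 * \<eta>"
  shows "\<eta> \<le> 2 * (\<epsilon> / \<kappa> + 2 * m * R / T)"
proof (cases "3/4 * \<eta> \<le> 2 * m * R / T")
  case True
  have "0 \<le> \<epsilon>" using D[of 0] by linarith
  then have "0 \<le> \<epsilon> / \<kappa>" using integral_fejer_pos \<kappa> by simp
  moreover have "\<eta> \<ge> 0" using B[of 0] by linarith
  moreover have "\<eta> \<le> 2 * (e + w)" if "3/4 * \<eta> \<le> w" "0 \<le> e" "0 \<le> \<eta>" for e w :: real
    using that by argo
  ultimately show ?thesis using True by blast
next
  case False
  define c where "c = 3/4 * \<eta> - 2 * m * R / T"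
  have c: "c > 0" using False by (simp add: c_def)
  have \<eta>0: "\<eta> \<ge> 0" using B[of 0] by linarith
  \<comment> \<open>Centred so that \<open>\<bar>u\<bar> \<le> R\<close> corresponds exactly to
    \<open>[z, z + 2 R / T]\<close>.\<close>
  define x where "x = z + R / T"
  let ?J = "indicator {u. \<bar>u\<bar> > R} :: real \<Rightarrow> real"
  have int: "integrable lborel (\<lambda>u. fejer u * ?J u)"
    by (rule Bochner_Integration.integrable_bound[OF integrable_fejer])
       (auto simp: fejer_nonneg indicator_def)
  have intD: "integrable lborel (\<lambda>u. \<Delta> (x - u / T) * fejer u)"
  proof (rule Bochner_Integration.integrable_bound[where f = "\<lambda>u. \<eta> * fejer u"])
    show "AE u in lborel. norm (\<Delta> (x - u / T) * fejer u) \<le> norm (\<eta> * fejer u)"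
      using B \<eta>0 by (intro AE_I2) (auto simp: abs_mult fejer_nonneg intro!: mult_right_mono)
  qed (auto simp: integrable_fejer)
  have pt: "c * fejer u - (c + \<eta>) * (fejer u * ?J u) \<le> \<Delta> (x - u / T) * fejer u" for u
  proof (cases "\<bar>u\<bar> > R")
    case True
    have "- \<eta> * fejer u \<le> \<Delta> (x - u / T) * fejer u"
      using B[of "x - u / T"] by (intro mult_right_mono fejer_nonneg) auto
    then show ?thesis using True by (simp add: algebra_simps)
  next
    case False
    define s where "s = R / T - u / T"
    have "s = (R - u) / T" by (simp add: s_def diff_divide_distrib)
    then have s: "0 \<le> s" "s \<le> 2 * R / T" using False T by (auto intro!: divide_right_mono)
    have "\<Delta> (z + s) \<ge> 3/4 * \<eta> - m * (2 * R / T)"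
      using up[OF s(1), of z] z mult_left_mono[OF s(2) m] by linarith
    then have "c \<le> \<Delta> (x - u / T)" by (simp add: c_def x_def s_def algebra_simps)
    then show ?thesis using False by (simp add: mult_right_mono fejer_nonneg)
  qed
  have "c * \<kappa> - (c + \<eta>) * (\<kappa> / 8) \<le> c * \<kappa> - (c + \<eta>) * (\<integral>u. fejer u * ?J u \<partial>lborel)"
    using R c \<eta>0 by (intro diff_left_mono mult_left_mono) auto
  also have "\<dots> = (\<integral>u. c * fejer u - (c + \<eta>) * (fejer u * ?J u) \<partial>lborel)"
    using int integrable_fejer by (simp add: \<kappa>)
  also have "\<dots> \<le> (\<integral>u. \<Delta> (x - u / T) * fejer u \<partial>lborel)"
    using int integrable_fejer intD by (intro integral_mono pt) auto
  also have "\<dots> \<le> \<epsilon>" using D[of x] by linarith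
  also have "c * \<kappa> - (c + \<eta>) * (\<kappa> / 8) = (7 * c - \<eta>) / 8 * \<kappa>" by (simp add: field_simps)
  finally have "(7 * c - \<eta>) / 8 * \<kappa> \<le> \<epsilon>" .
  moreover have "\<kappa> > 0" using integral_fejer_pos \<kappa> by simp
  ultimately have "(7 * c - \<eta>) / 8 \<le> \<epsilon> / \<kappa>" by (simp add: pos_le_divide_eq)
  moreover have "0 \<le> \<epsilon> / \<kappa>" using D[of 0] \<open>\<kappa> > 0\<close> by simp
  moreover have "0 \<le> 2 * m * R / T" using m R(2) T by simp
  \<comment> \<open>The left side is \<open>(17 \<eta> - 28 w) / 32\<close>, whence
    \<open>\<eta> \<le> (32 e + 28 w) / 17\<close>; so the levels 3/4 and 1/8 lead to the factor
    2.\<close>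
  moreover have "\<eta> \<le> 2 * (e + w)" if "(7 * (3/4 * \<eta> - w) - \<eta>) / 8 \<le> e" "0 \<le> e" "0 \<le> w" for e w :: real
    using that by simp
  ultimately show ?thesis unfolding c_def by blast
qed

text \<open>The supremum may not be attained, so a point reaching 3/4 of it is used. If \<Delta> is
  negative there, \<open>- \<Delta> (- x)\<close> satisfies the same one-sided condition and the
  same smoothing bound, because the kernel is even.\<close>

lemma desmoothing:
  "\<exists>C>0. \<forall>\<Delta> B m T \<epsilon>. \<Delta> \<in> borel_measurable borel \<longrightarrow> (\<forall>x. \<bar>\<Delta> x\<bar> \<le> B) \<longrightarrow> m \<ge> 0 \<longrightarrow>
     (\<forall>x s. s \<ge> 0 \<longrightarrow> \<Delta> (x + s) \<ge> \<Delta> x - m * s) \<longrightarrow> T > 0 \<longrightarrow>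
     (\<forall>x. \<bar>\<integral>u. \<Delta> (x - u / T) * fejer u \<partial>lborel\<bar> \<le> \<epsilon>) \<longrightarrow>
     (\<forall>x::real. \<bar>\<Delta> x\<bar> \<le> C * (\<epsilon> + m / T :: real))"
proof -
  define \<kappa> where "\<kappa> = (\<integral>u. fejer u \<partial>lborel)"
  have \<kappa>: "\<kappa> > 0" unfolding \<kappa>_def by (rule integral_fejer_pos)
  obtain R where R: "R > 0" "fejer_tail_mass R < \<kappa> / 8"
    using fejer_tail[of "\<kappa> / 8"] \<kappa> by auto
  define C where "C = 2 / \<kappa> + 4 * R"
  have C: "C > 0" using \<kappa> R by (simp add: C_def add_pos_pos)
  have "\<bar>\<Delta> x\<bar> \<le> C * (\<epsilon> + m / T)"
    if meas [measurable]: "\<Delta> \<in> borel_measurable borel" and B: "\<And>x. \<bar>\<Delta> x\<bar> \<le> B" and m: "m \<ge> 0"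
      and up: "\<And>x s. s \<ge> 0 \<Longrightarrow> \<Delta> (x + s) \<ge> \<Delta> x - m * s" and T: "T > 0"
      and D: "\<And>x. \<bar>\<integral>u. \<Delta> (x - u / T) * fejer u \<partial>lborel\<bar> \<le> \<epsilon>"
    for \<Delta> B m T \<epsilon> and x :: real
  proof -
    define \<eta> where "\<eta> = (SUP x. \<bar>\<Delta> x\<bar>)"
    have bdd: "bdd_above (range (\<lambda>x. \<bar>\<Delta> x\<bar>))" using B by (auto intro!: bdd_aboveI[of _ B])
    have le: "\<bar>\<Delta> x\<bar> \<le> \<eta>" for x unfolding \<eta>_def by (rule cSUP_upper[OF _ bdd]) simp
    have \<epsilon>0: "\<epsilon> \<ge> 0" using D[of 0] by linarith
    have "\<eta> \<le> 2 * (\<epsilon> / \<kappa> + 2 * m * R / T)"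
    proof (cases "\<eta> > 0")
      case True
      then obtain z where z: "\<bar>\<Delta> z\<bar> > 3/4 * \<eta>"
        using less_cSUP_iff[OF _ bdd, of "3/4 * \<eta>"] by (auto simp: \<eta>_def[symmetric])
      show ?thesis
      proof (cases "\<Delta> z \<ge> 0")
        case True
        then show ?thesis
          using z R D up le m T by (intro desmoothing_one_sided[where \<Delta> = \<Delta> and z = z]) (auto simp: \<kappa>_def)
      next
        case False
        have D': "\<bar>\<integral>u. - \<Delta> (- (x - u / T)) * fejer u \<partial>lborel\<bar> \<le> \<epsilon>" for x
        proof -
          have "(\<integral>u. \<Delta> (- x - u / T) * fejer u \<partial>lborel) = (\<integral>u. \<Delta> (- x + u / T) * fejer u \<partial>lborel)"
            by (subst lborel_integral_real_affine[where c = "-1" and t = 0]) auto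
          then show ?thesis using D[of "-x"] by (simp add: algebra_simps)
        qed
        have up': "- \<Delta> (- (x + s)) \<ge> - \<Delta> (- x) - m * s" if "s \<ge> 0" for x s
          using up[OF that, of "- x - s"] by simp
        show ?thesis
          using z R D' up' le m T False
          by (intro desmoothing_one_sided[where \<Delta> = "\<lambda>x. - \<Delta> (- x)" and z = "- z"]) (auto simp: \<kappa>_def)
      qed
    next
      case False
      have "0 \<le> 2 * (\<epsilon> / \<kappa> + 2 * m * R / T)" using \<epsilon>0 \<kappa> m R T by simp
      then show ?thesis using False by linarith
    qed
    also have "\<dots> = 2 / \<kappa> * \<epsilon> + 4 * R * (m / T)" by (simp add: algebra_simps)
    also have "\<dots> \<le> C * \<epsilon> + C * (m / T)"
      using \<epsilon>0 m T R \<kappa> by (intro add_mono mult_right_mono) (auto simp: C_def)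
    finally show ?thesis using le[of x] by (simp add: algebra_simps)
  qed
  then show ?thesis using C by blast
qed

section \<open>Fourier transforms of distribution functions and of the Fejer kernel\<close>

lemma has_bochner_integral_iexp_Icc:
  fixes a b t :: real
  assumes "t \<noteq> 0" "a \<le> b"
  shows "has_bochner_integral lborel (\<lambda>y. indicator {a..b} y *\<^sub>R iexp (t * y))
    ((iexp (t * b) - iexp (t * a)) / (\<i> * t))"
proof -
  have "has_bochner_integral lborel (\<lambda>y. indicator {a..b} y *\<^sub>R iexp (t * y))
     (iexp (t * b) / (\<i> * t) - iexp (t * a) / (\<i> * t))"
  proof (rule has_bochner_integral_FTC_Icc[OF assms(2)])
    fix y :: real
    have "((\<lambda>z. exp (\<i> * (of_real t * z)) / (\<i> * of_real t)) has_field_derivative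
        exp (\<i> * (of_real t * of_real y))) (at (of_real y))"
      using assms(1) by (auto intro!: derivative_eq_intros simp: algebra_simps)
    from has_vector_derivative_real_field[OF this]
    show "((\<lambda>y. iexp (t * y) / (\<i> * t)) has_vector_derivative iexp (t * y)) (at y within {a..b})"
      by simp
  qed (auto intro!: continuous_intros)
  then show ?thesis by (simp add: diff_divide_distrib)
qed

text \<open>Distribution function of the point mass at \<open>a\<close> minus that of the point mass
  at 0. Unlike a distribution function it is integrable, with norm \<open>\<bar>a\<bar>\<close>, so
  it has a Fourier transform.\<close>

definition heaviside_diff :: "real \<Rightarrow> real \<Rightarrow> real" where
  "heaviside_diff a y = indicator {a..} y - indicator {0..} y"

lemma borel_measurable_heaviside_diff [measurable]:
  "(\<lambda>p. heaviside_diff (fst p) (snd p)) \<in> borel_measurable (borel \<Otimes>\<^sub>M borel)"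
proof -
  have "heaviside_diff (fst p) (snd p) = (if fst p \<le> snd p then 1 else 0) - indicator {0..} (snd p)" for p
    by (simp add: heaviside_diff_def indicator_def)
  then show ?thesis by simp
qed

lemma heaviside_diff_AE:
  "AE y in lborel. heaviside_diff a y =
     (if 0 \<le> a then - indicator {0..a} y else indicator {a..0} y)"
  using AE_lborel_singleton[of a] AE_lborel_singleton[of 0]
  by eventually_elim (auto simp: heaviside_diff_def indicator_def)

lemma has_bochner_integral_abs_heaviside_diff:
  "has_bochner_integral lborel (\<lambda>y. \<bar>heaviside_diff a y\<bar>) \<bar>a\<bar>"
proof (rule has_bochner_integral_cong_AE[THEN iffD1])
  show "AE y in lborel. indicator {min 0 a..max 0 a} y = \<bar>heaviside_diff a y\<bar>"
    using heaviside_diff_AE[of a] by eventually_elim (auto simp: indicator_def split: if_splits)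
  have "has_bochner_integral lborel (indicator {min 0 a..max 0 a} :: real \<Rightarrow> real) (measure lborel {min 0 a..max 0 a})"
    by (rule has_bochner_integral_real_indicator) (auto simp: emeasure_lborel_Icc_eq)
  also have "measure lborel {min 0 a..max 0 a} = \<bar>a\<bar>"
    by (cases "0 \<le> a") auto
  finally show "has_bochner_integral lborel (\<lambda>y. indicator {min 0 a..max 0 a} y :: real) \<bar>a\<bar>" .
qed (auto simp: heaviside_diff_def)

lemma has_bochner_integral_heaviside_diff_iexp:
  assumes "t \<noteq> 0"
  shows "has_bochner_integral lborel (\<lambda>y. heaviside_diff a y *\<^sub>R iexp (t * y)) (- (iexp (t * a) - 1) / (\<i> * t))"
proof (rule has_bochner_integral_cong_AE[THEN iffD1])
  show "AE y in lborel. (if 0 \<le> a then - indicator {0..a} y else indicator {a..0} y) *\<^sub>R iexp (t * y)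
      = heaviside_diff a y *\<^sub>R iexp (t * y)"
    using heaviside_diff_AE[of a] by eventually_elim simp
  show "has_bochner_integral lborel (\<lambda>y. (if 0 \<le> a then - indicator {0..a} y else indicator {a..0} y) *\<^sub>R iexp (t * y))
      (- (iexp (t * a) - 1) / (\<i> * t))"
  proof (cases "0 \<le> a")
    case True
    then show ?thesis
      using has_bochner_integral_minus[OF has_bochner_integral_iexp_Icc[OF assms True]]
      by (simp add: diff_divide_distrib minus_divide_left)
  next
    case False
    then show ?thesis
      using has_bochner_integral_iexp_Icc[OF assms, of a 0] by (simp add: diff_divide_distrib)
  qed
qed (auto simp: heaviside_diff_def)

text \<open>Fubini for \<open>heaviside_diff\<close> averaged over \<open>a\<close>; the finite
  first moment is exactly its absolute integrability. The step at 0 is common to all distributions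
  and cancels when two of them are compared.\<close>

lemma (in real_distribution) fourier_cdf:
  assumes int: "integrable M (\<lambda>x. x)"
  shows "integrable lborel (\<lambda>y. cdf M y - indicator {0..} y)"
    and "t \<noteq> 0 \<Longrightarrow> (\<integral>y. (cdf M y - indicator {0..} y) *\<^sub>R iexp (t * y) \<partial>lborel) = - (char M t - 1) / (\<i> * t)"
proof -
  interpret P: pair_sigma_finite M lborel ..
  have M_eq: "\<And>f y. (\<integral>a. heaviside_diff a y \<partial>M) = cdf M y - indicator {0..} y"
  proof -
    fix y :: real
    have "(\<integral>a. heaviside_diff a y \<partial>M) = (\<integral>a. indicator {..y} a - indicator {0..} y \<partial>M)"
      by (intro Bochner_Integration.integral_cong) (auto simp: heaviside_diff_def indicator_def)
    also have "\<dots> = cdf M y - indicator {0..} y"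
      using prob_space
      by (subst Bochner_Integration.integral_diff)
         (auto simp: cdf_def less_top[symmetric] intro!: integrable_real_indicator)
    finally show "(\<integral>a. heaviside_diff a y \<partial>M) = cdf M y - indicator {0..} y" .
  qed
  have M_int: "integrable M (\<lambda>a. heaviside_diff a y)" for y
  proof -
    have "(\<lambda>a. heaviside_diff a y) = (\<lambda>a. indicator {..y} a - indicator {0..} y)"
      by (auto simp: heaviside_diff_def indicator_def)
    moreover have "integrable M (indicator {..y} :: real \<Rightarrow> real)"
      by (intro integrable_real_indicator) (auto simp: less_top[symmetric])
    ultimately show ?thesis by simp
  qed
  have meas [measurable]: "heaviside_diff a \<in> borel_measurable borel" for a
    unfolding heaviside_diff_def[abs_def] by measurable
  have prod: "integrable (M \<Otimes>\<^sub>M lborel) (\<lambda>p. heaviside_diff (fst p) (snd p) *\<^sub>R iexp (t * snd p))" for t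
  proof (rule P.Fubini_integrable)
    show "(\<lambda>p. heaviside_diff (fst p) (snd p) *\<^sub>R iexp (t * snd p)) \<in> borel_measurable (M \<Otimes>\<^sub>M lborel)"
    proof -
      have "(\<lambda>p. heaviside_diff (fst p) (snd p) *\<^sub>R iexp (t * snd p)) \<in> borel_measurable (borel \<Otimes>\<^sub>M borel)"
        by (intro borel_measurable_scaleR borel_measurable_heaviside_diff) measurable
      moreover have "sets (M \<Otimes>\<^sub>M lborel) = sets (borel \<Otimes>\<^sub>M borel :: (real \<times> real) measure)"
        by (intro sets_pair_measure_cong) auto
      ultimately show ?thesis using measurable_cong_sets by blast
    qed
    have "(\<integral>y. norm (heaviside_diff (fst (a, y)) (snd (a, y)) *\<^sub>R iexp (t * snd (a, y))) \<partial>lborel) = \<bar>a\<bar>" for a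
      using has_bochner_integral_abs_heaviside_diff[of a] by (simp add: has_bochner_integral_iff)
    then show "integrable M (\<lambda>a. \<integral>y. norm (heaviside_diff (fst (a, y)) (snd (a, y)) *\<^sub>R iexp (t * snd (a, y))) \<partial>lborel)"
      using int by simp
    show "AE a in M. integrable lborel (\<lambda>y. heaviside_diff (fst (a, y)) (snd (a, y)) *\<^sub>R iexp (t * snd (a, y)))"
    proof (rule AE_I2)
      fix a
      have "integrable lborel (heaviside_diff a)"
        using has_bochner_integral_abs_heaviside_diff[of a] meas
        by (subst integrable_abs_iff[symmetric]) (simp_all add: has_bochner_integral_iff)
      then show "integrable lborel (\<lambda>y. heaviside_diff (fst (a, y)) (snd (a, y)) *\<^sub>R iexp (t * snd (a, y)))"
        by (rule Bochner_Integration.integrable_bound) (auto simp: norm_mult)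
    qed
  qed
  have prod0: "integrable (M \<Otimes>\<^sub>M lborel) (\<lambda>p. heaviside_diff (fst p) (snd p))"
    by (rule Bochner_Integration.integrable_bound[OF prod[of 0]]) auto
  show "integrable lborel (\<lambda>y. cdf M y - indicator {0..} y)"
    using P.integrable_snd[of "\<lambda>a y. heaviside_diff a y"] prod0
    by (simp add: M_eq case_prod_beta')
  assume t: "t \<noteq> 0"
  have "(\<integral>y. (cdf M y - indicator {0..} y) *\<^sub>R iexp (t * y) \<partial>lborel)
      = (\<integral>y. (\<integral>a. heaviside_diff a y *\<^sub>R iexp (t * y) \<partial>M) \<partial>lborel)"
    unfolding M_eq[symmetric]
    by (intro Bochner_Integration.integral_cong refl integral_scaleR_left[symmetric] M_int)
  also have "\<dots> = (\<integral>a. (\<integral>y. heaviside_diff a y *\<^sub>R iexp (t * y) \<partial>lborel) \<partial>M)"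
    using P.Fubini_integral[of "\<lambda>a y. heaviside_diff a y *\<^sub>R iexp (t * y)"] prod[of t]
    by (simp add: case_prod_beta')
  also have "\<dots> = (\<integral>a. - (iexp (t * a) - 1) / (\<i> * t) \<partial>M)"
    using has_bochner_integral_heaviside_diff_iexp[OF t] by (simp add: has_bochner_integral_iff)
  also have "\<dots> = - (char M t - 1) / (\<i> * t)"
    using integrable_iexp[of "\<lambda>x. t * x"] prob_space
    by (simp add: char_def)
  finally show "(\<integral>y. (cdf M y - indicator {0..} y) *\<^sub>R iexp (t * y) \<partial>lborel) = - (char M t - 1) / (\<i> * t)" .
qed


text \<open>The kernel is the transform of a triangle supported on \<open>[-1, 1]\<close>. Compact
  support confines smoothing at scale \<open>1 / T\<close> to the frequencies
  \<open>\<bar>t\<bar> \<le> T\<close>.\<close>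

lemma fejer_fourier:
  assumes v: "v \<noteq> 0"
  shows "has_bochner_integral lborel (\<lambda>s. (indicator {-1..1} s * ((1 - \<bar>s\<bar>) / 2)) *\<^sub>R iexp (s * v)) (of_real (fejer v))"
proof -
  let ?e = "\<lambda>z::complex. exp (\<i> * (z * of_real v))"
  have pos: "has_bochner_integral lborel (\<lambda>s. indicator {0..1} s *\<^sub>R ((1 - of_real s) * ?e (of_real s)))
     (((1 - of_real 1) / (\<i> * v) * ?e (of_real 1) - ?e (of_real 1) / v\<^sup>2)
       - ((1 - of_real 0) / (\<i> * v) * ?e (of_real 0) - ?e (of_real 0) / v\<^sup>2))"
  proof (rule has_bochner_integral_FTC_Icc)
    fix s :: real
    have "((\<lambda>z. (1 - z) / (\<i> * v) * ?e z - ?e z / v\<^sup>2) has_field_derivative (1 - of_real s) * ?e (of_real s)) (at (of_real s))"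
      using v by (auto intro!: derivative_eq_intros simp: field_simps power2_eq_square)
    from has_vector_derivative_real_field[OF this]
    show "((\<lambda>s. (1 - of_real s) / (\<i> * v) * ?e (of_real s) - ?e (of_real s) / v\<^sup>2) has_vector_derivative
       (1 - of_real s) * ?e (of_real s)) (at s within {0..1})" .
  qed (auto intro!: continuous_intros)
  have neg: "has_bochner_integral lborel (\<lambda>s. indicator {-1..0} s *\<^sub>R ((1 + of_real s) * ?e (of_real s)))
     (((1 + of_real 0) / (\<i> * v) * ?e (of_real 0) + ?e (of_real 0) / v\<^sup>2)
       - ((1 + of_real (-1)) / (\<i> * v) * ?e (of_real (-1)) + ?e (of_real (-1)) / v\<^sup>2))"
  proof (rule has_bochner_integral_FTC_Icc)
    fix s :: real
    have "((\<lambda>z. (1 + z) / (\<i> * v) * ?e z + ?e z / v\<^sup>2) has_field_derivative (1 + of_real s) * ?e (of_real s)) (at (of_real s))"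
      using v by (auto intro!: derivative_eq_intros simp: field_simps power2_eq_square)
    from has_vector_derivative_real_field[OF this]
    show "((\<lambda>s. (1 + of_real s) / (\<i> * v) * ?e (of_real s) + ?e (of_real s) / v\<^sup>2) has_vector_derivative
       (1 + of_real s) * ?e (of_real s)) (at s within {-1..0})" .
  qed (auto intro!: continuous_intros)
  have sum: "has_bochner_integral lborel (\<lambda>s. (1/2) *\<^sub>R (indicator {-1..0} s *\<^sub>R ((1 + of_real s) * ?e (of_real s))
      + indicator {0..1} s *\<^sub>R ((1 - of_real s) * ?e (of_real s)))) (of_real (fejer v))"
  proof -
    have e: "?e 1 + ?e (-1) = of_real (2 * cos v)"
      by (simp add: complex_eq_iff Re_exp Im_exp)
    have "(1/2) *\<^sub>R ((((1 + of_real 0) / (\<i> * v) * ?e (of_real 0) + ?e (of_real 0) / v\<^sup>2)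
       - ((1 + of_real (-1)) / (\<i> * v) * ?e (of_real (-1)) + ?e (of_real (-1)) / v\<^sup>2))
       + (((1 - of_real 1) / (\<i> * v) * ?e (of_real 1) - ?e (of_real 1) / v\<^sup>2)
       - ((1 - of_real 0) / (\<i> * v) * ?e (of_real 0) - ?e (of_real 0) / v\<^sup>2)))
       = (2 - (?e 1 + ?e (-1))) / (2 * (of_real v)\<^sup>2)" (is "?l = _")
      by (simp add: scaleR_conv_of_real diff_divide_distrib add_divide_distrib mult.commute[of _ 2])
    also have "\<dots> = of_real (fejer v)"
      unfolding e by (simp add: fejer_def diff_divide_distrib)
    finally have "?l = of_real (fejer v)" .
    then show ?thesis
      using has_bochner_integral_scaleR_right[OF has_bochner_integral_add[OF neg pos], of "1/2"] by simp
  qed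
  show ?thesis
  proof (rule has_bochner_integral_cong_AE[THEN iffD1, OF _ _ _ sum])
    show "AE s in lborel. (1/2) *\<^sub>R (indicator {-1..0} s *\<^sub>R ((1 + of_real s) * ?e (of_real s))
      + indicator {0..1} s *\<^sub>R ((1 - of_real s) * ?e (of_real s)))
      = (indicator {-1..1} s * ((1 - \<bar>s\<bar>) / 2)) *\<^sub>R iexp (s * v)"
      using AE_lborel_singleton[of 0]
      by eventually_elim (auto simp: indicator_def scaleR_conv_of_real)
  qed auto
qed

text \<open>Writing the kernel as a transform and exchanging integrals leaves the transform of
  \<Delta> at \<open>- T s\<close> with weight at most 1/2; the substitution
  \<open>t = - T s\<close> absorbs the factor \<open>T\<close>.\<close>

lemma fejer_smoothing_bound:
  fixes \<Delta> r :: "real \<Rightarrow> real"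
  assumes D: "integrable lborel \<Delta>" and T: "T > 0" and r: "integrable lborel r" "\<And>t. r t \<ge> 0"
    and bound: "\<And>t. t \<noteq> 0 \<Longrightarrow> \<bar>t\<bar> \<le> T \<Longrightarrow> norm (\<integral>y. \<Delta> y *\<^sub>R iexp (t * y) \<partial>lborel) \<le> r t"
  shows "\<bar>\<integral>u. \<Delta> (x - u / T) * fejer u \<partial>lborel\<bar> \<le> (\<integral>t. r t \<partial>lborel) / 2"
proof -
  note [measurable] = borel_measurable_integrable[OF D] borel_measurable_integrable[OF r(1)]
  define w :: "real \<Rightarrow> real" where "w s = indicator {-1..1} s * ((1 - \<bar>s\<bar>) / 2)" for s
  have w_meas [measurable]: "w \<in> borel_measurable borel" unfolding w_def by measurable
  have w: "0 \<le> w s" "w s \<le> 1/2" for s by (auto simp: w_def indicator_def)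
  have w_int: "integrable lborel w"
  proof (rule Bochner_Integration.integrable_bound)
    show "integrable lborel (indicator {-1..1} :: real \<Rightarrow> real)" by simp
  qed (auto simp: w_def indicator_def)
  define g where "g y s = (\<Delta> y * w s) *\<^sub>R iexp (s * (T * (x - y)))" for y s
  have g_meas: "(\<lambda>p. g (fst p) (snd p)) \<in> borel_measurable (lborel \<Otimes>\<^sub>M lborel)"
    unfolding g_def by measurable
  have g_int: "integrable (lborel \<Otimes>\<^sub>M lborel) (\<lambda>p. g (fst p) (snd p))"
  proof (rule lborel_pair.Fubini_integrable[OF g_meas])
    have "(\<integral>s. norm (g (fst (y, s)) (snd (y, s))) \<partial>lborel) = \<bar>\<Delta> y\<bar> * (\<integral>s. w s \<partial>lborel)" for y
      by (simp add: g_def abs_mult w(1))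
    then show "integrable lborel (\<lambda>y. \<integral>s. norm (g (fst (y, s)) (snd (y, s))) \<partial>lborel)"
      using D by simp
    show "AE y in lborel. integrable lborel (\<lambda>s. g (fst (y, s)) (snd (y, s)))"
    proof (rule AE_I2)
      fix y
      show "integrable lborel (\<lambda>s. g (fst (y, s)) (snd (y, s)))"
        by (rule Bochner_Integration.integrable_bound[where f = "\<lambda>s. \<Delta> y * w s"])
           (auto simp: g_def w_int abs_mult)
    qed
  qed
  have "(\<integral>u. \<Delta> (x - u / T) * fejer u \<partial>lborel) = T * (\<integral>y. \<Delta> y * fejer (T * (x - y)) \<partial>lborel)"
    using T by (subst lborel_integral_real_affine[where c = "- T" and t = "T * x"])
      (auto simp: field_simps)
  also have "of_real \<dots> = of_real T * (\<integral>y. (\<integral>s. g y s \<partial>lborel) \<partial>lborel)"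
  proof -
    have "complex_of_real (\<integral>y. \<Delta> y * fejer (T * (x - y)) \<partial>lborel) = (\<integral>y. of_real (\<Delta> y * fejer (T * (x - y))) \<partial>lborel)"
      by (rule integral_complex_of_real[symmetric])
    also have "\<dots> = (\<integral>y. (\<integral>s. g y s \<partial>lborel) \<partial>lborel)"
    proof (rule integral_cong_AE)
      show "AE y in lborel. complex_of_real (\<Delta> y * fejer (T * (x - y))) = (\<integral>s. g y s \<partial>lborel)"
        using AE_lborel_singleton[of x]
      proof eventually_elim
        case (elim y)
        then have "T * (x - y) \<noteq> 0" using T by simp
        note fejer_fourier[OF this]
        then have "(\<integral>s. w s *\<^sub>R iexp (s * (T * (x - y))) \<partial>lborel) = of_real (fejer (T * (x - y)))"
          unfolding w_def by (simp add: has_bochner_integral_iff)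
        moreover have "(\<integral>s. g y s \<partial>lborel) = \<Delta> y *\<^sub>R (\<integral>s. w s *\<^sub>R iexp (s * (T * (x - y))) \<partial>lborel)"
          unfolding g_def scaleR_scaleR[symmetric] by (rule integral_scaleR_right)
        ultimately show ?case by (simp add: scaleR_conv_of_real)
      qed
    next
      show "(\<lambda>y. \<integral>s. g y s \<partial>lborel) \<in> borel_measurable lborel"
        using g_meas by (intro lborel.borel_measurable_lebesgue_integral) (simp add: case_prod_beta')
    qed measurable
    finally show ?thesis by simp
  qed
  also have "(\<integral>y. (\<integral>s. g y s \<partial>lborel) \<partial>lborel) = (\<integral>s. (\<integral>y. g y s \<partial>lborel) \<partial>lborel)"
    using lborel_pair.Fubini_integral[of g] g_int by (simp add: case_prod_beta')
  finally have eq: "complex_of_real (\<integral>u. \<Delta> (x - u / T) * fejer u \<partial>lborel)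
      = of_real T * (\<integral>s. (\<integral>y. g y s \<partial>lborel) \<partial>lborel)" .
  have "norm (\<integral>s. (\<integral>y. g y s \<partial>lborel) \<partial>lborel) \<le> (\<integral>s. norm (\<integral>y. g y s \<partial>lborel) \<partial>lborel)"
    by (rule integral_norm_bound)
  also have "\<dots> \<le> (\<integral>s. 1/2 * r (- T * s) \<partial>lborel)"
  proof (rule integral_mono_AE)
    show "integrable lborel (\<lambda>s. norm (\<integral>y. g y s \<partial>lborel))"
      using lborel_pair.integrable_snd[of g] g_int by (simp add: case_prod_beta')
    show "integrable lborel (\<lambda>s. 1/2 * r (- T * s))"
      using lborel_integrable_real_affine[OF r(1), of "- T" 0] T by simp
    show "AE s in lborel. norm (\<integral>y. g y s \<partial>lborel) \<le> 1/2 * r (- T * s)"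
      using AE_lborel_singleton[of 0]
    proof eventually_elim
      case (elim s)
      have "g y s = (w s *\<^sub>R iexp (s * T * x)) * (\<Delta> y *\<^sub>R iexp ((- T * s) * y))" for y
        by (simp add: g_def scaleR_conv_of_real algebra_simps exp_diff exp_minus divide_inverse)
      then have "(\<integral>y. g y s \<partial>lborel) = (w s *\<^sub>R iexp (s * T * x)) * (\<integral>y. \<Delta> y *\<^sub>R iexp ((- T * s) * y) \<partial>lborel)"
        by (simp only: integral_mult_right_zero)
      then have n: "norm (\<integral>y. g y s \<partial>lborel) = w s * norm (\<integral>y. \<Delta> y *\<^sub>R iexp ((- T * s) * y) \<partial>lborel)"
        using w(1)[of s] by (simp add: norm_mult)
      show ?case
      proof (cases "\<bar>s\<bar> \<le> 1")
        case True
        have "norm (\<integral>y. \<Delta> y *\<^sub>R iexp ((- T * s) * y) \<partial>lborel) \<le> r (- T * s)"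
          using True T elim mult_left_mono[OF True, of T] by (intro bound) (auto simp: abs_mult)
        then show ?thesis unfolding n using w[of s] r(2) by (intro mult_mono) auto
      next
        case False
        then have "w s = 0" by (auto simp: w_def indicator_def)
        then show ?thesis unfolding n using r(2) by simp
      qed
    qed
  qed
  also have "\<dots> = (\<integral>t. r t \<partial>lborel) / (2 * T)"
    using lborel_integral_real_affine[of "- T" r 0] T by simp
  finally have "T * norm (\<integral>s. (\<integral>y. g y s \<partial>lborel) \<partial>lborel) \<le> (\<integral>t. r t \<partial>lborel) / 2"
    using T by (simp add: field_simps)
  moreover have "\<bar>\<integral>u. \<Delta> (x - u / T) * fejer u \<partial>lborel\<bar> = T * norm (\<integral>s. (\<integral>y. g y s \<partial>lborel) \<partial>lborel)"
    using arg_cong[OF eq, of norm] T by (simp add: norm_mult)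
  ultimately show ?thesis by simp
qed

section \<open>The normal law and its Edgeworth correction\<close>

lemma Phi_eq_cdf: "Phi x = cdf std_normal_distribution x"
proof -
  have eq: "exp (- t\<^sup>2 / 2) / sqrt (2 * pi) = std_normal_density t" for t
    by (simp add: std_normal_density_def)
  have int: "set_integrable lborel {..x} std_normal_density"
    unfolding set_integrable_def
    by (rule integrable_mult_indicator) auto
  interpret real_distribution std_normal_distribution by (rule real_dist_normal_dist)
  have "cdf std_normal_distribution x = (\<integral>t. indicator {..x} t \<partial>std_normal_distribution)"
    by (simp add: cdf_def)
  also have "\<dots> = (LINT t:{..x}|lborel. std_normal_density t)"
    by (subst integral_density) (auto simp: set_lebesgue_integral_def mult.commute)
  also have "\<dots> = integral {..x} std_normal_density"
    by (rule set_borel_integral_eq_integral(2)[OF int])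
  finally show ?thesis unfolding Phi_def eq by simp
qed

text \<open>Minus the third derivative of \<open>Phi\<close>, the form in which a third cumulant
  enters an Edgeworth expansion.\<close>

definition edgeworth_term :: "real \<Rightarrow> real" where
  "edgeworth_term y = (1 - y\<^sup>2) * std_normal_density y"

lemma edgeworth_term_eq: "edgeworth_term y = (1 - y\<^sup>2) * exp (- y\<^sup>2 / 2) / sqrt (2 * pi)"
  by (simp add: edgeworth_term_def std_normal_density_def)

lemma integrable_edgeworth_term: "integrable lborel edgeworth_term"
proof -
  have "integrable lborel (\<lambda>y. std_normal_density y - std_normal_density y * y ^ 2)"
    using integrable_std_normal_moment[of 0] integrable_std_normal_moment[of 2] by (intro Bochner_Integration.integrable_diff) simp_all
  then show ?thesis by (simp add: edgeworth_term_def[abs_def] algebra_simps)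
qed

text \<open>Instead of locating maxima, compare with the Taylor bound for
  \<open>exp (y^2 / 2)\<close>; the squares \<open>(z - 1)^2\<close> and
  \<open>z^2 (z - 1)^2\<close> trade odd powers of \<open>z\<close> for even ones.\<close>

lemma exp_poly_bound:
  fixes y :: real
  shows "(\<bar>y\<bar> ^ 3 + 3 * \<bar>y\<bar>) * exp (- y\<^sup>2 / 2) \<le> 6" and "(1 + y\<^sup>2) * exp (- y\<^sup>2 / 2) \<le> 2"
proof -
  define z where "z = \<bar>y\<bar>"
  have z: "z \<ge> 0" "y\<^sup>2 = z\<^sup>2" by (auto simp: z_def)
  have e: "exp (z\<^sup>2 / 2) \<ge> 1 + z\<^sup>2 / 2 + (z\<^sup>2 / 2)\<^sup>2 / 2"
    by (rule exp_lower_Taylor_quadratic) auto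
  have "0 \<le> z\<^sup>2 * (z - 1)\<^sup>2" "0 \<le> (z - 1)\<^sup>2" "0 \<le> z\<^sup>2" "0 \<le> z\<^sup>2 * z\<^sup>2" by auto
  then have "2 * z ^ 3 \<le> z\<^sup>2 + z ^ 4" "2 * z \<le> 1 + z\<^sup>2" "0 \<le> z\<^sup>2" "0 \<le> z ^ 4"
    by (simp_all add: algebra_simps power2_eq_square eval_nat_numeral)
  moreover have "b + 3 * z \<le> 6 * (1 + a / 2 + q / 8)" if "2 * b \<le> a + q" "2 * z \<le> 1 + a" "0 \<le> a" "0 \<le> q"
    for a b q :: real
    using that by simp
  ultimately have "z ^ 3 + 3 * z \<le> 6 * (1 + z\<^sup>2 / 2 + z ^ 4 / 8)" by blast
  also have "z ^ 4 / 8 = (z\<^sup>2 / 2)\<^sup>2 / 2" by (simp add: power_divide flip: power_mult)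
  also have "6 * (1 + z\<^sup>2 / 2 + (z\<^sup>2 / 2)\<^sup>2 / 2) \<le> 6 * exp (z\<^sup>2 / 2)" by (rule mult_left_mono[OF e]) simp
  finally show "(\<bar>y\<bar> ^ 3 + 3 * \<bar>y\<bar>) * exp (- y\<^sup>2 / 2) \<le> 6"
    unfolding z(2) z_def[symmetric] by (simp add: exp_minus field_simps)
  have "1 + z\<^sup>2 \<le> 2 * (1 + z\<^sup>2 / 2 + (z\<^sup>2 / 2)\<^sup>2 / 2)" by simp
  also have "\<dots> \<le> 2 * exp (z\<^sup>2 / 2)" by (rule mult_left_mono[OF e]) simp
  finally show "(1 + y\<^sup>2) * exp (- y\<^sup>2 / 2) \<le> 2"
    unfolding z(2) by (simp add: exp_minus field_simps)
qed

lemma sqrt_2pi_ge_1: "1 \<le> sqrt (2 * pi)"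
  using pi_gt3 by (simp add: real_le_rsqrt)

lemma abs_edgeworth_term_le: "\<bar>edgeworth_term y\<bar> \<le> 2"
proof -
  have "\<bar>edgeworth_term y\<bar> = \<bar>1 - y\<^sup>2\<bar> * exp (- y\<^sup>2 / 2) / sqrt (2 * pi)"
    by (simp add: edgeworth_term_eq abs_mult)
  also have "\<dots> \<le> \<bar>1 - y\<^sup>2\<bar> * exp (- y\<^sup>2 / 2) / 1"
    using sqrt_2pi_ge_1 by (intro divide_left_mono) auto
  also have "\<dots> \<le> (1 + y\<^sup>2) * exp (- y\<^sup>2 / 2)"
    by (simp add: mult_right_mono abs_le_iff)
  finally show ?thesis using exp_poly_bound(2)[of y] by linarith
qed

lemma edgeworth_term_lipschitz: "\<bar>edgeworth_term x - edgeworth_term y\<bar> \<le> 6 * \<bar>x - y\<bar>"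
proof -
  have d: "(edgeworth_term has_real_derivative (u ^ 3 - 3 * u) * exp (- u\<^sup>2 / 2) / sqrt (2 * pi)) (at u)" for u
  proof -
    have "((\<lambda>u. (1 - u\<^sup>2) * exp (- u\<^sup>2 / 2)) has_real_derivative (u ^ 3 - 3 * u) * exp (- u\<^sup>2 / 2)) (at u)"
      by (auto intro!: derivative_eq_intros simp: field_simps power2_eq_square power3_eq_cube)
    from DERIV_cdivide[OF this, of "sqrt (2 * pi)"] show ?thesis unfolding edgeworth_term_eq[abs_def] .
  qed
  have b: "\<bar>(u ^ 3 - 3 * u) * exp (- u\<^sup>2 / 2) / sqrt (2 * pi)\<bar> \<le> 6" for u :: real
  proof -
    have "\<bar>(u ^ 3 - 3 * u) * exp (- u\<^sup>2 / 2) / sqrt (2 * pi)\<bar> = \<bar>u ^ 3 - 3 * u\<bar> * exp (- u\<^sup>2 / 2) / sqrt (2 * pi)"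
      by (simp add: abs_mult)
    also have "\<dots> \<le> \<bar>u ^ 3 - 3 * u\<bar> * exp (- u\<^sup>2 / 2) / 1"
      using sqrt_2pi_ge_1 by (intro divide_left_mono) auto
    also have "\<dots> \<le> (\<bar>u\<bar> ^ 3 + 3 * \<bar>u\<bar>) * exp (- u\<^sup>2 / 2)"
      using abs_triangle_ineq4[of "u ^ 3" "3 * u"] by (simp add: mult_right_mono abs_mult power_abs)
    finally show ?thesis using exp_poly_bound(1)[of u] by linarith
  qed
  have "norm (edgeworth_term x - edgeworth_term y) \<le> 6 * norm (x - y)"
  proof (rule field_differentiable_bound[of UNIV edgeworth_term "\<lambda>u. (u ^ 3 - 3 * u) * exp (- u\<^sup>2 / 2) / sqrt (2 * pi)"])
    show "(edgeworth_term has_field_derivative (u ^ 3 - 3 * u) * exp (- u\<^sup>2 / 2) / sqrt (2 * pi)) (at u within UNIV)" for u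
      using d by simp
    show "norm ((u ^ 3 - 3 * u) * exp (- u\<^sup>2 / 2) / sqrt (2 * pi)) \<le> 6" for u :: real
      using b[of u] unfolding real_norm_def .
  qed auto
  then show ?thesis by simp
qed

lemma std_normal_density_le_1: "std_normal_density y \<le> 1"
proof -
  have "std_normal_density y = exp (- y\<^sup>2 / 2) / sqrt (2 * pi)" by (simp add: std_normal_density_def)
  also have "\<dots> \<le> 1 / 1" using sqrt_2pi_ge_1 by (intro frac_le) auto
  finally show ?thesis by simp
qed

lemma Phi_lipschitz: "s \<ge> 0 \<Longrightarrow> Phi (x + s) \<le> Phi x + s"
proof -
  assume s: "s \<ge> 0"
  interpret real_distribution std_normal_distribution by (rule real_dist_normal_dist)
  show ?thesis
  proof (cases "s = 0")
    case False
    have "Phi (x + s) - Phi x = measure std_normal_distribution {x<..x + s}"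
      unfolding Phi_eq_cdf using s False by (intro cdf_diff_eq) auto
    also have "\<dots> = (\<integral>t. indicator {x<..x + s} t \<partial>std_normal_distribution)" by simp
    also have "\<dots> = (\<integral>t. std_normal_density t * indicator {x<..x + s} t \<partial>lborel)"
      by (subst integral_density) auto
    also have "\<dots> \<le> (\<integral>t. indicator {x<..x + s} t \<partial>lborel)"
    proof (rule integral_mono)
      show "integrable lborel (\<lambda>t. std_normal_density t * indicator {x<..x + s} t)"
        by (intro integrable_real_mult_indicator) auto
      show "integrable lborel (\<lambda>t. indicator {x<..x + s} t :: real)"
        using s by (intro integrable_real_indicator) auto
    qed (auto simp: indicator_def std_normal_density_le_1)
    also have "\<dots> = s" using s by simp
    finally show ?thesis by simp
  qed simp
qed

text \<open>The integrand minus \<open>t^2\<close> times the Gaussian one is the derivative of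
  \<open>(y + i t) \<phi>(y) exp (i t y)\<close>, with \<phi> the normal density. That function
  vanishes at both ends, and the Gaussian transform is known.\<close>

lemma edgeworth_term_fourier: "(\<integral>y. edgeworth_term y *\<^sub>R iexp (t * y) \<partial>lborel) = t\<^sup>2 * exp (- t\<^sup>2 / 2)"
proof -
  let ?\<phi> = std_normal_density
  have phi_complex: "complex_of_real (?\<phi> y) = exp (- (of_real y)\<^sup>2 / 2) / of_real (sqrt (2 * pi))" for y
    by (simp add: std_normal_density_def exp_of_real[symmetric])
  define F where "F y = (of_real y + \<i> * t) * (of_real (?\<phi> y) * iexp (t * y))" for y :: real
  define f where "f y = (1 - y\<^sup>2 - t\<^sup>2) *\<^sub>R (of_real (?\<phi> y) * iexp (t * y))" for y :: real
  have char: "(\<integral>y. ?\<phi> y *\<^sub>R iexp (t * y) \<partial>lborel) = exp (- t\<^sup>2 / 2)"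
    using char_std_normal_distribution by (simp add: char_def fun_eq_iff integral_density)
  have int_phi: "integrable lborel (\<lambda>y. ?\<phi> y *\<^sub>R iexp (t * y))"
    by (rule Bochner_Integration.integrable_bound[of lborel ?\<phi>]) auto
  have int_edgeworth_term: "integrable lborel (\<lambda>y. edgeworth_term y *\<^sub>R iexp (t * y))"
    by (rule Bochner_Integration.integrable_bound[OF integrable_edgeworth_term]) (auto simp: edgeworth_term_def)
  have f_eq: "f y = edgeworth_term y *\<^sub>R iexp (t * y) - t\<^sup>2 *\<^sub>R (?\<phi> y *\<^sub>R iexp (t * y))" for y
    by (simp add: f_def edgeworth_term_def scaleR_conv_of_real algebra_simps)
  have int_f: "integrable lborel f"
    unfolding f_eq[abs_def]
    by (intro Bochner_Integration.integrable_diff integrable_scaleR_right int_phi int_edgeworth_term)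
  have nF: "norm (F y) \<le> (\<bar>y\<bar> + \<bar>t\<bar>) * ?\<phi> y" for y
  proof -
    have "norm (F y) = norm (of_real y + \<i> * t) * ?\<phi> y" by (simp add: F_def norm_mult)
    also have "norm (of_real y + \<i> * t) \<le> \<bar>y\<bar> + \<bar>t\<bar>"
      by (rule order_trans[OF norm_triangle_ineq]) (simp add: norm_mult)
    finally show ?thesis by (simp add: mult_right_mono)
  qed
  have "(LBINT y=-\<infinity>..\<infinity>. f y) = 0 - 0"
  proof (rule interval_integral_FTC_integrable[where F = F])
    fix y :: real
    have "((\<lambda>z. (z + \<i> * t) * exp (- z\<^sup>2 / 2) * exp (\<i> * (t * z))) has_field_derivative
      (1 - (complex_of_real y)\<^sup>2 - t\<^sup>2) * exp (- (complex_of_real y)\<^sup>2 / 2) * exp (\<i> * (t * complex_of_real y))) (at (of_real y))"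
      by (auto intro!: derivative_eq_intros simp: field_simps power2_eq_square)
    from has_vector_derivative_real_field[OF DERIV_cdivide[OF this, of "of_real (sqrt (2 * pi))"]]
    show "(F has_vector_derivative f y) (at y)"
      by (simp add: F_def[abs_def] f_def phi_complex scaleR_conv_of_real mult_ac)
    show "isCont f y"
      unfolding f_def std_normal_density_def by (intro continuous_intros) auto
  next
    show "((F \<circ> real_of_ereal) \<longlongrightarrow> 0) (at_right (-\<infinity>))"
      unfolding ereal_tendsto_simps
    proof (rule Lim_null_comparison[OF always_eventually])
      show "\<forall>y. norm (F y) \<le> (\<bar>y\<bar> + \<bar>t\<bar>) * ?\<phi> y" using nF by simp
      show "((\<lambda>y. (\<bar>y\<bar> + \<bar>t\<bar>) * ?\<phi> y) \<longlongrightarrow> 0) at_bot"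
        unfolding std_normal_density_def by real_asymp
    qed
    show "((F \<circ> real_of_ereal) \<longlongrightarrow> 0) (at_left \<infinity>)"
      unfolding ereal_tendsto_simps
    proof (rule Lim_null_comparison[OF always_eventually])
      show "\<forall>y. norm (F y) \<le> (\<bar>y\<bar> + \<bar>t\<bar>) * ?\<phi> y" using nF by simp
      show "((\<lambda>y. (\<bar>y\<bar> + \<bar>t\<bar>) * ?\<phi> y) \<longlongrightarrow> 0) at_top"
        unfolding std_normal_density_def by real_asymp
    qed
  qed (use int_f in \<open>auto simp: set_integrable_def einterval_def\<close>)
  then have "(\<integral>y. f y \<partial>lborel) = 0"
    by (simp add: interval_lebesgue_integral_def set_lebesgue_integral_def einterval_def)
  also have "(\<integral>y. f y \<partial>lborel) = (\<integral>y. edgeworth_term y *\<^sub>R iexp (t * y) \<partial>lborel) - t\<^sup>2 *\<^sub>R complex_of_real (exp (- t\<^sup>2 / 2))"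
    unfolding f_eq
    by (simp only: Bochner_Integration.integral_diff[OF int_edgeworth_term integrable_scaleR_right[OF int_phi]]
          integral_scaleR_right char)
  finally show ?thesis by (simp add: scaleR_conv_of_real)
qed

text \<open>The transform of a distribution function involves division by \<open>t\<close>, so the
  discrepancy of the characteristic functions has to be \<open>\<bar>t\<bar> * r t\<close> with
  \<open>r\<close> integrable across 0.\<close>

lemma edgeworth_smoothing:
  obtains C where "C > 0"
    "\<And>(M::real measure) a T r x. real_distribution M \<Longrightarrow> integrable M (\<lambda>x. x) \<Longrightarrow> \<bar>a\<bar> \<le> 1 \<Longrightarrow> T > 0 \<Longrightarrow>
       integrable lborel r \<Longrightarrow> (\<And>t. r t \<ge> 0) \<Longrightarrow>
       (\<And>t. t \<noteq> 0 \<Longrightarrow> \<bar>t\<bar> \<le> T \<Longrightarrow>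
          norm (char M t - complex_of_real (exp (- t\<^sup>2 / 2)) * (1 - \<i> * a * t ^ 3)) \<le> \<bar>t\<bar> * r t) \<Longrightarrow>
       \<bar>cdf M x - Phi x - a * edgeworth_term x\<bar> \<le> C * ((\<integral>t. r t \<partial>lborel) + 1 / T)"
proof -
  obtain C where C: "C > 0" "\<And>\<Delta> B m T \<epsilon> x. \<Delta> \<in> borel_measurable borel \<Longrightarrow> (\<And>x. \<bar>\<Delta> x\<bar> \<le> B) \<Longrightarrow> m \<ge> 0 \<Longrightarrow>
     (\<And>x s. s \<ge> 0 \<Longrightarrow> \<Delta> (x + s) \<ge> \<Delta> x - m * s) \<Longrightarrow> T > 0 \<Longrightarrow>
     (\<And>x. \<bar>\<integral>u. \<Delta> (x - u / T) * fejer u \<partial>lborel\<bar> \<le> \<epsilon>) \<Longrightarrow> \<bar>\<Delta> x\<bar> \<le> C * (\<epsilon> + m / T)"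
    using desmoothing by blast
  have main: "\<bar>cdf M x - Phi x - a * edgeworth_term x\<bar> \<le> 7 * C * ((\<integral>t. r t \<partial>lborel) + 1 / T)"
    if M: "real_distribution M" "integrable M (\<lambda>x. x)" and a: "\<bar>a\<bar> \<le> 1" and T: "T > 0"
      and r: "integrable lborel r" "\<And>t. r t \<ge> 0"
      and bound: "\<And>t. t \<noteq> 0 \<Longrightarrow> \<bar>t\<bar> \<le> T \<Longrightarrow>
        norm (char M t - complex_of_real (exp (- t\<^sup>2 / 2)) * (1 - \<i> * a * t ^ 3)) \<le> \<bar>t\<bar> * r t"
    for M :: "real measure" and a T r x
  proof -
    interpret M: real_distribution M by (rule M)
    interpret N: real_distribution std_normal_distribution by (rule real_dist_normal_dist)
    define H where "H y = (indicator {0..} y :: real)" for y :: real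
    define K where "K y = cdf M y - H y" for y
    define L where "L y = Phi y - H y" for y
    define \<Delta> where "\<Delta> y = K y - L y - a * edgeworth_term y" for y
    have \<Delta>_eq: "\<Delta> y = cdf M y - Phi y - a * edgeworth_term y" for y
      by (simp add: \<Delta>_def K_def L_def)
    have N1: "integrable std_normal_distribution (\<lambda>x. x)"
      using integrable_std_normal_distribution_moment[of 1] by simp
    have iM: "integrable lborel K"
      unfolding H_def K_def[abs_def] by (rule M.fourier_cdf(1)[OF M(2)])
    have iN: "integrable lborel L"
      unfolding L_def[abs_def] H_def Phi_eq_cdf by (rule N.fourier_cdf(1)[OF N1])
    have iD: "integrable lborel \<Delta>"
      unfolding \<Delta>_def[abs_def]
    by (intro Bochner_Integration.integrable_diff integrable_mult_right iM iN integrable_edgeworth_term)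
    have scaled: "integrable lborel (\<lambda>y. h y *\<^sub>R iexp (t * y))" if "integrable lborel h" for h :: "real \<Rightarrow> real" and t
      using that by (rule Bochner_Integration.integrable_bound) (use that in auto)
    have FT: "norm (\<integral>y. \<Delta> y *\<^sub>R iexp (t * y) \<partial>lborel) \<le> r t" if t: "t \<noteq> 0" "\<bar>t\<bar> \<le> T" for t
    proof -
      have "(\<integral>y. \<Delta> y *\<^sub>R iexp (t * y) \<partial>lborel) = (\<integral>y. K y *\<^sub>R iexp (t * y) \<partial>lborel)
         - (\<integral>y. L y *\<^sub>R iexp (t * y) \<partial>lborel) - a *\<^sub>R (\<integral>y. edgeworth_term y *\<^sub>R iexp (t * y) \<partial>lborel)"
        unfolding \<Delta>_def scaleR_diff_left scaleR_scaleR[symmetric]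
        by (simp only: Bochner_Integration.integral_diff[OF Bochner_Integration.integrable_diff[OF
              scaled[OF iM] scaled[OF iN]] integrable_scaleR_right[OF scaled[OF integrable_edgeworth_term]]]
            Bochner_Integration.integral_diff[OF scaled[OF iM] scaled[OF iN]] integral_scaleR_right)
      also have "\<dots> = - (char M t - 1) / (\<i> * t) + (exp (- t\<^sup>2 / 2) - 1) / (\<i> * t) - a * (t\<^sup>2 * exp (- t\<^sup>2 / 2))"
        unfolding K_def L_def H_def Phi_eq_cdf M.fourier_cdf(2)[OF M(2) t(1)] N.fourier_cdf(2)[OF N1 t(1)]
          edgeworth_term_fourier char_std_normal_distribution
        by (simp add: scaleR_conv_of_real diff_divide_distrib)
      also have "\<dots> = - (char M t - complex_of_real (exp (- t\<^sup>2 / 2)) * (1 - \<i> * a * t ^ 3)) / (\<i> * t)"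
        using t by (simp add: field_simps power2_eq_square power3_eq_cube)
      also have "norm \<dots> \<le> (\<bar>t\<bar> * r t) / \<bar>t\<bar>"
        using divide_right_mono[OF bound[OF t], of "\<bar>t\<bar>"]
        by (simp add: norm_divide norm_mult del: minus_diff_eq)
      finally show ?thesis using t by simp
    qed
    \<comment> \<open>Slope 7: \<open>cdf M\<close> is nondecreasing, \<open>Phi\<close> grows at
      rate at most 1, and the correction has Lipschitz constant 6 because
      \<open>\<bar>a\<bar> \<le> 1\<close>.\<close>
    have "\<bar>\<Delta> x\<bar> \<le> C * ((\<integral>t. r t \<partial>lborel) / 2 + 7 / T)"
    proof (rule C(2)[where \<Delta> = \<Delta> and x = x and B = 4 and m = 7 and T = T and \<epsilon> = "(\<integral>t. r t \<partial>lborel) / 2"])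
      show "\<Delta> \<in> borel_measurable borel" using iD by (simp add: borel_measurable_integrable)
      show "\<bar>\<Delta> x\<bar> \<le> 4" for x
      proof -
        have "\<bar>a * edgeworth_term x\<bar> \<le> 1 * 2"
          unfolding abs_mult using a abs_edgeworth_term_le[of x] by (intro mult_mono) auto
        moreover have "0 \<le> cdf M x" "cdf M x \<le> 1" by (auto simp: M.cdf_nonneg M.cdf_bounded_prob)
        moreover have "0 \<le> Phi x" "Phi x \<le> 1" by (auto simp: Phi_eq_cdf N.cdf_nonneg N.cdf_bounded_prob)
        ultimately show ?thesis by (simp add: \<Delta>_eq)
      qed
      show "\<Delta> x - 7 * s \<le> \<Delta> (x + s)" if s: "0 \<le> s" for x s
      proof -
        have "cdf M x \<le> cdf M (x + s)" using s by (intro M.cdf_nondecreasing) simp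
        moreover have "Phi (x + s) \<le> Phi x + s" by (rule Phi_lipschitz[OF s])
        moreover have "\<bar>a * (edgeworth_term (x + s) - edgeworth_term x)\<bar> \<le> 1 * (6 * s)"
          unfolding abs_mult using a edgeworth_term_lipschitz[of "x + s" x] s by (intro mult_mono) auto
        ultimately show ?thesis by (simp add: \<Delta>_eq algebra_simps)
      qed
      show "\<bar>\<integral>u. \<Delta> (y - u / T) * fejer u \<partial>lborel\<bar> \<le> (\<integral>t. r t \<partial>lborel) / 2" for y
        by (rule fejer_smoothing_bound[OF iD T r FT])
    qed (use T in auto)
    also have "\<dots> \<le> C * (7 * (\<integral>t. r t \<partial>lborel) + 7 / T)"
    proof -
      have "0 \<le> (\<integral>t. r t \<partial>lborel)" by (rule Bochner_Integration.integral_nonneg) (rule r(2))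
      then show ?thesis using C(1) by (intro mult_left_mono add_right_mono) auto
    qed
    finally show ?thesis by (simp add: \<Delta>_eq algebra_simps)
  qed
  show thesis
  proof (rule that)
    show "7 * C > 0" using C(1) by simp
  qed (rule main)
qed

section \<open>Bounds on the characteristic function\<close>

text \<open>\<open>x \<le> exp x\<close> at \<open>c t^2 / k\<close>, raised to the power
  \<open>k\<close>, controls \<open>t^(2 k)\<close>; then \<open>p \<le> 1 + p^2\<close> returns to
  the power \<open>k\<close>.\<close>

lemma power_exp_bounded:
  fixes c :: real assumes c: "c > 0"
  shows "\<exists>K\<ge>0. \<forall>t::real. \<bar>t\<bar> ^ k * exp (- (c * t\<^sup>2)) \<le> K"
proof (cases "k = 0")
  case True
  then show ?thesis using c by (intro exI[of _ 1]) auto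
next
  case False
  have "\<bar>t\<bar> ^ k * exp (- (c * t\<^sup>2)) \<le> 1 + (real k / c) ^ k" for t
  proof -
    have "(c * t\<^sup>2 / real k) ^ k \<le> exp (c * t\<^sup>2 / real k) ^ k"
    proof (rule power_mono)
      show "c * t\<^sup>2 / real k \<le> exp (c * t\<^sup>2 / real k)"
        using exp_ge_add_one_self[of "c * t\<^sup>2 / real k"] by linarith
    qed (use c in auto)
    also have "\<dots> = exp (c * t\<^sup>2)" using False by (simp add: exp_of_nat_mult[symmetric])
    finally have "(t\<^sup>2) ^ k * (c / real k) ^ k \<le> exp (c * t\<^sup>2)"
      by (simp add: power_mult_distrib[symmetric] mult_ac)
    then have 1: "(t\<^sup>2) ^ k * exp (- (c * t\<^sup>2)) \<le> (real k / c) ^ k"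
      using c False by (simp add: exp_minus power_divide field_simps)
    have "p \<le> 1 + p\<^sup>2" if "p \<ge> 0" for p :: real
      using zero_le_power2[of "p - 1"] that by (simp add: power2_diff)
    then have "\<bar>t\<bar> ^ k \<le> 1 + (\<bar>t\<bar> ^ k)\<^sup>2" by simp
    also have "(\<bar>t\<bar> ^ k)\<^sup>2 = (t\<^sup>2) ^ k" by (simp add: power_mult[symmetric] mult.commute[of k] power_even_abs)
    finally have "\<bar>t\<bar> ^ k * exp (- (c * t\<^sup>2)) \<le> (1 + (t\<^sup>2) ^ k) * exp (- (c * t\<^sup>2))"
      by (intro mult_right_mono) auto
    also have "\<dots> = exp (- (c * t\<^sup>2)) + (t\<^sup>2) ^ k * exp (- (c * t\<^sup>2))" by (simp add: algebra_simps)
    also have "\<dots> \<le> 1 + (real k / c) ^ k" using 1 c by (intro add_mono) auto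
    finally show ?thesis .
  qed
  moreover have "1 + (real k / c) ^ k \<ge> 0" using c by simp
  ultimately show ?thesis by blast
qed

text \<open>\<open>n\<close> is admissible when the threshold \<open>b\<close>, of size about \<open>n / (ln n)^4\<close>, separates the
  essentially independent short cycles from the few long ones.\<close>

definition admissible :: "nat \<Rightarrow> nat \<Rightarrow> bool" where
  "admissible n b \<longleftrightarrow> 2 \<le> b \<and> 2 * b < n \<and> ln (real n) \<ge> 3 \<and> ln (real n) / 2 \<le> ln (real b)
    \<and> real b / real n \<le> 1 / ln (real n) ^ 4 \<and> ln (real n) - ln (real b) \<le> 5 * ln (ln (real n))"

text \<open>Rounding \<open>n / L^4\<close> down costs at most a factor 2, and
  \<open>4 ln L + ln 2\<close> is eventually at most \<open>5 ln L\<close>, which explains the 5 in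
  the definition.\<close>

lemma eventually_admissible: "eventually (\<lambda>n. \<exists>b. admissible n b) sequentially"
proof -
  have "eventually (\<lambda>n. real n / ln (real n) ^ 4 \<ge> 3) sequentially"
    by real_asymp
  moreover have "eventually (\<lambda>n. 2 * (real n / ln (real n) ^ 4) < real n) sequentially"
    by real_asymp
  moreover have "eventually (\<lambda>n. ln (real n) \<ge> 3) sequentially" by real_asymp
  moreover have "eventually (\<lambda>n. ln (real n) / 2 \<le> ln (real n / ln (real n) ^ 4 / 2)) sequentially" by real_asymp
  moreover have "eventually (\<lambda>n. ln (real n) - 5 * ln (ln (real n)) \<le> ln (real n / ln (real n) ^ 4 / 2)) sequentially" by real_asymp
  moreover have "eventually (\<lambda>n. n > 0) sequentially" by (rule eventually_gt_at_top)
  ultimately show ?thesis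
  proof eventually_elim
    case (elim n)
    define y where "y = real n / ln (real n) ^ 4"
    define b where "b = nat \<lfloor>y\<rfloor>"
    have y: "y \<ge> 3" using elim by (simp add: y_def)
    have b: "real b \<le> y" "y - 1 \<le> real b" using y unfolding b_def by linarith+
    have b2: "2 \<le> b" using b y by linarith
    have "y / 2 \<le> real b" using b y by linarith
    then have "ln (y / 2) \<le> ln (real b)" using y by (subst ln_le_cancel_iff) auto
    moreover have "2 * b < n" using b elim(2) unfolding y_def[symmetric] by linarith
    moreover have "real b / real n \<le> y / real n" using b by (intro divide_right_mono) auto
    moreover have "y / real n = 1 / ln (real n) ^ 4" using elim by (simp add: y_def)
    ultimately have "admissible n b"
      unfolding admissible_def using b2 elim unfolding y_def[symmetric] by linarith
    then show ?case by blast
  qed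
qed

lemma admissibleD:
  assumes "admissible n b"
  shows "2 \<le> b" "2 * b < n" "ln (real n) \<ge> 3" "ln (real n) / 2 \<le> ln (real b)"
    "real b / real n \<le> 1 / ln (real n) ^ 4" "ln (real n) - ln (real b) \<le> 5 * ln (ln (real n))"
  using assms unfolding admissible_def by auto

lemma norm_cis_Suc_diff_le:
  assumes "1 \<le> k"
  shows "norm (cis (\<theta> * ln (real (Suc k))) - cis (\<theta> * ln (real k))) \<le> \<bar>\<theta>\<bar> / real k"
proof -
  have "norm (cis (\<theta> * ln (real (Suc k))) - cis (\<theta> * ln (real k))) \<le> \<bar>\<theta>\<bar> * (ln (real (Suc k)) - ln (real k))"
    using norm_cis_diff_le[of "\<theta> * ln (real (Suc k))" "\<theta> * ln (real k)"] assms
    by (simp add: right_diff_distrib[symmetric] abs_mult del: of_nat_Suc)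
  also have "\<dots> \<le> \<bar>\<theta>\<bar> * (1 / real k)"
    by (intro mult_left_mono ln_Suc_diff assms abs_ge_zero)
  finally show ?thesis by simp
qed

text \<open>\<open>8 + 4 (1 + L) \<le> 16 L\<close> and \<open>exp 1 \<le> 3\<close> give 48; the
  ratio \<open>b / n \<le> 1 / L^4\<close> turns the factor \<open>L\<close> into
  \<open>1 / L^3\<close>.\<close>

lemma admissible_error_le:
  assumes adm: "admissible n b" and \<theta>: "\<bar>\<theta>\<bar> \<le> 2"
  shows "split_error \<bar>\<theta>\<bar> n b \<le> 48 / ln (real n) ^ 3"
proof -
  define L where "L = ln (real n)"
  note adm = admissibleD[OF adm, folded L_def]
  have "2 * \<bar>\<theta>\<bar> * (1 + L) \<le> 4 * (1 + L)" using \<theta> adm(3) by (intro mult_right_mono) auto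
  then have "8 + 2 * \<bar>\<theta>\<bar> * (1 + L) \<le> 16 * L" using adm(3) by (simp add: algebra_simps)
  then have "exp 1 * (8 + 2 * \<bar>\<theta>\<bar> * (1 + L)) * (real b / real n) \<le> 3 * (16 * L) * (1 / L ^ 4)"
    using adm exp_le by (intro mult_mono) auto
  also have "\<dots> = 48 / L ^ 3" using adm(3) by (simp add: eval_nat_numeral)
  finally show ?thesis by (simp add: L_def)
qed

lemma norm_cyc_cis_le:
  assumes adm: "admissible n b" and \<theta>: "\<bar>\<theta>\<bar> \<le> 2"
  shows "norm (cis_coeff \<theta> n)
    \<le> 3 * exp (cos_sum \<theta> b) + 48 / ln (real n) ^ 3"
proof -
  note adm' = admissibleD[OF adm]
  have "norm (cis_coeff \<theta> n)
    \<le> exp 1 * exp (\<Sum>k=1..b. (Re (cis (\<theta> * ln (real k))) - 1) / real k)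
      + split_error \<bar>\<theta>\<bar> n b"
    using adm' norm_cis_Suc_diff_le by (intro norm_cyc_le_exp) auto
  also have "\<dots> \<le> 3 * exp (cos_sum \<theta> b) + 48 / ln (real n) ^ 3"
    using exp_le admissible_error_le[OF adm \<theta>] by (intro add_mono) auto
  finally show ?thesis .
qed

text \<open>The perturbation parameter is \<open>\<bar>\<theta>\<bar> * L\<close> times the harmonic
  sum over the long cycles, which the choice of \<open>b\<close> keeps below
  \<open>5 ln L\<close>.\<close>

lemma norm_cyc_cis_sub_exp_le:
  assumes adm: "admissible n b" and \<theta>: "\<bar>\<theta>\<bar> \<le> 2"
    and small: "\<bar>\<theta>\<bar> * ln (real n) * (5 * ln (ln (real n))) \<le> 1"
  shows "norm (cis_coeff \<theta> n - exp (cis_sum \<theta> n))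
    \<le> exp (cos_sum \<theta> b) * (2 * (\<bar>\<theta>\<bar> * ln (real n) * (5 * ln (ln (real n))))\<^sup>2)
      + 96 / ln (real n) ^ 3"
proof -
  define L where "L = ln (real n)"
  define \<Lambda> where "\<Lambda> = \<bar>\<theta>\<bar> * L * (5 * ln L)"
  note adm' = admissibleD[OF adm, folded L_def]
  have "(\<Sum>k\<in>{b<..n}. norm (cis (\<theta> * ln (real k)) - 1) / real k) \<le> (\<Sum>k\<in>{b<..n}. (\<bar>\<theta>\<bar> * L) * (1 / real k))"
  proof (rule sum_mono)
    fix k assume k: "k \<in> {b<..n}"
    have "norm (cis (\<theta> * ln (real k)) - 1) \<le> \<bar>\<theta>\<bar> * ln (real k)"
      using norm_cis_diff_le[of "\<theta> * ln (real k)" 0] k adm' by (simp add: abs_mult)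
    also have "\<dots> \<le> \<bar>\<theta>\<bar> * L" using k adm' by (intro mult_left_mono) (auto simp: L_def)
    finally show "norm (cis (\<theta> * ln (real k)) - 1) / real k \<le> (\<bar>\<theta>\<bar> * L) * (1 / real k)"
      by (simp add: divide_right_mono)
  qed
  also have "\<dots> = (\<bar>\<theta>\<bar> * L) * (\<Sum>k\<in>{b<..n}. 1 / real k)" by (simp add: sum_distrib_left)
  also have "\<dots> \<le> (\<bar>\<theta>\<bar> * L) * (5 * ln L)"
    using harm_interval_le[of b n] adm' by (intro mult_left_mono) (auto simp: L_def)
  finally have L: "(\<Sum>k\<in>{b<..n}. norm (cis (\<theta> * ln (real k)) - 1) / real k) \<le> \<Lambda>"
    by (simp add: \<Lambda>_def)
  have "norm (cis_coeff \<theta> n - exp (cis_sum \<theta> n))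
    \<le> exp (\<Sum>k=1..b. (Re (cis (\<theta> * ln (real k))) - 1) / real k) * (2 * \<Lambda>\<^sup>2)
      + 2 * split_error \<bar>\<theta>\<bar> n b"
    using adm' norm_cis_Suc_diff_le small L by (intro norm_cyc_sub_exp_le) (auto simp: \<Lambda>_def L_def)
  then show ?thesis
    using admissible_error_le[OF adm \<theta>] by (simp add: \<Lambda>_def L_def)
qed

text \<open>From \<open>ln b \<ge> L / 2\<close>,
  \<open>2/15 * 3 t^2 / (4 L) = t^2 / (10 L)\<close>; the prefactor \<open>L / 2\<close> turns this
  into \<open>t^2 / 20\<close> and the level 1/2 into \<open>L / 4\<close>.\<close>

lemma sum_cos_admissible_le:
  "\<exists>C\<ge>0. \<forall>n b \<theta> t. admissible n b \<longrightarrow> \<theta> \<noteq> 0 \<longrightarrow> \<theta>\<^sup>2 * ln (real n) ^ 3 = 3 * t\<^sup>2 \<longrightarrow>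
     cos_sum \<theta> b \<le> C * \<bar>\<theta>\<bar> - min (t\<^sup>2 / 20) (ln (real n) / 4)"
proof -
  obtain C where C: "C \<ge> 0" "\<And>\<theta> b. \<theta> \<noteq> 0 \<Longrightarrow> b \<ge> 2 \<Longrightarrow>
     cos_sum \<theta> b
       \<le> C * \<bar>\<theta>\<bar> - ln (real b) * min (2 * (\<theta> * ln (real b))\<^sup>2 / 15) (1/2)"
    using sum_cos_ln_le by blast
  have "cos_sum \<theta> b \<le> C * \<bar>\<theta>\<bar> - min (t\<^sup>2 / 20) (ln (real n) / 4)"
    if adm: "admissible n b" and \<theta>: "\<theta> \<noteq> 0" "\<theta>\<^sup>2 * ln (real n) ^ 3 = 3 * t\<^sup>2" for n b \<theta> t
  proof -
    define L where "L = ln (real n)"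
    note adm' = admissibleD[OF adm, folded L_def]
    have "\<theta>\<^sup>2 * (L / 2)\<^sup>2 \<le> \<theta>\<^sup>2 * (ln (real b))\<^sup>2"
      using adm' by (intro mult_left_mono power_mono) auto
    moreover have "\<theta>\<^sup>2 * (L / 2)\<^sup>2 = 3 * t\<^sup>2 / (4 * L)"
      using \<theta>(2) adm'(3) unfolding L_def[symmetric] by (simp add: field_simps eval_nat_numeral)
    ultimately have "t\<^sup>2 / (10 * L) \<le> 2 * (\<theta> * ln (real b))\<^sup>2 / 15"
      by (simp add: power_mult_distrib)
    then have "(L / 2) * min (t\<^sup>2 / (10 * L)) (1/2) \<le> ln (real b) * min (2 * (\<theta> * ln (real b))\<^sup>2 / 15) (1/2)"
      using adm' by (intro mult_mono min.mono) auto
    also have "(L / 2) * min (t\<^sup>2 / (10 * L)) (1/2) = min (t\<^sup>2 / 20) (L / 4)"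
      using adm'(3) by (subst min_mult_distrib_left) auto
    finally show ?thesis
      using C(2)[of \<theta> b] \<theta>(1) adm'(1) by (simp add: L_def)
  qed
  then show ?thesis using C(1) by blast
qed

section \<open>Law and characteristic function of the standardized linear statistic\<close>

lemma prod_cis_power:
  "finite A \<Longrightarrow> (\<Prod>k\<in>A. cis (x k) ^ c k) = cis (\<Sum>k\<in>A. real (c k) * x k)"
  by (induction A rule: finite_induct) (auto simp: Complex.DeMoivre cis_mult)

definition standardized :: "nat \<Rightarrow> (nat \<Rightarrow> nat) \<Rightarrow> real" where
  "standardized n \<sigma> = (log_weight n (cycle_count n \<sigma>) - (ln (real n))\<^sup>2 / 2) / sqrt (ln (real n) ^ 3 / 3)"

definition cycle_dist :: "nat \<Rightarrow> real measure" where
  "cycle_dist n = distr (uniform_perm n) borel (standardized n)"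

lemma finite_perms: "finite {\<sigma>. \<sigma> permutes {1..n::nat}}"
  by (intro finite_permutations) simp

lemma perms_nonempty: "{\<sigma>. \<sigma> permutes {1..n::nat}} \<noteq> {}"
  using permutes_id by blast

lemma integral_perms:
  fixes g :: "(nat \<Rightarrow> nat) \<Rightarrow> 'a::{real_normed_field, banach, second_countable_topology}"
  shows "(\<integral>\<sigma>. g \<sigma> \<partial>uniform_perm n) = perm_avg n g"
proof -
  have "(\<integral>\<sigma>. g \<sigma> \<partial>uniform_perm n)
      = (\<Sum>\<sigma>\<in>{\<sigma>. \<sigma> permutes {1..n}}. pmf (pmf_of_set {\<sigma>. \<sigma> permutes {1..n}}) \<sigma> *\<^sub>R g \<sigma>)"
    by (rule integral_measure_pmf[OF finite_perms]) (simp add: set_pmf_of_set[OF perms_nonempty finite_perms] del: One_nat_def)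
  also have "\<dots> = (\<Sum>\<sigma>\<in>{\<sigma>. \<sigma> permutes {1..n}}. (1 / fact n) *\<^sub>R g \<sigma>)"
    using card_permutations[of "{1..n}" n] perms_nonempty finite_perms
    by (intro sum.cong refl) (simp add: pmf_of_set)
  also have "\<dots> = perm_avg n g"
    by (simp add: perm_avg_def scaleR_conv_of_real sum_divide_distrib)
  finally show ?thesis .
qed

lemma real_distribution_cycle_dist: "real_distribution (cycle_dist n)"
  unfolding cycle_dist_def by (rule prob_space.real_distribution_distr) (auto intro: prob_space_measure_pmf)

lemma integrable_cycle_dist: "integrable (cycle_dist n) (\<lambda>x. x)"
  unfolding cycle_dist_def
  by (subst integrable_distr_eq)
     (auto intro!: integrable_measure_pmf_finite simp: set_pmf_of_set[OF perms_nonempty finite_perms] finite_perms simp del: One_nat_def)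

lemma cdf_cycle_dist:
  "cdf (cycle_dist n) x = real (card {\<sigma>. \<sigma> permutes {1..n} \<and> standardized n \<sigma> \<le> x}) / fact n"
proof -
  have "cdf (cycle_dist n) x = measure (uniform_perm n) {\<sigma>. standardized n \<sigma> \<le> x}"
    unfolding cycle_dist_def cdf_def by (subst measure_distr) (auto simp: vimage_def)
  also have "\<dots> = real (card ({\<sigma>. \<sigma> permutes {1..n}} \<inter> {\<sigma>. standardized n \<sigma> \<le> x})) / fact n"
    using card_permutations[of "{1..n}" n] by (subst measure_pmf_of_set[OF perms_nonempty finite_perms]) simp
  finally show ?thesis by (simp add: Collect_conj_eq)
qed

lemma char_cycle_dist_perm_avg: "char (cycle_dist n) t = perm_avg n (\<lambda>\<sigma>. cis (t * standardized n \<sigma>))"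
proof -
  have "char (cycle_dist n) t = (\<integral>\<sigma>. iexp (t * standardized n \<sigma>) \<partial>uniform_perm n)"
    unfolding char_def cycle_dist_def by (subst integral_distr) auto
  then show ?thesis unfolding integral_perms by (simp add: cis_conv_exp)
qed

lemma char_cycle_dist:
  fixes t :: real and n :: nat
  defines "\<theta> \<equiv> t / sqrt (ln (real n) ^ 3 / 3)"
  shows "char (cycle_dist n) t
    = cis (- (\<theta> * (ln (real n))\<^sup>2 / 2)) * cis_coeff \<theta> n"
proof -
  have "cis (t * standardized n \<sigma>) = cis (- (\<theta> * (ln (real n))\<^sup>2 / 2))
      * (\<Prod>k=1..n. cis (\<theta> * ln (real k)) ^ cycle_count n \<sigma> k)" for \<sigma>
  proof -
    have "t * standardized n \<sigma> = - (\<theta> * (ln (real n))\<^sup>2 / 2)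
       + (\<Sum>k=1..n. real (cycle_count n \<sigma> k) * (\<theta> * ln (real k)))"
      by (simp add: standardized_def log_weight_def \<theta>_def sum_distrib_left diff_divide_distrib right_diff_distrib sum_divide_distrib mult_ac)
    then show ?thesis by (simp add: prod_cis_power cis_mult)
  qed
  then show ?thesis
    unfolding char_cycle_dist_perm_avg by (simp add: perm_avg_mult_left perm_avg_prod del: One_nat_def)
qed

lemma norm_perm_avg_le: "norm (perm_avg n g) \<le> perm_avg n (\<lambda>\<sigma>. norm (g \<sigma>))"
  unfolding perm_avg_def norm_divide by (intro frac_le norm_sum sum_nonneg) auto

text \<open>First-moment bound, for frequencies so close to 0 that the additive error of the
  coefficient estimates would exceed \<open>\<bar>t\<bar>\<close>.\<close>

lemma norm_char_cycle_dist_sub_1_le: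
  assumes L: "ln (real n) \<ge> 3"
  shows "norm (char (cycle_dist n) t - 1) \<le> \<bar>t\<bar> * (9 * ln (real n))"
proof -
  define L where "L = ln (real n)"
  define s where "s = sqrt (L ^ 3 / 3)"
  have L3: "L \<ge> 3" using L by (simp add: L_def)
  have n1: "n \<ge> 1" using L by (cases n) auto
  have s: "s \<ge> L"
  proof -
    have "L\<^sup>2 * 3 \<le> L\<^sup>2 * L" using L3 by (intro mult_left_mono) auto
    then show ?thesis unfolding s_def by (intro real_le_rsqrt) (simp add: eval_nat_numeral)
  qed
  have "char (cycle_dist n) t - 1 = perm_avg n (\<lambda>\<sigma>. cis (t * standardized n \<sigma>) - 1)"
    by (simp add: char_cycle_dist_perm_avg perm_avg_diff perm_avg_const)
  also have "norm \<dots> \<le> perm_avg n (\<lambda>\<sigma>. norm (cis (t * standardized n \<sigma>) - 1))"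
    by (rule norm_perm_avg_le)
  also have "\<dots> \<le> perm_avg n (\<lambda>\<sigma>. (\<bar>t\<bar> / s) * (log_weight n (cycle_count n \<sigma>) - (- L\<^sup>2 / 2)))"
  proof (rule perm_avg_mono)
    fix \<sigma>
    have "norm (cis (t * standardized n \<sigma>) - 1) \<le> \<bar>t\<bar> * \<bar>standardized n \<sigma>\<bar>"
      using norm_cis_diff_le[of "t * standardized n \<sigma>" 0] by (simp add: abs_mult)
    also have "\<bar>standardized n \<sigma>\<bar> \<le> (log_weight n (cycle_count n \<sigma>) + L\<^sup>2 / 2) / s"
      using log_weight_nonneg[of n "cycle_count n \<sigma>"] s L3
      by (simp add: standardized_def L_def[symmetric] s_def[symmetric] divide_right_mono abs_le_iff)
    finally show "norm (cis (t * standardized n \<sigma>) - 1) \<le> (\<bar>t\<bar> / s) * (log_weight n (cycle_count n \<sigma>) - (- L\<^sup>2 / 2))"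
      by (simp add: mult_left_mono)
  qed
  also have "\<dots> = (\<bar>t\<bar> / s) * (perm_avg n (\<lambda>\<sigma>. log_weight n (cycle_count n \<sigma>)) + L\<^sup>2 / 2)"
    unfolding perm_avg_mult_left perm_avg_diff perm_avg_const by simp
  also have "\<dots> \<le> (\<bar>t\<bar> / s) * (9 * L\<^sup>2)"
  proof (rule mult_left_mono)
    have "perm_avg n (\<lambda>\<sigma>. log_weight n (cycle_count n \<sigma>)) \<le> 2 * L * (1 + L)"
      unfolding L_def by (rule perm_avg_log_weight_le[OF n1])
    also have "\<dots> \<le> 4 * L\<^sup>2" using L3 by (simp add: power2_eq_square algebra_simps)
    finally have "perm_avg n (\<lambda>\<sigma>. log_weight n (cycle_count n \<sigma>)) \<le> 4 * L\<^sup>2" .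
    moreover have "a + p / 2 \<le> 9 * p" if "a \<le> 4 * p" "0 \<le> p" for a p :: real
      using that by simp
    ultimately show "perm_avg n (\<lambda>\<sigma>. log_weight n (cycle_count n \<sigma>)) + L\<^sup>2 / 2 \<le> 9 * L\<^sup>2"
      using zero_le_power2 by blast
  qed (use s L3 in auto)
  also have "\<dots> \<le> (\<bar>t\<bar> / L) * (9 * L\<^sup>2)"
    using s L3 by (intro mult_right_mono divide_left_mono) auto
  also have "\<dots> = \<bar>t\<bar> * (9 * L)" using L3 by (simp add: power2_eq_square)
  finally show ?thesis by (simp add: L_def)
qed

text \<open>Once the mean and the Gaussian factor are split off, the exponent is
  \<open>- i q\<close> up to \<open>R\<close>. Linearising its exponential costs a square, and only
  the third-cumulant term \<open>q\<close> is kept.\<close>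

lemma exp_sum_cis_expansion:
  "\<exists>C\<ge>0. \<forall>n \<theta> L q R. n \<ge> 2 \<longrightarrow> L = ln (real n) \<longrightarrow> \<theta> \<noteq> 0 \<longrightarrow> q = \<theta> ^ 3 * L ^ 4 / 24 \<longrightarrow>
     R = \<theta> ^ 4 * L ^ 5 / 120 + C * \<bar>\<theta>\<bar> \<longrightarrow> \<bar>q\<bar> \<le> 1/2 \<longrightarrow> R \<le> 1/2 \<longrightarrow>
     norm (cis (- (\<theta> * L\<^sup>2 / 2)) * exp (cis_sum \<theta> n)
        - complex_of_real (exp (- (\<theta>\<^sup>2 * L ^ 3 / 6))) * (1 - \<i> * q))
      \<le> exp (- (\<theta>\<^sup>2 * L ^ 3 / 6)) * (2 * q\<^sup>2 + 2 * R)"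
proof -
  obtain C where C: "C \<ge> 0" "\<And>\<theta> n. \<theta> \<noteq> 0 \<Longrightarrow> n \<ge> 1 \<Longrightarrow>
     norm (cis_sum \<theta> n
       - ((cis (\<theta> * ln (real n)) - 1) / (\<i> * \<theta>) - ln (real n))) \<le> C * \<bar>\<theta>\<bar>"
    using sum_cis_ln by blast
  have "norm (cis (- (\<theta> * L\<^sup>2 / 2)) * exp (cis_sum \<theta> n)
        - complex_of_real (exp (- (\<theta>\<^sup>2 * L ^ 3 / 6))) * (1 - \<i> * q))
      \<le> exp (- (\<theta>\<^sup>2 * L ^ 3 / 6)) * (2 * q\<^sup>2 + 2 * R)"
    if n: "n \<ge> 2" and L: "L = ln (real n)" and \<theta>: "\<theta> \<noteq> 0" and q: "q = \<theta> ^ 3 * L ^ 4 / 24"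
      and R: "R = \<theta> ^ 4 * L ^ 5 / 120 + C * \<bar>\<theta>\<bar>" and small: "\<bar>q\<bar> \<le> 1/2" "R \<le> 1/2" for n \<theta> L q R
  proof -
    define S where "S = cis_sum \<theta> n"
    define A where "A = (cis (\<theta> * L) - 1) / (\<i> * \<theta>) - L"
    define P where "P = \<i> * (\<theta> * L\<^sup>2 / 2) - of_real (\<theta>\<^sup>2 * L ^ 3 / 6) - \<i> * (\<theta> ^ 3 * L ^ 4 / 24)"
    define z where "z = S - \<i> * (\<theta> * L\<^sup>2 / 2) + of_real (\<theta>\<^sup>2 * L ^ 3 / 6)"
    have L0: "L > 0" using n L by simp
    have "norm (S - A) \<le> C * \<bar>\<theta>\<bar>" unfolding S_def A_def L using C(2)[of \<theta> n] \<theta> n by simp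
    moreover have "norm (A - P) \<le> \<theta> ^ 4 * L ^ 5 / 120"
      unfolding A_def P_def by (rule norm_cis_taylor[OF \<theta> L0])
    ultimately have "norm ((S - A) + (A - P)) \<le> R"
      unfolding R by (intro order_trans[OF norm_triangle_ineq]) simp
    moreover have "(S - A) + (A - P) = z + \<i> * q" by (simp add: z_def P_def q)
    ultimately have zR: "norm (z + \<i> * q) \<le> R" by simp
    have R0: "R \<ge> 0" using norm_ge_zero zR by (rule order_trans)
    have "norm z \<le> norm (z + \<i> * q) + norm (\<i> * q)"
      using norm_triangle_ineq4[of "z + \<i> * q" "\<i> * q"] by simp
    then have nz: "norm z \<le> \<bar>q\<bar> + R" using zR by (simp add: norm_mult)
    have "norm (exp z - 1 - z) \<le> (\<bar>q\<bar> + R)\<^sup>2"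
      using nz small by (intro norm_exp_sub_linear_le) auto
    also have "\<dots> \<le> 2 * q\<^sup>2 + 2 * R\<^sup>2"
      using zero_le_power2[of "\<bar>q\<bar> - R"] by (simp add: power2_sum power2_diff)
    also have "R\<^sup>2 \<le> R * (1/2)" unfolding power2_eq_square using small R0 by (intro mult_left_mono) auto
    finally have 1: "norm (exp z - 1 - z) \<le> 2 * q\<^sup>2 + R" by simp
    have "norm (exp z - (1 - \<i> * q)) \<le> norm (exp z - 1 - z) + norm (z + \<i> * q)"
      using norm_triangle_ineq[of "exp z - 1 - z" "z + \<i> * q"] by (simp add: algebra_simps)
    then have 2: "norm (exp z - (1 - \<i> * q)) \<le> 2 * q\<^sup>2 + 2 * R" using 1 zR by simp
    have "cis (- (\<theta> * L\<^sup>2 / 2)) * exp S = of_real (exp (- (\<theta>\<^sup>2 * L ^ 3 / 6))) * exp z"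
      unfolding cis_conv_exp exp_of_real[symmetric] exp_add[symmetric] z_def by (simp add: algebra_simps)
    then have "cis (- (\<theta> * L\<^sup>2 / 2)) * exp S - of_real (exp (- (\<theta>\<^sup>2 * L ^ 3 / 6))) * (1 - \<i> * q)
       = of_real (exp (- (\<theta>\<^sup>2 * L ^ 3 / 6))) * (exp z - (1 - \<i> * q))"
      by (simp add: right_diff_distrib)
    also have "norm \<dots> \<le> exp (- (\<theta>\<^sup>2 * L ^ 3 / 6)) * (2 * q\<^sup>2 + 2 * R)"
      unfolding norm_mult using 2 by (simp add: mult_left_mono)
    finally show ?thesis unfolding S_def .
  qed
  then show ?thesis using C(1) by blast
qed

text \<open>Third cumulant \<open>L^4 / 4\<close> divided by 6 times the cube of the standard
  deviation \<open>sqrt (L^3 / 3)\<close>.\<close>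

definition skew_coeff :: "real \<Rightarrow> real" where
  "skew_coeff L = 3 powr (3/2) / (24 * sqrt L)"

lemma three_powr_three_halves: "3 powr (3/2) = 3 * sqrt (3::real)"
proof -
  have "(3::real) powr (3/2) = 3 powr (1 + 1/2)" by simp
  also have "\<dots> = 3 * sqrt 3" by (subst powr_add) (simp add: powr_half_sqrt)
  finally show ?thesis .
qed

lemma frequency_facts:
  fixes L t :: real
  assumes L: "L \<ge> 3" and t: "t \<noteq> 0"
  defines "\<theta> \<equiv> t / sqrt (L ^ 3 / 3)" and "q \<equiv> skew_coeff L * t ^ 3"
  shows "\<theta> \<noteq> 0" "\<theta>\<^sup>2 * L ^ 3 = 3 * t\<^sup>2" "\<bar>\<theta>\<bar> \<le> \<bar>t\<bar> / L" "q = \<theta> ^ 3 * L ^ 4 / 24"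
    "q\<^sup>2 = 27 * t ^ 6 / (576 * L)" "\<theta> ^ 4 * L ^ 5 = 9 * t ^ 4 / L"
    "(\<bar>\<theta>\<bar> * L * x)\<^sup>2 = 3 * t\<^sup>2 * x\<^sup>2 / L"
proof -
  define s where "s = sqrt (L ^ 3 / 3)"
  have s2: "s\<^sup>2 = L ^ 3 / 3" using L by (simp add: s_def)
  have s0: "s > 0" using L by (simp add: s_def)
  have sL: "s \<ge> L"
  proof -
    have "L\<^sup>2 * 3 \<le> L\<^sup>2 * L" using L by (intro mult_left_mono) auto
    then show ?thesis unfolding s_def by (intro real_le_rsqrt) (simp add: eval_nat_numeral)
  qed
  have \<theta>: "\<theta> = t / s" by (simp add: \<theta>_def s_def)
  show "\<theta> \<noteq> 0" using t s0 by (simp add: \<theta>)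
  have \<theta>2: "\<theta>\<^sup>2 = 3 * t\<^sup>2 / L ^ 3" using L by (simp add: \<theta> power_divide s2)
  show "\<theta>\<^sup>2 * L ^ 3 = 3 * t\<^sup>2" using L by (simp add: \<theta>2)
  show "\<bar>\<theta>\<bar> \<le> \<bar>t\<bar> / L" using s0 sL L by (simp add: \<theta> abs_divide divide_left_mono)
  have "\<theta> ^ 4 = (\<theta>\<^sup>2)\<^sup>2" by (simp flip: power_mult)
  also have "\<dots> = 9 * t ^ 4 / L ^ 6" by (simp add: \<theta>2 power_divide power_mult_distrib flip: power_mult)
  finally have \<theta>4: "\<theta> ^ 4 = 9 * t ^ 4 / L ^ 6" .
  have "L ^ 6 = L ^ 5 * L" by (simp add: eval_nat_numeral)
  then show "\<theta> ^ 4 * L ^ 5 = 9 * t ^ 4 / L" unfolding \<theta>4 using L by simp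
  have "(\<bar>\<theta>\<bar> * L * x)\<^sup>2 = \<theta>\<^sup>2 * L\<^sup>2 * x\<^sup>2" by (simp add: power_mult_distrib)
  moreover have "L ^ 3 = L\<^sup>2 * L" by (simp add: eval_nat_numeral)
  ultimately show "(\<bar>\<theta>\<bar> * L * x)\<^sup>2 = 3 * t\<^sup>2 * x\<^sup>2 / L"
    unfolding \<theta>2 using L by simp
  have "s = L * sqrt L / sqrt 3"
    unfolding s_def real_sqrt_divide using L by (simp add: eval_nat_numeral real_sqrt_mult)
  then have Ls: "L / s = sqrt 3 / sqrt L" using L by simp
  have "\<theta> ^ 3 = \<theta>\<^sup>2 * \<theta>" by (simp add: eval_nat_numeral)
  then have "\<theta> ^ 3 * L ^ 4 / 24 = 3 * t ^ 3 * (L / s) / 24"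
    unfolding \<theta>2 using L s0 by (simp add: \<theta> eval_nat_numeral)
  then show q: "q = \<theta> ^ 3 * L ^ 4 / 24"
    unfolding Ls by (simp add: q_def skew_coeff_def three_powr_three_halves)
  have "(sqrt 3 / sqrt L)\<^sup>2 = 3 / L" using L by (simp add: power_divide)
  moreover have "q = t ^ 3 / 8 * (sqrt 3 / sqrt L)"
    by (simp add: q_def skew_coeff_def three_powr_three_halves)
  moreover have "(t ^ 3)\<^sup>2 = t ^ 6" by (simp flip: power_mult)
  ultimately show "q\<^sup>2 = 27 * t ^ 6 / (576 * L)"
    by (simp add: power_mult_distrib power_divide)
qed

lemma abs_skew_term_le:
  fixes L t :: real
  assumes L: "L \<ge> 3" and t: "t \<noteq> 0"
  shows "\<bar>skew_coeff L * t ^ 3\<bar> \<le> \<bar>t\<bar> ^ 3"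
proof -
  have "(skew_coeff L * t ^ 3)\<^sup>2 = (27 / (576 * L)) * t ^ 6" using frequency_facts(5)[OF L t] by simp
  also have "\<dots> \<le> 1 * t ^ 6" using L by (intro mult_right_mono) (auto simp: field_simps)
  also have "1 * t ^ 6 = (\<bar>t\<bar> ^ 3)\<^sup>2" by (simp add: power_even_abs flip: power_mult)
  finally show ?thesis by (metis abs_ge_zero abs_le_square_iff abs_of_nonneg zero_le_power)
qed

section \<open>The characteristic function in three frequency ranges\<close>

abbreviation edgeworth_char :: "real \<Rightarrow> real \<Rightarrow> complex" where
  "edgeworth_char L t \<equiv> complex_of_real (exp (- t\<^sup>2 / 2)) * (1 - \<i> * skew_coeff L * complex_of_real t ^ 3)"

text \<open>The threshold \<open>1 / L^2\<close> is low enough for a bound of size \<open>L\<close>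
  to integrate to \<open>O(1 / L)\<close>, and high enough for additive errors of order
  \<open>1 / L^3\<close> to be \<open>O(\<bar>t\<bar> / L)\<close> above it.\<close>

lemma char_bound_tiny:
  assumes L: "ln (real n) \<ge> 3" and t: "t \<noteq> 0" "\<bar>t\<bar> \<le> 1 / (ln (real n))\<^sup>2"
  shows "norm (char (cycle_dist n) t - edgeworth_char (ln (real n)) t) \<le> \<bar>t\<bar> * (11 * ln (real n))"
proof -
  define L where "L = ln (real n)"
  define q where "q = skew_coeff L * t ^ 3"
  have L3: "L \<ge> 3" using L by (simp add: L_def)
  have "1 / L\<^sup>2 \<le> 1 / 1" using L3 by (intro divide_left_mono) (auto simp: one_le_power)
  then have t1: "\<bar>t\<bar> \<le> 1" using t by (simp add: L_def)
  have t2: "\<bar>t\<bar> * \<bar>t\<bar> \<le> \<bar>t\<bar> * 1" using t1 by (intro mult_left_mono) auto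
  have e: "\<bar>exp (- t\<^sup>2 / 2) - 1\<bar> \<le> \<bar>t\<bar>"
  proof -
    have "1 - t\<^sup>2 / 2 \<le> exp (- t\<^sup>2 / 2)" using exp_ge_add_one_self[of "- t\<^sup>2 / 2"] by simp
    moreover have "exp (- t\<^sup>2 / 2) \<le> 1" by simp
    moreover have "t\<^sup>2 / 2 \<le> \<bar>t\<bar>" using t2 by (simp add: power2_eq_square)
    ultimately show ?thesis by linarith
  qed
  have "\<bar>q\<bar> \<le> \<bar>t\<bar> ^ 3" unfolding q_def by (rule abs_skew_term_le[OF L3 t(1)])
  also have "\<bar>t\<bar> ^ 3 \<le> \<bar>t\<bar>" using power_decreasing[of 1 3 "\<bar>t\<bar>"] t1 by simp
  finally have qt: "\<bar>q\<bar> \<le> \<bar>t\<bar>" .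
  have "edgeworth_char L t - 1 = of_real (exp (- t\<^sup>2 / 2) - 1) - of_real (exp (- t\<^sup>2 / 2)) * (\<i> * q)"
    by (simp add: q_def algebra_simps)
  also have "norm \<dots> \<le> \<bar>t\<bar> + 1 * \<bar>t\<bar>"
  proof (intro order_trans[OF norm_triangle_ineq4] add_mono)
    show "norm (complex_of_real (exp (- t\<^sup>2 / 2) - 1)) \<le> \<bar>t\<bar>" unfolding norm_of_real by (rule e)
    show "norm (complex_of_real (exp (- t\<^sup>2 / 2)) * (\<i> * q)) \<le> 1 * \<bar>t\<bar>"
      unfolding norm_mult by (intro mult_mono) (use qt in auto)
  qed
  finally have "norm (edgeworth_char L t - 1) \<le> 2 * \<bar>t\<bar>" by simp
  moreover have "norm (char (cycle_dist n) t - 1) \<le> \<bar>t\<bar> * (9 * L)"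
    unfolding L_def by (rule norm_char_cycle_dist_sub_1_le[OF L])
  moreover have "norm (char (cycle_dist n) t - edgeworth_char L t)
      \<le> norm (char (cycle_dist n) t - 1) + norm (edgeworth_char L t - 1)"
    using norm_triangle_ineq4[of "char (cycle_dist n) t - 1" "edgeworth_char L t - 1"] by simp
  moreover have "2 * \<bar>t\<bar> \<le> \<bar>t\<bar> * (2 * L)" using L3 mult_left_mono[of 2 "2 * L" "\<bar>t\<bar>"] by (simp add: mult.commute)
  ultimately have "norm (char (cycle_dist n) t - edgeworth_char L t) \<le> \<bar>t\<bar> * (9 * L) + \<bar>t\<bar> * (2 * L)"
    by linarith
  also have "\<dots> = \<bar>t\<bar> * (11 * L)" by (simp add: algebra_simps)
  finally show ?thesis by (simp add: L_def)
qed

text \<open>\<open>L^(1/6)\<close> is the range in which \<open>q^2\<close>, of order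
  \<open>t^6 / L\<close>, stays bounded.\<close>

lemma power_le_of_le_root:
  fixes L t :: real
  assumes L: "L \<ge> 3" and t: "\<bar>t\<bar> \<le> L powr (1/6)"
  shows "t ^ 6 \<le> L" "t ^ 4 \<le> L" "t\<^sup>2 \<le> L powr (1/3)" "t\<^sup>2 \<le> L"
proof -
  have p: "\<bar>t\<bar> ^ k \<le> L powr (real k / 6)" for k
    using power_mono[OF t, of k] L by (simp add: powr_powr flip: powr_realpow)
  have m: "L powr a \<le> L" if "a \<le> 1" for a
    using powr_mono[of a 1 L] that L by simp
  show "t ^ 6 \<le> L" using p[of 6] L by (simp add: power_even_abs)
  show "t ^ 4 \<le> L" using order_trans[OF p[of 4] m] by (simp add: power_even_abs)
  show "t\<^sup>2 \<le> L powr (1/3)" using p[of 2] by simp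
  show "t\<^sup>2 \<le> L" using order_trans[OF p[of 2] m] by simp
qed

text \<open>Two errors, each brought to the form \<open>\<bar>t\<bar>\<close> times a rate: from the
  coefficient to the exponential, and from there to the Edgeworth factor. The last two assumptions
  hold for large \<open>n\<close>; they make the perturbation parameter at most 1 and help to keep
  \<open>R\<close> below 1/2.\<close>

lemma char_bound_moderate:
  "\<exists>C\<ge>0. \<exists>K\<ge>0. \<forall>n b t. admissible n b \<longrightarrow> t \<noteq> 0 \<longrightarrow>
     \<bar>t\<bar> \<le> ln (real n) powr (1/6) \<longrightarrow> 1 / (ln (real n))\<^sup>2 < \<bar>t\<bar> \<longrightarrow>
     75 * ln (real n) powr (1/3) * (ln (ln (real n)))\<^sup>2 / ln (real n) \<le> 1 \<longrightarrow>
     K * ln (real n) powr (1/6) / ln (real n) \<le> 1/4 \<longrightarrow>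
     norm (char (cycle_dist n) t - edgeworth_char (ln (real n)) t)
       \<le> \<bar>t\<bar> * (C * (ln (ln (real n)))\<^sup>2 / ln (real n))"
proof -
  obtain C0 where C0: "C0 \<ge> 0" "\<And>n b \<theta> t. admissible n b \<Longrightarrow> \<theta> \<noteq> 0 \<Longrightarrow> \<theta>\<^sup>2 * ln (real n) ^ 3 = 3 * t\<^sup>2 \<Longrightarrow>
     cos_sum \<theta> b \<le> C0 * \<bar>\<theta>\<bar> - min (t\<^sup>2 / 20) (ln (real n) / 4)"
    using sum_cos_admissible_le by blast
  obtain K where K: "K \<ge> 0" "\<And>n \<theta> L q R. n \<ge> 2 \<Longrightarrow> L = ln (real n) \<Longrightarrow> \<theta> \<noteq> 0 \<Longrightarrow> q = \<theta> ^ 3 * L ^ 4 / 24 \<Longrightarrow>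
     R = \<theta> ^ 4 * L ^ 5 / 120 + K * \<bar>\<theta>\<bar> \<Longrightarrow> \<bar>q\<bar> \<le> 1/2 \<Longrightarrow> R \<le> 1/2 \<Longrightarrow>
     norm (cis (- (\<theta> * L\<^sup>2 / 2)) * exp (cis_sum \<theta> n)
        - complex_of_real (exp (- (\<theta>\<^sup>2 * L ^ 3 / 6))) * (1 - \<i> * q))
      \<le> exp (- (\<theta>\<^sup>2 * L ^ 3 / 6)) * (2 * q\<^sup>2 + 2 * R)"
    using exp_sum_cis_expansion by blast
  \<comment> \<open>Exponential decay absorbs the powers of \<open>t\<close>: rate 1/20 from the
    cosine sum, rate 1/2 from the normal law.\<close>
  obtain K1 where K1: "K1 \<ge> 0" "\<And>t::real. \<bar>t\<bar> ^ 1 * exp (- (1/20 * t\<^sup>2)) \<le> K1"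
    using power_exp_bounded[of "1/20" 1] by auto
  obtain K3 where K3: "K3 \<ge> 0" "\<And>t::real. \<bar>t\<bar> ^ 3 * exp (- (1/2 * t\<^sup>2)) \<le> K3"
    using power_exp_bounded[of "1/2" 3] by auto
  obtain K5 where K5: "K5 \<ge> 0" "\<And>t::real. \<bar>t\<bar> ^ 5 * exp (- (1/2 * t\<^sup>2)) \<le> K5"
    using power_exp_bounded[of "1/2" 5] by auto
  define C where "C = 150 * exp C0 * K1 + 96 + (K5 + 2 * K3 + 2 * K)"
  have "norm (char (cycle_dist n) t - edgeworth_char (ln (real n)) t)
       \<le> \<bar>t\<bar> * (C * (ln (ln (real n)))\<^sup>2 / ln (real n))"
    if adm: "admissible n b" and t: "t \<noteq> 0" "\<bar>t\<bar> \<le> ln (real n) powr (1/6)" "1 / (ln (real n))\<^sup>2 < \<bar>t\<bar>"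
      and c1: "75 * ln (real n) powr (1/3) * (ln (ln (real n)))\<^sup>2 / ln (real n) \<le> 1"
      and c2: "K * ln (real n) powr (1/6) / ln (real n) \<le> 1/4" for n b t
  proof -
    define L where "L = ln (real n)"
    define \<theta> where "\<theta> = t / sqrt (L ^ 3 / 3)"
    define q where "q = skew_coeff L * t ^ 3"
    define R where "R = \<theta> ^ 4 * L ^ 5 / 120 + K * \<bar>\<theta>\<bar>"
    define p where "p = \<bar>\<theta>\<bar> * L * (5 * ln L)"
    define F where "F = cis_coeff \<theta> n"
    define E where "E = exp (cis_sum \<theta> n)"
    define w where "w = cis (- (\<theta> * L\<^sup>2 / 2))"
    have L3: "L \<ge> 3" and n2: "n \<ge> 2" using admissibleD[OF adm] by (auto simp: L_def)
    have lnL: "ln L \<ge> 1" using L3 exp_le by (subst ln_ge_iff) auto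
    then have lnL2: "1 \<le> (ln L)\<^sup>2" by simp
    note freq = frequency_facts[OF L3 t(1), folded \<theta>_def q_def]
    note tp = power_le_of_le_root[OF L3 t(2)[folded L_def]]
    have "\<bar>t\<bar> / L \<le> L powr (1/6) / L" using t(2) L3 by (intro divide_right_mono) (auto simp: L_def)
    also have "\<dots> \<le> L / L" using powr_mono[of "1/6" 1 L] L3 by (intro divide_right_mono) auto
    also have "L / L = 1" using L3 by simp
    finally have \<theta>1: "\<bar>\<theta>\<bar> \<le> 1" using freq(3) by (rule order_trans[rotated])
    have p2: "p\<^sup>2 = 75 * t\<^sup>2 * (ln L)\<^sup>2 / L"
      unfolding p_def freq(7) by (simp add: power_mult_distrib)
    also have "\<dots> \<le> 75 * L powr (1/3) * (ln L)\<^sup>2 / L"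
      using tp(3) L3 by (intro divide_right_mono mult_right_mono mult_left_mono) auto
    also have "\<dots> \<le> 1" using c1 by (simp add: L_def)
    finally have "p\<^sup>2 \<le> 1\<^sup>2" by simp
    then have p1: "p \<le> 1" by (rule power2_le_imp_le) simp
    have S: "exp (cos_sum \<theta> b) \<le> exp C0 * exp (- (1/20 * t\<^sup>2))"
    proof -
      have "cos_sum \<theta> b \<le> C0 * \<bar>\<theta>\<bar> - min (t\<^sup>2 / 20) (L / 4)"
        unfolding L_def using freq(1,2) by (intro C0(2)[OF adm]) (auto simp: L_def)
      also have "min (t\<^sup>2 / 20) (L / 4) = t\<^sup>2 / 20" using tp(4) L3 by (intro min_absorb1) simp
      also have "C0 * \<bar>\<theta>\<bar> \<le> C0 * 1" using \<theta>1 C0(1) by (intro mult_left_mono) auto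
      finally show ?thesis by (simp flip: exp_add)
    qed
    have "norm (F - E) \<le> exp (cos_sum \<theta> b) * (2 * p\<^sup>2) + 96 / L ^ 3"
      unfolding F_def E_def p_def L_def
      by (rule norm_cyc_cis_sub_exp_le[OF adm]) (use \<theta>1 p1 in \<open>auto simp: p_def L_def\<close>)
    also have "\<dots> \<le> (exp C0 * exp (- (1/20 * t\<^sup>2))) * (150 * t\<^sup>2 * (ln L)\<^sup>2 / L) + 96 / L ^ 3"
      using S L3 unfolding p2 by (intro add_mono mult_mono) auto
    also have "\<dots> = \<bar>t\<bar> * (150 * exp C0 * (\<bar>t\<bar> ^ 1 * exp (- (1/20 * t\<^sup>2))) * (ln L)\<^sup>2 / L) + 1 / L\<^sup>2 * (96 / L)"
      using L3 by (simp add: field_simps power2_eq_square power3_eq_cube abs_mult_self_eq)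
    \<comment> \<open>Here \<open>1 / L^2 < \<bar>t\<bar>\<close> converts the additive error into a
      multiple of \<open>\<bar>t\<bar>\<close>.\<close>
    also have "\<dots> \<le> \<bar>t\<bar> * (150 * exp C0 * K1 * (ln L)\<^sup>2 / L) + \<bar>t\<bar> * (96 * (ln L)\<^sup>2 / L)"
    proof (intro add_mono mult_left_mono divide_right_mono mult_right_mono K1 mult_mono)
      show "1 / L\<^sup>2 \<le> \<bar>t\<bar>" using t(3) by (simp add: L_def)
      show "(96::real) \<le> 96 * (ln L)\<^sup>2" using lnL2 by simp
    qed (use L3 in auto)
    finally have 1: "norm (F - E) \<le> \<bar>t\<bar> * ((150 * exp C0 * K1 + 96) * (ln L)\<^sup>2 / L)"
      by (simp add: algebra_simps add_divide_distrib)
    have R_le: "R \<le> t ^ 4 / L + K * (\<bar>t\<bar> / L)"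
    proof -
      have "\<theta> ^ 4 * L ^ 5 / 120 \<le> t ^ 4 / L" unfolding freq(6) using L3 by (simp add: field_simps)
      moreover have "K * \<bar>\<theta>\<bar> \<le> K * (\<bar>t\<bar> / L)" using K(1) freq(3) by (intro mult_left_mono)
      ultimately show ?thesis unfolding R_def by (rule add_mono)
    qed
    have R_small: "R \<le> 1/2"
    proof -
      have "\<theta> ^ 4 * L ^ 5 / 120 \<le> 1/4" unfolding freq(6) using tp(2) L3 by (simp add: field_simps)
      moreover have "K * \<bar>\<theta>\<bar> \<le> K * (L powr (1/6) / L)"
        using K(1) freq(3) t(2) L3
        by (intro mult_left_mono order_trans[OF freq(3)] divide_right_mono) (auto simp: L_def)
      ultimately show ?thesis using c2 unfolding R_def by (simp add: L_def)
    qed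
    have q_small: "\<bar>q\<bar> \<le> 1/2"
    proof (rule power2_le_imp_le)
      have "q\<^sup>2 = (27 / 576) * (t ^ 6 / L)" using freq(5) by simp
      also have "\<dots> \<le> (27 / 576) * 1" using tp(1) L3 by (intro mult_left_mono) auto
      finally show "\<bar>q\<bar>\<^sup>2 \<le> (1/2)\<^sup>2" by (simp add: power2_eq_square)
    qed simp
    have e: "exp (- (\<theta>\<^sup>2 * L ^ 3 / 6)) = exp (- (1/2 * t\<^sup>2))" unfolding freq(2) by simp
    have "norm (w * E - edgeworth_char L t) \<le> exp (- (1/2 * t\<^sup>2)) * (2 * q\<^sup>2 + 2 * R)"
      using K(2)[OF n2 L_def freq(1) freq(4) R_def q_small R_small]
      unfolding e w_def E_def q_def by (simp add: mult.assoc)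
    also have "\<dots> \<le> exp (- (1/2 * t\<^sup>2)) * (t ^ 6 / L + 2 * (t ^ 4 / L + K * (\<bar>t\<bar> / L)))"
    proof (intro mult_left_mono add_mono R_le)
      show "2 * q\<^sup>2 \<le> t ^ 6 / L" unfolding freq(5) using L3 by (simp add: field_simps)
    qed auto
    also have "\<dots> = \<bar>t\<bar> * ((\<bar>t\<bar> ^ 5 * exp (- (1/2 * t\<^sup>2)) + 2 * (\<bar>t\<bar> ^ 3 * exp (- (1/2 * t\<^sup>2))) + 2 * (K * exp (- (1/2 * t\<^sup>2)))) / L)"
    proof -
      have "t ^ 6 = \<bar>t\<bar> * \<bar>t\<bar> ^ 5" "t ^ 4 = \<bar>t\<bar> * \<bar>t\<bar> ^ 3"
        by (simp_all add: power_even_abs flip: power_Suc)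
      then show ?thesis by (simp add: algebra_simps add_divide_distrib)
    qed
    also have "\<dots> \<le> \<bar>t\<bar> * ((K5 + 2 * K3 + 2 * (K * 1)) / L)"
      using L3 K(1) by (intro mult_left_mono divide_right_mono add_mono K5 K3) auto
    also have "\<dots> \<le> \<bar>t\<bar> * ((K5 + 2 * K3 + 2 * K) * (ln L)\<^sup>2 / L)"
      using L3 lnL2 K(1) K3(1) K5(1) mult_left_mono[OF lnL2, of "K5 + 2 * K3 + 2 * K"]
      by (intro mult_left_mono divide_right_mono) auto
    finally have 2: "norm (w * E - edgeworth_char L t) \<le> \<bar>t\<bar> * ((K5 + 2 * K3 + 2 * K) * (ln L)\<^sup>2 / L)" .
    have ch: "char (cycle_dist n) t = w * F"
      unfolding char_cycle_dist w_def F_def \<theta>_def L_def ..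
    have "norm (char (cycle_dist n) t - edgeworth_char L t) \<le> norm (w * (F - E)) + norm (w * E - edgeworth_char L t)"
      unfolding ch using norm_triangle_ineq[of "w * (F - E)" "w * E - edgeworth_char L t"]
      by (simp add: algebra_simps)
    also have "norm (w * (F - E)) = norm (F - E)" by (simp add: norm_mult w_def)
    also have "norm (F - E) + norm (w * E - edgeworth_char L t) \<le> \<bar>t\<bar> * (C * (ln L)\<^sup>2 / L)"
      using add_mono[OF 1 2] by (simp add: C_def algebra_simps add_divide_distrib)
    finally show ?thesis by (simp add: L_def)
  qed
  moreover have "C \<ge> 0" using K(1) K1(1) K3(1) K5(1) by (simp add: C_def)
  ultimately show ?thesis using K(1) by blast
qed

text \<open>The two functions are not compared but bounded separately: beyond \<open>L^(1/6)\<close>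
  the factor \<open>exp (- t^2 / 20)\<close> beats every power of \<open>L\<close>, and where the
  cosine bound saturates, \<open>exp (- L / 4)\<close> does.\<close>

lemma char_bound_large:
  "\<exists>C\<ge>0. \<forall>n b t. admissible n b \<longrightarrow>
     \<bar>t\<bar> \<le> ln (real n) powr (2/3) \<longrightarrow> ln (real n) powr (1/6) < \<bar>t\<bar> \<longrightarrow>
     exp (- (ln (real n) powr (1/3) / 20)) \<le> 1 / (ln (real n))\<^sup>2 \<longrightarrow>
     exp (- (ln (real n) / 4)) \<le> 1 / (ln (real n))\<^sup>2 \<longrightarrow>
     norm (char (cycle_dist n) t - edgeworth_char (ln (real n)) t) \<le> \<bar>t\<bar> * (C / (ln (real n))\<^sup>2)"
proof -
  obtain C0 where C0: "C0 \<ge> 0" "\<And>n b \<theta> t. admissible n b \<Longrightarrow> \<theta> \<noteq> 0 \<Longrightarrow> \<theta>\<^sup>2 * ln (real n) ^ 3 = 3 * t\<^sup>2 \<Longrightarrow>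
     cos_sum \<theta> b \<le> C0 * \<bar>\<theta>\<bar> - min (t\<^sup>2 / 20) (ln (real n) / 4)"
    using sum_cos_admissible_le by blast
  obtain K where K: "K \<ge> 0" "\<And>t::real. \<bar>t\<bar> ^ 3 * exp (- (1/4 * t\<^sup>2)) \<le> K"
    using power_exp_bounded[of "1/4" 3] by auto
  define C where "C = 3 * exp C0 + 48 + (1 + K)"
  have "norm (char (cycle_dist n) t - edgeworth_char (ln (real n)) t) \<le> \<bar>t\<bar> * (C / (ln (real n))\<^sup>2)"
    if adm: "admissible n b" and t: "\<bar>t\<bar> \<le> ln (real n) powr (2/3)" "ln (real n) powr (1/6) < \<bar>t\<bar>"
      and d1: "exp (- (ln (real n) powr (1/3) / 20)) \<le> 1 / (ln (real n))\<^sup>2"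
      and d2: "exp (- (ln (real n) / 4)) \<le> 1 / (ln (real n))\<^sup>2" for n b t
  proof -
    define L where "L = ln (real n)"
    define \<theta> where "\<theta> = t / sqrt (L ^ 3 / 3)"
    have L3: "L \<ge> 3" using admissibleD[OF adm] by (auto simp: L_def)
    have "1 \<le> L powr (1/6)" using L3 by (intro ge_one_powr_ge_zero) auto
    then have t1: "1 \<le> \<bar>t\<bar>" and t0: "t \<noteq> 0" using t(2) by (auto simp: L_def)
    note freq = frequency_facts[OF L3 t0, folded \<theta>_def]
    have "\<bar>t\<bar> / L \<le> L powr (2/3) / L" using t(1) L3 by (intro divide_right_mono) (auto simp: L_def)
    also have "\<dots> \<le> L / L" using powr_mono[of "2/3" 1 L] L3 by (intro divide_right_mono) auto
    also have "L / L = 1" using L3 by simp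
    finally have \<theta>1: "\<bar>\<theta>\<bar> \<le> 1" using freq(3) by (rule order_trans[rotated])
    have t2: "L powr (1/3) \<le> t\<^sup>2"
      using power_mono[of "L powr (1/6)" "\<bar>t\<bar>" 2] t(2) L3
      by (simp add: L_def powr_powr flip: powr_realpow)
    have small: "exp (- (t\<^sup>2 / 20)) \<le> 1 / L\<^sup>2"
      using t2 by (intro order_trans[OF _ d1[folded L_def]]) simp
    have S: "exp (cos_sum \<theta> b) \<le> exp C0 * (1 / L\<^sup>2)"
    proof -
      have "cos_sum \<theta> b \<le> C0 * \<bar>\<theta>\<bar> - min (t\<^sup>2 / 20) (L / 4)"
        unfolding L_def using freq(1,2) by (intro C0(2)[OF adm]) (auto simp: L_def)
      also have "C0 * \<bar>\<theta>\<bar> \<le> C0 * 1" using \<theta>1 C0(1) by (intro mult_left_mono) auto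
      finally have "exp (cos_sum \<theta> b) \<le> exp C0 * exp (- min (t\<^sup>2 / 20) (L / 4))"
        by (simp flip: exp_add)
      also have "exp (- min (t\<^sup>2 / 20) (L / 4)) \<le> 1 / L\<^sup>2"
        using small d2 by (simp add: min_def L_def)
      finally show ?thesis by (simp add: mult_left_mono)
    qed
    have "norm (char (cycle_dist n) t) = norm (cis_coeff \<theta> n)"
      unfolding char_cycle_dist \<theta>_def L_def by (simp add: norm_mult)
    also have "\<dots> \<le> 3 * exp (cos_sum \<theta> b) + 48 / L ^ 3"
      unfolding L_def by (rule norm_cyc_cis_le[OF adm]) (use \<theta>1 in auto)
    also have "\<dots> \<le> 3 * (exp C0 * (1 / L\<^sup>2)) + 48 / L\<^sup>2"
      using S L3 by (intro add_mono mult_left_mono divide_left_mono power_increasing) auto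
    finally have 1: "norm (char (cycle_dist n) t) \<le> (3 * exp C0 + 48) / L\<^sup>2"
      by (simp add: add_divide_distrib)
    have "norm (edgeworth_char L t) \<le> exp (- t\<^sup>2 / 2) * (1 + \<bar>t\<bar> ^ 3)"
    proof -
      have "norm (1 - \<i> * skew_coeff L * t ^ 3) \<le> 1 + \<bar>skew_coeff L * t ^ 3\<bar>"
        by (rule order_trans[OF norm_triangle_ineq4]) (simp add: norm_mult abs_mult norm_power power_abs)
      also have "\<dots> \<le> 1 + \<bar>t\<bar> ^ 3" using abs_skew_term_le[OF L3 t0] by simp
      finally show ?thesis by (simp add: norm_mult)
    qed
    \<comment> \<open>Half of the Gaussian exponent pays for \<open>1 / L^2\<close>, the other half
      for the cubic factor.\<close>
    also have "\<dots> = exp (- (1/4 * t\<^sup>2)) * (exp (- (1/4 * t\<^sup>2)) + \<bar>t\<bar> ^ 3 * exp (- (1/4 * t\<^sup>2)))"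
      by (simp add: algebra_simps flip: exp_add)
    also have "\<dots> \<le> (1 / L\<^sup>2) * (1 + K)"
    proof (intro mult_mono add_mono K)
      show "exp (- (1/4 * t\<^sup>2)) \<le> 1 / L\<^sup>2" by (rule order_trans[OF _ small]) simp
    qed (auto intro!: add_nonneg_nonneg)
    finally have 2: "norm (edgeworth_char L t) \<le> (1 + K) / L\<^sup>2" by simp
    have "norm (char (cycle_dist n) t - edgeworth_char L t) \<le> C / L\<^sup>2"
      using order_trans[OF norm_triangle_ineq4 add_mono[OF 1 2]] by (simp add: C_def add_divide_distrib)
    also have "\<dots> \<le> \<bar>t\<bar> * (C / L\<^sup>2)"
      using t1 K(1) mult_right_mono[OF t1, of "C / L\<^sup>2"] by (simp add: C_def)
    finally show ?thesis by (simp add: L_def)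
  qed
  moreover have "C \<ge> 0" using K(1) by (simp add: C_def)
  ultimately show ?thesis by blast
qed

section \<open>Edgeworth expansion of the linear statistic\<close>

lemma eventually_ln:
  assumes "eventually P at_top"
  shows "eventually (\<lambda>n. P (ln (real n))) sequentially"
proof -
  have "filterlim (\<lambda>n. ln (real n)) at_top sequentially" by real_asymp
  then show ?thesis using assms by (rule eventually_compose_filterlim[rotated])
qed

lemma abs_skew_coeff_le_1: "L \<ge> 3 \<Longrightarrow> \<bar>skew_coeff L\<bar> \<le> 1"
proof -
  assume L: "L \<ge> 3"
  have "sqrt 3 \<le> 2" by (rule real_le_lsqrt) auto
  moreover have "1 \<le> sqrt L" using L by simp
  ultimately have "3 * sqrt 3 \<le> 24 * sqrt L" by linarith
  then show ?thesis using L by (simp add: skew_coeff_def three_powr_three_halves)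
qed

text \<open>Integrated over their ranges, the three bounds are of order \<open>1 / L\<close>,
  \<open>(ln L)^2 L^(-5/6)\<close> and \<open>L^(-4/3)\<close>; the cutoff term
  \<open>1 / T = L^(-2/3)\<close> dominates.\<close>

lemma cdf_cycle_dist_edgeworth:
  "\<exists>C\<ge>0. eventually (\<lambda>n. \<forall>x. \<bar>cdf (cycle_dist n) x - Phi x - skew_coeff (ln (real n)) * edgeworth_term x\<bar>
      \<le> C * ln (real n) powr (-2/3)) sequentially"
proof (rule edgeworth_smoothing, goal_cases)
  case (1 C)
  note C = 1
  obtain C1 K where C1: "C1 \<ge> 0" "K \<ge> 0" "\<And>n b t. admissible n b \<Longrightarrow> t \<noteq> 0 \<Longrightarrow>
     \<bar>t\<bar> \<le> ln (real n) powr (1/6) \<Longrightarrow> 1 / (ln (real n))\<^sup>2 < \<bar>t\<bar> \<Longrightarrow>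
     75 * ln (real n) powr (1/3) * (ln (ln (real n)))\<^sup>2 / ln (real n) \<le> 1 \<Longrightarrow>
     K * ln (real n) powr (1/6) / ln (real n) \<le> 1/4 \<Longrightarrow>
     norm (char (cycle_dist n) t - edgeworth_char (ln (real n)) t)
       \<le> \<bar>t\<bar> * (C1 * (ln (ln (real n)))\<^sup>2 / ln (real n))"
    using char_bound_moderate by blast
  obtain C2 where C2: "C2 \<ge> 0" "\<And>n b t. admissible n b \<Longrightarrow>
     \<bar>t\<bar> \<le> ln (real n) powr (2/3) \<Longrightarrow> ln (real n) powr (1/6) < \<bar>t\<bar> \<Longrightarrow>
     exp (- (ln (real n) powr (1/3) / 20)) \<le> 1 / (ln (real n))\<^sup>2 \<Longrightarrow>
     exp (- (ln (real n) / 4)) \<le> 1 / (ln (real n))\<^sup>2 \<Longrightarrow>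
     norm (char (cycle_dist n) t - edgeworth_char (ln (real n)) t) \<le> \<bar>t\<bar> * (C2 / (ln (real n))\<^sup>2)"
    using char_bound_large by blast
  define D where "D = C * (23 + 2 * C1 + 2 * C2)"
  have c2: "eventually (\<lambda>L::real. K * L powr (1/6) / L \<le> 1/4) at_top"
  proof -
    have "((\<lambda>L::real. L powr (1/6) / L) \<longlongrightarrow> 0) at_top" by real_asymp
    then have "((\<lambda>L::real. K * (L powr (1/6) / L)) \<longlongrightarrow> K * 0) at_top" by (intro tendsto_intros)
    then have "eventually (\<lambda>L::real. K * (L powr (1/6) / L) < 1/4) at_top"
      by (intro order_tendstoD(2)[where y = "K * 0"]) auto
    then show ?thesis by eventually_elim simp
  qed
  have "eventually (\<lambda>L::real. 75 * L powr (1/3) * (ln L)\<^sup>2 / L \<le> 1) at_top" by real_asymp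
  moreover have "eventually (\<lambda>L::real. exp (- (L powr (1/3) / 20)) \<le> 1 / L\<^sup>2) at_top" by real_asymp
  moreover have "eventually (\<lambda>L::real. exp (- (L / 4)) \<le> 1 / L\<^sup>2) at_top" by real_asymp
  moreover have "eventually (\<lambda>L::real. 11 * L * (2 / L\<^sup>2) \<le> 22 * L powr (-2/3)) at_top" by real_asymp
  moreover have "eventually (\<lambda>L::real. (ln L)\<^sup>2 / L * L powr (1/6) \<le> L powr (-2/3)) at_top" by real_asymp
  moreover have "eventually (\<lambda>L::real. 1 / L\<^sup>2 * L powr (2/3) \<le> L powr (-2/3)) at_top" by real_asymp
  ultimately have "eventually (\<lambda>L::real. K * L powr (1/6) / L \<le> 1/4
      \<and> 75 * L powr (1/3) * (ln L)\<^sup>2 / L \<le> 1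
      \<and> exp (- (L powr (1/3) / 20)) \<le> 1 / L\<^sup>2 \<and> exp (- (L / 4)) \<le> 1 / L\<^sup>2
      \<and> 11 * L * (2 / L\<^sup>2) \<le> 22 * L powr (-2/3) \<and> (ln L)\<^sup>2 / L * L powr (1/6) \<le> L powr (-2/3)
      \<and> 1 / L\<^sup>2 * L powr (2/3) \<le> L powr (-2/3)) at_top"
    using c2 by eventually_elim simp
  from eventually_ln[OF this] eventually_admissible
  have "eventually (\<lambda>n. \<forall>x. \<bar>cdf (cycle_dist n) x - Phi x - skew_coeff (ln (real n)) * edgeworth_term x\<bar>
      \<le> D * ln (real n) powr (-2/3)) sequentially"
  proof eventually_elim
    case (elim n)
    define L where "L = ln (real n)"
    obtain b where adm: "admissible n b" using elim by blast
    have L3: "L \<ge> 3" using admissibleD[OF adm] by (simp add: L_def)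
    note e = elim(1)[folded L_def]
    define T where "T = L powr (2/3)"
    define A where "A = C1 * (ln L)\<^sup>2 / L"
    define B where "B = C2 / L\<^sup>2"
    \<comment> \<open>The intervals overlap harmlessly: all levels are nonnegative, so
      \<open>r\<close> is at least the level required in each range.\<close>
    define r where "r t = 11 * L * indicator {- (1 / L\<^sup>2)..1 / L\<^sup>2} t + A * indicator {- (L powr (1/6))..L powr (1/6)} t
       + B * indicator {-T..T} t" for t :: real
    have T0: "T > 0" using L3 by (simp add: T_def)
    have A0: "A \<ge> 0" and B0: "B \<ge> 0" using C1(1) C2(1) L3 by (auto simp: A_def B_def)
    have rnn: "r t \<ge> 0" for t using L3 A0 B0 by (simp add: r_def)
    have r_int: "has_bochner_integral lborel r (11 * L * (2 / L\<^sup>2) + A * (2 * L powr (1/6)) + B * (2 * T))"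
    proof -
      have "has_bochner_integral lborel (indicator {-c..c} :: real \<Rightarrow> real) (2 * c)" if "c \<ge> 0" for c :: real
        using has_bochner_integral_real_indicator[of "{-c..c}" lborel] that by simp
      from this[of "1 / L\<^sup>2"] this[of "L powr (1/6)"] this[of T] show ?thesis
        unfolding r_def using T0 by (intro has_bochner_integral_add has_bochner_integral_mult_right) auto
    qed
    have bound: "norm (char (cycle_dist n) t - edgeworth_char L t) \<le> \<bar>t\<bar> * r t" if t: "t \<noteq> 0" "\<bar>t\<bar> \<le> T" for t
    proof -
      consider "\<bar>t\<bar> \<le> 1 / L\<^sup>2" | "1 / L\<^sup>2 < \<bar>t\<bar>" "\<bar>t\<bar> \<le> L powr (1/6)" | "L powr (1/6) < \<bar>t\<bar>" by linarith
      then show ?thesis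
      proof cases
        case 1
        have "norm (char (cycle_dist n) t - edgeworth_char L t) \<le> \<bar>t\<bar> * (11 * L)"
          using char_bound_tiny[of n t] L3 t 1 by (simp add: L_def)
        also have "11 * L \<le> r t" using 1 A0 B0 by (simp add: r_def indicator_def abs_le_iff)
        finally show ?thesis by (simp add: mult_left_mono)
      next
        case 2
        have "norm (char (cycle_dist n) t - edgeworth_char L t) \<le> \<bar>t\<bar> * A"
          unfolding L_def A_def by (rule C1(3)[OF adm t(1)]) (use 2 e in \<open>simp_all add: L_def\<close>)
        also have "A \<le> r t" using 2 A0 B0 L3 by (simp add: r_def indicator_def abs_le_iff)
        finally show ?thesis by (simp add: mult_left_mono)
      next
        case 3
        have "norm (char (cycle_dist n) t - edgeworth_char L t) \<le> \<bar>t\<bar> * B"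
          unfolding L_def B_def by (rule C2(2)[OF adm]) (use 3 e t in \<open>simp_all add: L_def T_def\<close>)
        also have "B \<le> r t" using t A0 B0 L3 by (simp add: r_def indicator_def abs_le_iff)
        finally show ?thesis by (simp add: mult_left_mono)
      qed
    qed
    have T_inv: "1 / T = L powr (-2/3)" using L3 by (simp add: T_def powr_minus_divide)
    have "(\<integral>t. r t \<partial>lborel) \<le> (22 + 2 * C1 + 2 * C2) * L powr (-2/3)"
    proof -
      have "(\<integral>t. r t \<partial>lborel) = 11 * L * (2 / L\<^sup>2) + 2 * C1 * ((ln L)\<^sup>2 / L * L powr (1/6)) + 2 * C2 * (1 / L\<^sup>2 * L powr (2/3))"
        using r_int by (simp add: has_bochner_integral_iff A_def B_def T_def mult_ac)
      also have "\<dots> \<le> 22 * L powr (-2/3) + 2 * C1 * L powr (-2/3) + 2 * C2 * L powr (-2/3)"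
        using e C1(1) C2(1) by (intro add_mono mult_left_mono) auto
      finally show ?thesis by (simp add: algebra_simps)
    qed
    then have i: "(\<integral>t. r t \<partial>lborel) + 1 / T \<le> (23 + 2 * C1 + 2 * C2) * L powr (-2/3)"
      unfolding T_inv by (simp add: algebra_simps)
    show ?case
    proof
      fix x
      have "\<bar>cdf (cycle_dist n) x - Phi x - skew_coeff L * edgeworth_term x\<bar> \<le> C * ((\<integral>t. r t \<partial>lborel) + 1 / T)"
        using r_int by (intro C(2)[OF real_distribution_cycle_dist integrable_cycle_dist abs_skew_coeff_le_1[OF L3] T0 _ rnn bound])
          (simp_all add: has_bochner_integral_iff)
      also have "\<dots> \<le> C * ((23 + 2 * C1 + 2 * C2) * L powr (-2/3))"
        using i C(1) by (intro mult_left_mono) auto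
      finally show "\<bar>cdf (cycle_dist n) x - Phi x - skew_coeff (ln (real n)) * edgeworth_term x\<bar> \<le> D * ln (real n) powr (-2/3)"
        by (simp add: D_def L_def mult_ac)
    qed
  qed
  moreover have "D \<ge> 0" using C(1) C1(1) C2(1) by (simp add: D_def)
  ultimately show ?case by blast
qed

section \<open>Transfer to the involution count\<close>

lemma card_perms_markov:
  fixes \<rho> :: "(nat \<Rightarrow> nat) \<Rightarrow> real"
  assumes "c > 0" "\<And>\<sigma>. \<rho> \<sigma> \<ge> 0"
  shows "real (card {\<sigma>. \<sigma> permutes {1..n} \<and> \<rho> \<sigma> > c}) / fact n \<le> perm_avg n \<rho> / c"
proof -
  have fin: "finite {\<sigma>. \<sigma> permutes {1..n} \<and> \<rho> \<sigma> > c}"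
    by (rule finite_subset[OF _ finite_perms[of n]]) auto
  have "real (card {\<sigma>. \<sigma> permutes {1..n} \<and> \<rho> \<sigma> > c}) * c = (\<Sum>\<sigma> | \<sigma> permutes {1..n} \<and> \<rho> \<sigma> > c. c)"
    by simp
  also have "\<dots> \<le> (\<Sum>\<sigma> | \<sigma> permutes {1..n} \<and> \<rho> \<sigma> > c. \<rho> \<sigma>)" by (intro sum_mono) auto
  also have "\<dots> \<le> (\<Sum>\<sigma> | \<sigma> permutes {1..n}. \<rho> \<sigma>)"
    using assms(2) by (intro sum_mono2 finite_perms) auto
  finally show ?thesis using assms(1) by (simp add: perm_avg_def field_simps)
qed

theorem theorem5p8:
  shows "\<exists>C. \<exists>N. \<forall>n\<ge>N. \<forall>x::real.
    \<bar>invol_cdf n x - Phi x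
       - 3 powr (3/2) / (24 * sqrt (2 * pi)) * ((1 - x\<^sup>2) * exp (- x\<^sup>2 / 2)) / sqrt (ln (real n))\<bar>
    \<le> C * (ln (ln (real n)) / ln (real n)) powr (2/3)"
proof -
  obtain C where C: "C \<ge> 0" "eventually (\<lambda>n. \<forall>x. \<bar>cdf (cycle_dist n) x - Phi x - skew_coeff (ln (real n)) * edgeworth_term x\<bar>
      \<le> C * ln (real n) powr (-2/3)) sequentially"
    using cdf_cycle_dist_edgeworth by blast
  obtain K where K: "K \<ge> 0" "\<And>n. perm_avg n (\<lambda>\<sigma>. \<Sum>k=1..n. ln (invol_factor k (cycle_count n \<sigma> k))) \<le> K"
    using perm_avg_invol_factor by blast
  \<comment> \<open>With standard deviation \<open>s\<close> and shift
    \<open>\<delta> = L^(-2/3)\<close> this says \<open>s \<delta>^2 \<ge> 1\<close>, so Markov's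
    bound \<open>K / (s \<delta>)\<close> is at most \<open>K \<delta>\<close>.\<close>
  have "eventually (\<lambda>L::real. L powr (2/3) \<le> sqrt (L ^ 3 / 3) * L powr (-2/3)) at_top" by real_asymp
  then have ev1: "eventually (\<lambda>n. ln (real n) powr (2/3) \<le> sqrt (ln (real n) ^ 3 / 3) * ln (real n) powr (-2/3)) sequentially"
    by (rule eventually_ln)
  have ev2: "eventually (\<lambda>n. ln (real n) \<ge> 3) sequentially" by real_asymp
  have "eventually (\<lambda>n. \<forall>x. \<bar>invol_cdf n x - Phi x
       - 3 powr (3/2) / (24 * sqrt (2 * pi)) * ((1 - x\<^sup>2) * exp (- x\<^sup>2 / 2)) / sqrt (ln (real n))\<bar>
    \<le> (C + K + 7) * (ln (ln (real n)) / ln (real n)) powr (2/3)) sequentially"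
    using C(2) ev1 ev2
  proof eventually_elim
    case (elim n)
    define L where "L = ln (real n)"
    define s where "s = sqrt (L ^ 3 / 3)"
    define \<delta> where "\<delta> = L powr (-2/3)"
    define \<rho> where "\<rho> \<sigma> = (\<Sum>k=1..n. ln (invol_factor k (cycle_count n \<sigma> k)))" for \<sigma>
    define V where "V \<sigma> = (ln (invol n (cycle_count n \<sigma>)) - (ln (real n))\<^sup>2 / 2) / sqrt ((ln (real n)) ^ 3 / 3)" for \<sigma>
    define G where "G x = Phi x + skew_coeff L * edgeworth_term x" for x
    have L3: "L \<ge> 3" using elim by (simp add: L_def)
    have s0: "s > 0" using L3 by (simp add: s_def)
    have \<delta>0: "\<delta> > 0" using L3 by (simp add: \<delta>_def)
    have s\<delta>: "1 / \<delta> \<le> s * \<delta>"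
      using elim(2) L3 by (simp add: s_def \<delta>_def L_def powr_minus_divide)
    have \<rho>0: "\<rho> \<sigma> \<ge> 0" for \<sigma>
      unfolding \<rho>_def using invol_factor_ge_1 by (intro sum_nonneg) simp
    have V: "V \<sigma> = standardized n \<sigma> + \<rho> \<sigma> / s" for \<sigma>
      unfolding V_def ln_invol standardized_def \<rho>_def s_def L_def
      by (simp add: add_divide_distrib diff_divide_distrib)
    have cdf_V: "invol_cdf n x = real (card {\<sigma>. \<sigma> permutes {1..n} \<and> V \<sigma> \<le> x}) / fact n" for x
      by (simp add: invol_cdf_def V_def)
    have fin: "finite {\<sigma>. \<sigma> permutes {1..n} \<and> P \<sigma>}" for P
      by (rule finite_subset[OF _ finite_perms[of n]]) auto
    \<comment> \<open>The correction \<rho> is nonnegative, so this direction holds without a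
      shift.\<close>
    have upper: "invol_cdf n x \<le> cdf (cycle_dist n) x" for x
    proof -
      have "standardized n \<sigma> \<le> x" if "V \<sigma> \<le> x" for \<sigma>
        using that \<rho>0[of \<sigma>] s0 divide_nonneg_pos[of "\<rho> \<sigma>" s] unfolding V by linarith
      then show ?thesis
        unfolding cdf_V cdf_cycle_dist by (intro divide_right_mono of_nat_mono card_mono fin) auto
    qed
    \<comment> \<open>Outside the event \<open>\<rho> > s \<delta>\<close> the correction moves the
      standardized value by at most \<delta>.\<close>
    have lower: "cdf (cycle_dist n) (x - \<delta>) - K * \<delta> \<le> invol_cdf n x" for x
    proof -
      let ?S = "{\<sigma>. \<sigma> permutes {1..n} \<and> standardized n \<sigma> \<le> x - \<delta>}" and ?V = "{\<sigma>. \<sigma> permutes {1..n} \<and> V \<sigma> \<le> x}"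
        and ?B = "{\<sigma>. \<sigma> permutes {1..n} \<and> \<rho> \<sigma> > s * \<delta>}"
      have "?S
          \<subseteq> ?V \<union> ?B"
      proof -
        have "V \<sigma> \<le> x" if "standardized n \<sigma> \<le> x - \<delta>" "\<not> \<rho> \<sigma> > s * \<delta>" for \<sigma>
        proof -
          have "\<rho> \<sigma> / s \<le> \<delta>" using that(2) s0 by (simp add: field_simps)
          then show ?thesis using that(1) unfolding V by linarith
        qed
        then show ?thesis by auto
      qed
      then have "card ?S
          \<le> card (?V \<union> ?B)"
        by (intro card_mono finite_UnI fin)
      also have "\<dots> \<le> card ?V + card ?B"
        by (rule card_Un_le)
      finally have "real (card ?S) / fact n
          \<le> (real (card ?V) + real (card ?B)) / fact n"
        by (intro divide_right_mono) (simp_all flip: of_nat_add)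
      also have "\<dots> = invol_cdf n x + real (card ?B) / fact n"
        by (simp add: cdf_V add_divide_distrib)
      also have "real (card ?B) / fact n \<le> perm_avg n \<rho> / (s * \<delta>)"
        using s0 \<delta>0 \<rho>0 by (intro card_perms_markov) auto
      also have "\<dots> \<le> K / (s * \<delta>)"
        using K(2)[of n] s0 \<delta>0 unfolding \<rho>_def[abs_def] by (intro divide_right_mono) auto
      also have "\<dots> \<le> K / (1 / \<delta>)"
        using K(1) s\<delta> s0 \<delta>0 by (intro divide_left_mono) auto
      finally show ?thesis by (simp add: cdf_cycle_dist)
    qed
    have edgeworth: "\<bar>cdf (cycle_dist n) x - G x\<bar> \<le> C * \<delta>" for x
      using elim(1) unfolding G_def L_def \<delta>_def by (simp add: algebra_simps)
    have G_lip: "G x - 7 * \<delta> \<le> G (x - \<delta>)" for x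
    proof -
      have "Phi x \<le> Phi (x - \<delta>) + \<delta>" using Phi_lipschitz[of \<delta> "x - \<delta>"] \<delta>0 by simp
      moreover have "\<bar>skew_coeff L * (edgeworth_term x - edgeworth_term (x - \<delta>))\<bar> \<le> 1 * (6 * \<delta>)"
        unfolding abs_mult using abs_skew_coeff_le_1[OF L3] edgeworth_term_lipschitz[of x "x - \<delta>"] \<delta>0
        by (intro mult_mono) auto
      ultimately show ?thesis by (simp add: G_def algebra_simps)
    qed
    \<comment> \<open>\<open>C\<close> comes from the Edgeworth expansion, \<open>K\<close> from
      Markov's inequality, and 7 = 1 + 6 from the Lipschitz constants of \<open>Phi\<close> and of
      the correction.\<close>
    have main: "\<bar>invol_cdf n x - G x\<bar> \<le> (C + K + 7) * \<delta>" for x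
    proof -
      have "invol_cdf n x - G x \<le> C * \<delta>"
        using upper[of x] edgeworth[of x] by linarith
      also have "\<dots> \<le> (C + K + 7) * \<delta>" using K(1) \<delta>0 by (intro mult_right_mono) auto
      finally have 1: "invol_cdf n x - G x \<le> (C + K + 7) * \<delta>" .
      have "G x - invol_cdf n x \<le> C * \<delta> + K * \<delta> + 7 * \<delta>"
        using lower[of x] edgeworth[of "x - \<delta>"] G_lip[of x] by linarith
      also have "\<dots> = (C + K + 7) * \<delta>" by (simp add: algebra_simps)
      finally show ?thesis using 1 by (simp add: abs_le_iff)
    qed
    \<comment> \<open>\<open>ln L \<ge> 1\<close> passes from the rate \<open>L^(-2/3)\<close> to
      the stated one.\<close>
    have \<delta>_le: "\<delta> \<le> (ln L / L) powr (2/3)"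
    proof -
      have "ln L \<ge> 1" using L3 exp_le by (subst ln_ge_iff) auto
      then have "(1 / L) powr (2/3) \<le> (ln L / L) powr (2/3)"
        using L3 by (intro powr_mono2 divide_right_mono) auto
      moreover have "(1 / L) powr (2/3) = \<delta>"
        using L3 by (simp add: \<delta>_def powr_divide powr_minus_divide)
      ultimately show ?thesis by simp
    qed
    show ?case
    proof
      fix x
      have "skew_coeff L * edgeworth_term x = 3 powr (3/2) / (24 * sqrt (2 * pi)) * ((1 - x\<^sup>2) * exp (- x\<^sup>2 / 2)) / sqrt L"
        by (simp add: skew_coeff_def edgeworth_term_eq)
      then have "\<bar>invol_cdf n x - Phi x
         - 3 powr (3/2) / (24 * sqrt (2 * pi)) * ((1 - x\<^sup>2) * exp (- x\<^sup>2 / 2)) / sqrt L\<bar> = \<bar>invol_cdf n x - G x\<bar>"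
        by (simp add: G_def algebra_simps)
      also have "\<dots> \<le> (C + K + 7) * \<delta>" by (rule main)
      also have "\<dots> \<le> (C + K + 7) * (ln L / L) powr (2/3)"
        using \<delta>_le C(1) K(1) by (intro mult_left_mono) auto
      finally show "\<bar>invol_cdf n x - Phi x
         - 3 powr (3/2) / (24 * sqrt (2 * pi)) * ((1 - x\<^sup>2) * exp (- x\<^sup>2 / 2)) / sqrt (ln (real n))\<bar>
       \<le> (C + K + 7) * (ln (ln (real n)) / ln (real n)) powr (2/3)" unfolding L_def .
    qed
  qed
  then show ?thesis unfolding eventually_sequentially by blast
qed

end
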